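(* Let $f$ be the germ at the origin of a real-analytic, symplectic, planar map with an elliptic fixed point at the origin, having rational rotation number $\omega_0=\frac{p}{q}\in(0,\tfrac12)$, $\gcd(p,q)=1$, $q\ge3$. Suppose $f$ admits a real-analytic first integral $I_1$ with a non-degenerate local minimum at $(0,0)$. Then $f$ is real-analytically, symplectically, conjugate, in a neighbourhood of the origin, to a map which, in polar coordinates, is $$f_{\nu\nu\nu}(r,\theta)=\big(r,\ \theta+\Omega(r^2)\big),$$ where $\Omega$ is real-analytic with $\Omega(0)=\tfrac{2\pi p}{q}$.
   Context: A real-analytic planar map germ $f$ with $f(0,0)=(0,0)$ has an elliptic fixed point at the origin with rotation number $\omega_0\in(0,\tfrac12)$ if the eigenvalues of its linear part $L=d_{(0,0)}f$ are $\mu=e^{i2\pi\omega_0}$ and $\bar\mu$. The plane is identified with $\mathbb{C}$ via $z=x+iy$, and it is assumed that in this coordinate $L(z)=\mu z$. Polar coordinates are given by $w=re^{i\theta}$. Symplectic means preserving $dx\wedge dy$. A first integral of $f$ is a function $I$ defined in a neighbourhood of the origin with $I\circ f=I$ near the origin. A non-degenerate local minimum at $(0,0)$ means a critical point there with positive definite Hessian. Two germs $f,g$ fixing the origin are real-analytically, symplectically, conjugate if there is a germ of real-analytic diffeomorphism $\phi$ fixing the origin and preserving $dx\wedge dy$ with $\phi^{-1}\circ f\circ\phi=g$. *)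

theory Defs
  imports "HOL-Analysis.Analysis"
begin

text \<open>The plane is the type \<^typ>\<open>complex\<close>, regarded as a real vector space with the coordinates
  $x = \mathrm{Re}\,z$, $y = \mathrm{Im}\,z$.  A germ at the origin is represented by a total
  function, and every condition on it is imposed only near the origin.\<close>

text \<open>Real-analyticity in the two real variables $(x,y)$: the germ at the origin is the sum of a
  convergent double power series.\<close>

definition real_analytic_germ :: "(complex \<Rightarrow> 'b::real_normed_vector) \<Rightarrow> bool" where
  "real_analytic_germ f \<longleftrightarrow>
     (\<exists>c :: nat \<Rightarrow> nat \<Rightarrow> 'b. \<forall>\<^sub>F z in nhds 0.
        ((\<lambda>(j, k). (Re z ^ j * Im z ^ k) *\<^sub>R c j k) has_sum f z) UNIV)"

definition area_form :: "complex \<Rightarrow> complex \<Rightarrow> real" where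
  "area_form u v = Re u * Im v - Im u * Re v"

definition symplectic_germ :: "(complex \<Rightarrow> complex) \<Rightarrow> bool" where
  "symplectic_germ f \<longleftrightarrow>
     (\<forall>\<^sub>F z in nhds 0. \<exists>D. (f has_derivative D) (at z) \<and>
        (\<forall>u v. area_form (D u) (D v) = area_form u v))"

text \<open>Eigenvalues of the matrix of a real-linear map of the plane with respect to the real basis
  $(1, i)$; the eigenvectors $(a,b)$ range over the complexification $\mathbb{C}^2$ of the plane.\<close>

definition plane_eigenvalues :: "(complex \<Rightarrow> complex) \<Rightarrow> complex set" where
  "plane_eigenvalues L =
     {l. \<exists>a b. (a, b) \<noteq> (0, 0) \<and>
           of_real (Re (L 1)) * a + of_real (Re (L \<i>)) * b = l * a \<and>
           of_real (Im (L 1)) * a + of_real (Im (L \<i>)) * b = l * b}"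

definition elliptic_fixed_point :: "(complex \<Rightarrow> complex) \<Rightarrow> real \<Rightarrow> bool" where
  "elliptic_fixed_point f \<omega> \<longleftrightarrow>
     0 < \<omega> \<and> \<omega> < 1 / 2 \<and> f 0 = 0 \<and>
     (\<exists>L. (f has_derivative L) (at 0) \<and>
          plane_eigenvalues L = {cis (2 * pi * \<omega>), cnj (cis (2 * pi * \<omega>))})"

definition first_integral :: "(complex \<Rightarrow> complex) \<Rightarrow> (complex \<Rightarrow> real) \<Rightarrow> bool" where
  "first_integral f I \<longleftrightarrow> (\<forall>\<^sub>F z in nhds 0. I (f z) = I z)"

text \<open>\<open>D\<close> is the differential of \<open>I\<close> near the origin and \<open>H\<close> its derivative at the origin, so that
  \<open>(u, v) \<mapsto> H u v\<close> is the Hessian bilinear form.\<close>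

definition nondegenerate_local_min :: "(complex \<Rightarrow> real) \<Rightarrow> bool" where
  "nondegenerate_local_min I \<longleftrightarrow>
     (\<exists>(D :: complex \<Rightarrow> complex \<Rightarrow>\<^sub>L real) (H :: complex \<Rightarrow> complex \<Rightarrow>\<^sub>L real).
        (\<forall>\<^sub>F z in nhds 0. (I has_derivative blinfun_apply (D z)) (at z)) \<and>
        D 0 = 0 \<and> (D has_derivative H) (at 0) \<and>
        (\<forall>v. v \<noteq> 0 \<longrightarrow> blinfun_apply (H v) v > 0))"

definition analytic_symplectic_conjugate ::
    "(complex \<Rightarrow> complex) \<Rightarrow> (complex \<Rightarrow> complex) \<Rightarrow> bool" where
  "analytic_symplectic_conjugate f g \<longleftrightarrow>
     (\<exists>\<phi> \<psi>. \<phi> 0 = 0 \<and> \<psi> 0 = 0 \<and>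
        real_analytic_germ \<phi> \<and> real_analytic_germ \<psi> \<and>
        (\<forall>\<^sub>F z in nhds 0. \<psi> (\<phi> z) = z \<and> \<phi> (\<psi> z) = z) \<and>
        symplectic_germ \<phi> \<and>
        (\<forall>\<^sub>F z in nhds 0. \<psi> (f (\<phi> z)) = g z))"

end

theory Submission
  imports Defs "HOL-Complex_Analysis.Complex_Analysis"
begin

text \<open>The invariance of \<open>I\<^sub>1\<close> under the rotation by \<open>2\<pi>p/q\<close>, whose square is not the identity,
  forces its Hessian at the origin to be a multiple of the identity.  An analytic Morse coordinate
  tangent to the identity turns \<open>I\<^sub>1\<close> into a function of \<open>\<bar>z\<bar>\<^sup>2\<close> and the area form into
  \<open>g dx dy\<close>; a second change of coordinates, explicit in polar coordinates and permuting the
  circles, turns \<open>g dx dy\<close> into \<open>dx dy\<close>, where the primitive of \<open>g - mean g\<close> along the circles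
  is found coefficientwise in the expansion in \<open>z\<close> and \<open>cnj z\<close>.  In the resulting symplectic
  coordinates \<open>f\<close> preserves every circle, hence has the form \<open>z \<mapsto> z \<mu> e\<^bsup>ih(z)\<^esup>\<close>, and preservation
  of area means \<open>\<partial>h/\<partial>\<theta> = 0\<close>, so \<open>h\<close> is an analytic function of \<open>\<bar>z\<bar>\<^sup>2\<close>.\<close>

section \<open>Double power series\<close>

text \<open>Resonance does no harm because f is never normalised degree by degree: the integral is
  straightened as a whole, and the rotation number enters only through \<mu>^2 \<noteq> 1, which
  removes the z^2 part of the Hessian. The Morse coordinate ignores area. Its correction may then
  only permute the circles, or the straightening would be lost; this leaves one radial function and
  one angular shift, just enough to absorb the angular mean of the density and its remainder. No
  small divisors occur: the angular primitive divides the coefficient of z^j (cnj z)^k by \<i> (j -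
  k), of modulus at least 1 off the diagonal. To keep inverses, roots and logarithms analytic, z and
  cnj z are treated as independent complex variables z and w. Then analyticity follows from mere
  complex differentiability, and an identity valid for w = cnj z holds on a full bidisc, where it
  can be evaluated at z = 0 or compared coefficientwise.\<close>

definition geom_bounded :: "(nat \<Rightarrow> nat \<Rightarrow> complex) \<Rightarrow> real \<Rightarrow> bool" where
  "geom_bounded c R \<longleftrightarrow> (\<exists>M. \<forall>j k. norm (c j k) * R ^ (j + k) \<le> M)"

text \<open>The sum is unordered, so only absolute convergence counts;
  \<open>geom_bounded c R\<close> supplies it on the open bidisc of radius R.\<close>

definition psum :: "(nat \<Rightarrow> nat \<Rightarrow> complex) \<Rightarrow> complex \<Rightarrow> complex \<Rightarrow> complex" where
  "psum c z w = (\<Sum>\<^sub>\<infinity>(j, k). c j k * z ^ j * w ^ k)"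

lemma geometric_double_summable:
  fixes a b :: real
  assumes "0 \<le> a" "a < 1" "0 \<le> b" "b < 1"
  shows "(\<lambda>(j, k). a ^ j * b ^ k) summable_on (UNIV :: (nat \<times> nat) set)"
proof -
  have g: "((\<lambda>j. x ^ j) has_sum (1 / (1 - x))) UNIV" if "0 \<le> x" "x < 1" for x :: real
    using geometric_sums[of x] that by (intro sums_nonneg_imp_has_sum) auto
  have "(\<lambda>(j, k). a ^ j * b ^ k) summable_on (UNIV \<times> UNIV)"
  proof (rule summable_on_SigmaI)
    show "((\<lambda>k. (case (j, k) of (j, k) \<Rightarrow> a ^ j * b ^ k)) has_sum (a ^ j * (1 / (1 - b)))) UNIV"
      for j :: nat
      using has_sum_cmult_right[OF g[OF assms(3,4)], of "a ^ j"] by simp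
    show "(\<lambda>j. a ^ j * (1 / (1 - b))) summable_on UNIV"
      using has_sum_cmult_left[OF g[OF assms(1,2)], of "1 / (1 - b)"] by (auto simp: summable_on_def)
  qed (use assms in auto)
  then show ?thesis by simp
qed

lemma psum_abs_summable:
  assumes "geom_bounded c R" "norm z < R" "norm w < R"
  shows "(\<lambda>x. norm (case x of (j, k) \<Rightarrow> c j k * z ^ j * w ^ k)) summable_on UNIV"
proof -
  have R: "R > 0" using assms(2) norm_ge_zero[of z] by linarith
  obtain M where M: "\<And>j k. norm (c j k) * R ^ (j + k) \<le> M"
    using assms(1) unfolding geom_bounded_def by blast
  have "(\<lambda>(j, k). (norm z / R) ^ j * (norm w / R) ^ k) summable_on (UNIV :: (nat \<times> nat) set)"
    by (rule geometric_double_summable) (use assms R in auto)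
  then have s: "(\<lambda>x. M * (case x of (j, k) \<Rightarrow> (norm z / R) ^ j * (norm w / R) ^ k))
      summable_on (UNIV :: (nat \<times> nat) set)"
    by (rule summable_on_cmult_right)
  show ?thesis
  proof (rule Infinite_Sum.abs_summable_on_comparison_test'[OF s])
    fix x :: "nat \<times> nat"
    obtain j k where x: "x = (j, k)" by force
    have "norm (c j k * z ^ j * w ^ k)
        = (norm (c j k) * R ^ (j + k)) * ((norm z / R) ^ j * (norm w / R) ^ k)"
      using R by (simp add: norm_mult norm_power power_add power_divide)
    also have "\<dots> \<le> M * ((norm z / R) ^ j * (norm w / R) ^ k)"
      using R by (intro mult_right_mono M) auto
    finally show "norm (case x of (j, k) \<Rightarrow> c j k * z ^ j * w ^ k)
        \<le> M * (case x of (j, k) \<Rightarrow> (norm z / R) ^ j * (norm w / R) ^ k)"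
      by (simp add: x)
  qed
qed

lemma psum_has_sum:
  assumes "geom_bounded c R" "norm z < R" "norm w < R"
  shows "((\<lambda>(j, k). c j k * z ^ j * w ^ k) has_sum psum c z w) UNIV"
  unfolding psum_def
  using abs_summable_summable[OF psum_abs_summable[OF assms]] by (rule has_sum_infsum)

lemma geom_bounded_row:
  assumes "geom_bounded c R" "R > 0"
  shows "\<exists>M. \<forall>k. norm (c j k) * R ^ k \<le> M"
proof -
  obtain M where M: "\<And>j k. norm (c j k) * R ^ (j + k) \<le> M"
    using assms(1) unfolding geom_bounded_def by blast
  have "norm (c j k) * R ^ k \<le> M / R ^ j" for k
    using M[of j k] assms(2) by (simp add: field_simps power_add)
  then show ?thesis by blast
qed

lemma psum_row_has_sum:
  assumes "geom_bounded c R" "norm w < R"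
  shows "((\<lambda>k. c j k * w ^ k) has_sum (\<Sum>k. c j k * w ^ k)) UNIV"
proof -
  have R: "R > 0" using assms(2) norm_ge_zero[of w] by linarith
  obtain M where M: "\<And>k. norm (c j k) * R ^ k \<le> M"
    using geom_bounded_row[OF assms(1) R] by blast
  have "summable (\<lambda>k. norm (c j k * w ^ k))"
  proof (rule summable_comparison_test)
    show "summable (\<lambda>k. M * (norm w / R) ^ k)"
      using assms R by (intro summable_mult summable_geometric) auto
    show "\<exists>N. \<forall>n\<ge>N. norm (norm (c j n * w ^ n)) \<le> M * (norm w / R) ^ n"
    proof (intro exI allI impI)
      fix n :: nat
      have "norm (norm (c j n * w ^ n)) = (norm (c j n) * R ^ n) * (norm w / R) ^ n"
        using R by (simp add: norm_mult norm_power power_divide)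
      also have "\<dots> \<le> M * (norm w / R) ^ n"
        using R by (intro mult_right_mono M) auto
      finally show "norm (norm (c j n * w ^ n)) \<le> M * (norm w / R) ^ n" .
    qed
  qed
  then show ?thesis
    by (intro norm_summable_imp_has_sum) (auto dest: summable_norm_cancel summable_sums)
qed

text \<open>Summing over k first leaves a power series in z whose coefficients depend on w, which
  opens the way to one-variable results.\<close>

lemma psum_sums:
  assumes "geom_bounded c R" "norm z < R" "norm w < R"
  shows "(\<lambda>j. (\<Sum>k. c j k * w ^ k) * z ^ j) sums psum c z w"
proof -
  have a: "((\<lambda>(j, k). c j k * z ^ j * w ^ k) has_sum psum c z w) (UNIV \<times> UNIV)"
    using psum_has_sum[OF assms] by simp
  have b: "((\<lambda>k. (case (j, k) of (j, k) \<Rightarrow> c j k * z ^ j * w ^ k)) has_sum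
      ((\<Sum>k. c j k * w ^ k) * z ^ j)) UNIV" for j
    using has_sum_cmult_left[OF psum_row_has_sum[OF assms(1,3), of j], of "z ^ j"]
    by (simp add: mult_ac)
  have "((\<lambda>j. (\<Sum>k. c j k * w ^ k) * z ^ j) has_sum psum c z w) UNIV"
    by (rule has_sum_SigmaD[OF a b])
  then show ?thesis by (rule has_sum_imp_sums)
qed

lemma geom_bounded_shift1:
  assumes "geom_bounded c R" "R > 0"
  shows "geom_bounded (\<lambda>j k. c (Suc j) k) R"
proof -
  obtain M where M: "\<And>j k. norm (c j k) * R ^ (j + k) \<le> M"
    using assms(1) unfolding geom_bounded_def by blast
  have "norm (c (Suc j) k) * R ^ (j + k) \<le> M / R" for j k
    using M[of "Suc j" k] assms(2) by (simp add: field_simps)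
  then show ?thesis unfolding geom_bounded_def by blast
qed

text \<open>Together with \<open>psum_swap\<close> this exchanges the roles of the variables, so
  that facts about the second one are read off from the first.\<close>

lemma geom_bounded_swap: "geom_bounded (\<lambda>j k. c k j) R \<longleftrightarrow> geom_bounded c R"
  unfolding geom_bounded_def by (subst all_comm) (simp add: add.commute)

lemma psum_swap: "psum (\<lambda>j k. c k j) z w = psum c w z"
  unfolding psum_def
  by (rule infsum_reindex_bij_witness[where i = prod.swap and j = prod.swap]) (auto simp: mult_ac)

text \<open>Hadamard's lemma on coefficients: the terms without z are the value at z = 0, and all
  others are divisible by z.\<close>

lemma psum_shift1:
  assumes "geom_bounded c R" "norm z < R" "norm w < R"
  shows "psum c z w = psum c 0 w + z * psum (\<lambda>j k. c (Suc j) k) z w"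
proof -
  have R: "R > 0" using assms(2) norm_ge_zero[of z] by linarith
  let ?a = "\<lambda>j. (\<Sum>k. c j k * w ^ k)"
  have s: "(\<lambda>j. ?a j * z ^ j) sums psum c z w" by (rule psum_sums[OF assms])
  have s0: "(\<lambda>j. ?a j * 0 ^ j) sums psum c 0 w"
    by (rule psum_sums[OF assms(1) _ assms(3)]) (use R in simp)
  have "(\<lambda>j. ?a j * 0 ^ j) sums (?a 0)"
    using powser_sums_zero[of ?a] by simp
  then have e0: "psum c 0 w = ?a 0" using s0 sums_unique2 by blast
  have "(\<lambda>j. ?a (Suc j) * z ^ j) sums psum (\<lambda>j k. c (Suc j) k) z w"
    by (rule psum_sums[OF geom_bounded_shift1[OF assms(1) R] assms(2,3)])
  then have "(\<lambda>j. z * (?a (Suc j) * z ^ j)) sums (z * psum (\<lambda>j k. c (Suc j) k) z w)"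
    by (rule sums_mult)
  then have "(\<lambda>j. ?a (Suc j) * z ^ (Suc j)) sums (z * psum (\<lambda>j k. c (Suc j) k) z w)"
    by (simp add: mult_ac)
  then have "(\<lambda>j. ?a j * z ^ j) sums (z * psum (\<lambda>j k. c (Suc j) k) z w + ?a 0 * z ^ 0)"
    by (subst (asm) sums_Suc_iff) simp
  then show ?thesis using s sums_unique2 e0 by fastforce
qed

section \<open>Termwise differentiation of double power series\<close>

lemma nat_mult_power_bounded:
  fixes x :: real
  assumes "0 \<le> x" "x < 1"
  shows "\<exists>C. \<forall>n. real n * x ^ n \<le> C"
proof -
  have "(\<lambda>n. real n * x ^ n) \<longlonglongrightarrow> 0"
    using powser_times_n_limit_0[of x] assms by simp
  then have "Bseq (\<lambda>n. real n * x ^ n)"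
    using convergent_imp_Bseq convergentI by blast
  then obtain K where "\<And>n. norm (real n * x ^ n) \<le> K" by (rule BseqE) blast
  then have "real n * x ^ n \<le> K" for n
    using abs_ge_self[of "real n * x ^ n"] by (force intro: order_trans)
  then show ?thesis by blast
qed

text \<open>The index gained by differentiation is absorbed by the decay of (r / R)^n, at the price
  of a smaller radius.\<close>

lemma geom_bounded_deriv1:
  assumes "geom_bounded c R" "0 < r" "r < R"
  shows "geom_bounded (\<lambda>j k. of_nat (Suc j) * c (Suc j) k) r"
proof -
  obtain M where M: "\<And>j k. norm (c j k) * R ^ (j + k) \<le> M"
    using assms(1) unfolding geom_bounded_def by blast
  have M0: "M \<ge> 0" using M[of 0 0] norm_ge_zero[of "c 0 0"] by (simp del: norm_ge_zero)
  obtain C where C: "\<And>n. real n * (r / R) ^ n \<le> C"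
    using nat_mult_power_bounded[of "r / R"] assms by auto
  have "norm (of_nat (Suc j) * c (Suc j) k) * r ^ (j + k) \<le> C * M / r" for j k
  proof -
    have "norm (of_nat (Suc j) * c (Suc j) k) * r ^ (j + k) * r
      = (real (Suc j) * (r / R) ^ (Suc j)) * ((r / R) ^ k * (norm (c (Suc j) k) * R ^ (Suc j + k)))"
      using assms unfolding norm_mult norm_of_nat power_add power_Suc power_divide
      by (simp add: field_simps)
    also have "\<dots> \<le> C * (1 * M)"
    proof (intro mult_mono C M)
      show "(r / R) ^ k \<le> 1" using assms by (intro power_le_one) auto
      show "0 \<le> C" using C[of 0] by simp
    qed (use assms M0 in auto)
    finally show ?thesis using assms by (simp add: field_simps)
  qed
  then show ?thesis unfolding geom_bounded_def by blast
qed

lemma geom_bounded_deriv2: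
  assumes "geom_bounded c R" "0 < r" "r < R"
  shows "geom_bounded (\<lambda>j k. of_nat (Suc k) * c j (Suc k)) r"
  using geom_bounded_deriv1[of "\<lambda>j k. c k j" R r] assms
    geom_bounded_swap[of c R] geom_bounded_swap[of "\<lambda>j k. of_nat (Suc k) * c j (Suc k)" r]
  by simp

lemma has_sum_shift_fst:
  assumes "\<And>k. g (0, k) = 0"
  shows "((g :: nat \<times> nat \<Rightarrow> 'a :: {comm_monoid_add,topological_space}) has_sum S) UNIV \<longleftrightarrow>
    ((\<lambda>(j, k). g (Suc j, k)) has_sum S) UNIV"
proof -
  have "(g has_sum S) UNIV \<longleftrightarrow> (g has_sum S) ({1..} \<times> UNIV)"
    using assms by (intro has_sum_cong_neutral) (auto simp: Suc_le_eq intro!: gr0I)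
  also have "\<dots> \<longleftrightarrow> ((\<lambda>(j, k). g (Suc j, k)) has_sum S) UNIV"
    by (rule has_sum_reindex_bij_witness[where i = "\<lambda>(j, k). (Suc j, k)" and j = "\<lambda>(j, k). (j - 1, k)"])
      auto
  finally show ?thesis .
qed

text \<open>The indices of c stay unshifted so that this series can be compared term by term with
  that of \<open>psum c\<close>. The truncated exponent j - 1 at j = 0 is harmless, since the factor
  j vanishes there.\<close>

lemma psum_deriv1_has_sum:
  assumes "geom_bounded c R" "norm z < R" "norm w < R"
  shows "((\<lambda>(j, k). of_nat j * c j k * z ^ (j - 1) * w ^ k) has_sum
      psum (\<lambda>j k. of_nat (Suc j) * c (Suc j) k) z w) UNIV"
    and "(\<lambda>x. norm (case x of (j, k) \<Rightarrow> of_nat j * c j k * z ^ (j - 1) * w ^ k)) summable_on UNIV"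
proof -
  obtain r where r: "norm z < r" "norm w < r" "r < R"
    using assms dense[of "max (norm z) (norm w)" R] by auto
  then have r0: "0 < r" using norm_ge_zero[of z] by linarith
  note b = geom_bounded_deriv1[OF assms(1) r0 r(3)]
  show "((\<lambda>(j, k). of_nat j * c j k * z ^ (j - 1) * w ^ k) has_sum
      psum (\<lambda>j k. of_nat (Suc j) * c (Suc j) k) z w) UNIV"
    by (subst has_sum_shift_fst) (use psum_has_sum[OF b r(1,2)] in auto)
  obtain S where "((\<lambda>x. norm (case x of (j, k) \<Rightarrow> of_nat (Suc j) * c (Suc j) k * z ^ j * w ^ k))
      has_sum S) UNIV"
    using psum_abs_summable[OF b r(1,2)] unfolding summable_on_def by blast
  then have "((\<lambda>x. norm (case x of (j, k) \<Rightarrow> of_nat j * c j k * z ^ (j - 1) * w ^ k)) has_sum S) UNIV"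
    by (subst has_sum_shift_fst) (auto simp: case_prod_unfold)
  then show "(\<lambda>x. norm (case x of (j, k) \<Rightarrow> of_nat j * c j k * z ^ (j - 1) * w ^ k)) summable_on UNIV"
    unfolding summable_on_def by blast
qed

lemma psum_deriv2_has_sum:
  assumes "geom_bounded c R" "norm z < R" "norm w < R"
  shows "((\<lambda>(j, k). of_nat k * c j k * z ^ j * w ^ (k - 1)) has_sum
      psum (\<lambda>j k. of_nat (Suc k) * c j (Suc k)) z w) UNIV"
    and "(\<lambda>x. norm (case x of (j, k) \<Rightarrow> of_nat k * c j k * z ^ j * w ^ (k - 1))) summable_on UNIV"
proof -
  have b: "geom_bounded (\<lambda>j k. c k j) R" using assms(1) geom_bounded_swap by blast
  note p = psum_deriv1_has_sum[OF b assms(3,2)]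
  have e: "psum (\<lambda>j k. of_nat (Suc j) * c k (Suc j)) w z = psum (\<lambda>j k. of_nat (Suc k) * c j (Suc k)) z w"
    by (rule psum_swap[of "\<lambda>j k. of_nat (Suc k) * c j (Suc k)"])
  show "((\<lambda>(j, k). of_nat k * c j k * z ^ j * w ^ (k - 1)) has_sum
      psum (\<lambda>j k. of_nat (Suc k) * c j (Suc k)) z w) UNIV"
    using p(1) unfolding e
    by (subst has_sum_reindex_bij_witness[where i = prod.swap and j = prod.swap and T = UNIV
          and h = "\<lambda>(j, k). of_nat j * c k j * w ^ (j - 1) * z ^ k"]) (auto simp: mult_ac)
  show "(\<lambda>x. norm (case x of (j, k) \<Rightarrow> of_nat k * c j k * z ^ j * w ^ (k - 1))) summable_on UNIV"
    using p(2)
    by (subst summable_on_reindex_bij_witness[where i = prod.swap and j = prod.swap and T = UNIV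
          and h = "\<lambda>x. norm (case x of (j, k) \<Rightarrow> of_nat j * c k j * w ^ (j - 1) * z ^ k)"])
      (auto simp: norm_mult mult_ac)
qed

text \<open>Enumerating the index pairs turns an unordered double sum into a sequential series, the
  form required by the M-test and by \<open>has_derivative_series\<close>.\<close>

lemma has_sum_imp_sums_prod_decode:
  assumes "(f has_sum S) UNIV"
  shows "(\<lambda>n. f (prod_decode n)) sums S"
  by (rule has_sum_imp_sums) (use assms has_sum_reindex_bij_betw[OF bij_prod_decode] in blast)

lemma summable_on_imp_summable_prod_decode:
  assumes "f summable_on UNIV"
  shows "summable (\<lambda>n. f (prod_decode n))"
  using assms has_sum_imp_sums_prod_decode unfolding summable_on_def summable_def by blast

lemma psum_has_derivative:
  assumes "geom_bounded c R" "norm z < R" "norm w < R"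
  shows "((\<lambda>p. psum c (fst p) (snd p)) has_derivative
     (\<lambda>h. psum (\<lambda>j k. of_nat (Suc j) * c (Suc j) k) z w * fst h
        + psum (\<lambda>j k. of_nat (Suc k) * c j (Suc k)) z w * snd h)) (at (z, w))"
proof -
  obtain r where r: "norm z < r" "norm w < r" "r < R"
    using assms dense[of "max (norm z) (norm w)" R] by auto
  then have r0: "0 < r" using norm_ge_zero[of z] by linarith
  define S where "S = ball (0::complex) r \<times> ball (0::complex) r"
  have S: "convex S" "open S" "(z, w) \<in> S"
    using r by (auto simp: S_def intro: convex_Times open_Times)
  let ?j = "\<lambda>n. fst (prod_decode n)" and ?k = "\<lambda>n. snd (prod_decode n)"
  let ?c1 = "\<lambda>j k. of_nat (Suc j) * c (Suc j) k" and ?c2 = "\<lambda>j k. of_nat (Suc k) * c j (Suc k)"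
  define f where "f = (\<lambda>n p. c (?j n) (?k n) * fst p ^ ?j n * snd p ^ ?k n)"
  define A where "A = (\<lambda>n p. of_nat (?j n) * c (?j n) (?k n) * fst p ^ (?j n - 1) * snd p ^ ?k n)"
  define B where "B = (\<lambda>n p. of_nat (?k n) * c (?j n) (?k n) * fst p ^ ?j n * snd p ^ (?k n - 1))"
  have in_S: "norm (fst p) < r \<and> norm (snd p) < r" if "p \<in> S" for p
    using that by (auto simp: S_def)
  have lt: "norm (of_real r :: complex) < R" using r r0 by simp
  have powr: "norm (u ^ n) \<le> norm ((of_real r :: complex) ^ n)" if "norm u < r" for u :: complex and n
    using that r0 by (auto simp: norm_power intro!: power_mono)
  \<comment> \<open>Every term on the bidisc S is dominated by its value at the corner (r, r), where
    the derivative series converges absolutely because r < R.\<close>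
  have unifA: "uniform_limit S (\<lambda>n p. \<Sum>i<n. A i p) (\<lambda>p. suminf (\<lambda>i. A i p)) sequentially"
  proof (rule Weierstrass_m_test)
    show "norm (A n p) \<le> norm (A n (of_real r, of_real r))" if "p \<in> S" for n p
      using in_S[OF that] powr unfolding A_def fst_conv snd_conv norm_mult
      by (intro mult_mono mult_nonneg_nonneg norm_ge_zero order_refl) auto
    show "summable (\<lambda>n. norm (A n (complex_of_real r, complex_of_real r)))"
      using summable_on_imp_summable_prod_decode[OF psum_deriv1_has_sum(2)[OF assms(1) lt lt]]
      by (simp add: A_def case_prod_unfold)
  qed
  have unifB: "uniform_limit S (\<lambda>n p. \<Sum>i<n. B i p) (\<lambda>p. suminf (\<lambda>i. B i p)) sequentially"
  proof (rule Weierstrass_m_test)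
    show "norm (B n p) \<le> norm (B n (of_real r, of_real r))" if "p \<in> S" for n p
      using in_S[OF that] powr unfolding B_def fst_conv snd_conv norm_mult
      by (intro mult_mono mult_nonneg_nonneg norm_ge_zero order_refl) auto
    show "summable (\<lambda>n. norm (B n (complex_of_real r, complex_of_real r)))"
      using summable_on_imp_summable_prod_decode[OF psum_deriv2_has_sum(2)[OF assms(1) lt lt]]
      by (simp add: B_def case_prod_unfold)
  qed
  have pR: "norm (fst p) < R" "norm (snd p) < R" if "p \<in> S" for p
    using in_S[OF that] r by auto
  have sA: "(\<lambda>n. A n p) sums psum ?c1 (fst p) (snd p)" if "p \<in> S" for p
    using has_sum_imp_sums_prod_decode[OF psum_deriv1_has_sum(1)[OF assms(1) pR[OF that]]]
    by (simp add: A_def case_prod_unfold)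
  have sB: "(\<lambda>n. B n p) sums psum ?c2 (fst p) (snd p)" if "p \<in> S" for p
    using has_sum_imp_sums_prod_decode[OF psum_deriv2_has_sum(1)[OF assms(1) pR[OF that]]]
    by (simp add: B_def case_prod_unfold)
  have sf: "(\<lambda>n. f n p) sums psum c (fst p) (snd p)" if "p \<in> S" for p
    using has_sum_imp_sums_prod_decode[OF psum_has_sum[OF assms(1) pR[OF that]]]
    by (simp add: f_def case_prod_unfold)
  define g' where "g' = (\<lambda>p h. psum ?c1 (fst p) (snd p) * fst h + psum ?c2 (fst p) (snd p) * snd h)"
  have "\<exists>g. \<forall>p\<in>S. (\<lambda>n. f n p) sums (g p) \<and> (g has_derivative g' p) (at p within S)"
  proof (rule has_derivative_series[where f' = "\<lambda>n p h. A n p * fst h + B n p * snd h" and x = "(z, w)"])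
    show "(f n has_derivative (\<lambda>h. A n p * fst h + B n p * snd h)) (at p within S)" for n p
      unfolding f_def A_def B_def
      by (auto intro!: derivative_eq_intros ext simp: algebra_simps)
    show "convex S" "(z, w) \<in> S" "(\<lambda>n. f n (z, w)) sums psum c (fst (z, w)) (snd (z, w))"
      using S sf by blast+
    show "\<forall>\<^sub>F n in sequentially. \<forall>x\<in>S. \<forall>h.
        norm ((\<Sum>i<n. A i x * fst h + B i x * snd h) - g' x h) \<le> e * norm h" if e: "e > 0" for e
    proof -
      have "\<forall>\<^sub>F n in sequentially. \<forall>x\<in>S. dist (\<Sum>i<n. A i x) (suminf (\<lambda>i. A i x)) < e / 2"
        "\<forall>\<^sub>F n in sequentially. \<forall>x\<in>S. dist (\<Sum>i<n. B i x) (suminf (\<lambda>i. B i x)) < e / 2"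
        using uniform_limitD[OF unifA, of "e/2"] uniform_limitD[OF unifB, of "e/2"] e by auto
      then show ?thesis
      proof eventually_elim
        case (elim n)
        show ?case
        proof (intro ballI allI)
          fix x h assume x: "x \<in> S"
          have a: "norm ((\<Sum>i<n. A i x) - psum ?c1 (fst x) (snd x)) \<le> e / 2"
            "norm ((\<Sum>i<n. B i x) - psum ?c2 (fst x) (snd x)) \<le> e / 2"
            using elim x sums_unique[OF sA[OF x]] sums_unique[OF sB[OF x]] by (auto simp: dist_norm less_imp_le)
          have "(\<Sum>i<n. A i x * fst h + B i x * snd h) - g' x h
            = ((\<Sum>i<n. A i x) - psum ?c1 (fst x) (snd x)) * fst h
             + ((\<Sum>i<n. B i x) - psum ?c2 (fst x) (snd x)) * snd h"
            by (simp add: g'_def sum.distrib sum_distrib_left algebra_simps)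
          also have "norm \<dots> \<le> e / 2 * norm h + e / 2 * norm h"
            unfolding norm_mult[symmetric]
            by (rule norm_triangle_le, unfold norm_mult, intro add_mono mult_mono a)
              (use e norm_fst_le[of "fst h" "snd h"] norm_snd_le[of "snd h" "fst h"] in auto)
          finally show "norm ((\<Sum>i<n. A i x * fst h + B i x * snd h) - g' x h) \<le> e * norm h"
            by simp
        qed
      qed
    qed
  qed
  then obtain g where g: "\<And>p. p \<in> S \<Longrightarrow> (\<lambda>n. f n p) sums (g p)"
    "\<And>p. p \<in> S \<Longrightarrow> (g has_derivative g' p) (at p within S)" by blast
  have g_eq: "g p = psum c (fst p) (snd p)" if "p \<in> S" for p
    using g(1)[OF that] sf[OF that] sums_unique2 by blast
  have "(g has_derivative g' (z, w)) (at (z, w))"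
    using g(2)[OF S(3)] at_within_open[OF S(3,2)] by simp
  then have "((\<lambda>p. psum c (fst p) (snd p)) has_derivative g' (z, w)) (at (z, w))"
    by (rule has_derivative_transform_within_open[OF _ S(2,3) g_eq])
  then show ?thesis by (simp add: g'_def)
qed

section \<open>Germs of holomorphic functions of two variables\<close>

text \<open>Only complex differentiability near the origin is demanded, with no continuity of a and
  b in p. This makes closure under composition a plain chain rule, while analyticity is recovered in
  \<open>holo2_expansion\<close>.\<close>

definition holo2 :: "(complex \<times> complex \<Rightarrow> complex) \<Rightarrow> bool" where
  "holo2 F \<longleftrightarrow> (\<forall>\<^sub>F p in nhds 0. \<exists>a b. (F has_derivative (\<lambda>h. a * fst h + b * snd h)) (at p))"

lemma eventually_nhds_polydisc:
  "(\<forall>\<^sub>F p in nhds (0 :: complex \<times> complex). P p) \<longleftrightarrow>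
     (\<exists>r>0. \<forall>z w. norm z < r \<longrightarrow> norm w < r \<longrightarrow> P (z, w))"
proof
  assume "\<forall>\<^sub>F p in nhds (0 :: complex \<times> complex). P p"
  then obtain d where d: "d > 0" "\<And>p. dist p 0 < d \<Longrightarrow> P p"
    unfolding eventually_nhds_metric by blast
  show "\<exists>r>0. \<forall>z w. norm z < r \<longrightarrow> norm w < r \<longrightarrow> P (z, w)"
  proof (intro exI[of _ "d/2"] conjI allI impI)
    fix z w :: complex assume "norm z < d / 2" "norm w < d / 2"
    then have "dist (z, w) 0 < d"
      using norm_Pair_le[of z w] by (simp add: dist_norm)
    then show "P (z, w)" by (rule d(2))
  qed (use d in auto)
next
  assume "\<exists>r>0. \<forall>z w. norm z < r \<longrightarrow> norm w < r \<longrightarrow> P (z, w)"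
  then obtain r where r: "r > 0" "\<And>z w. norm z < r \<Longrightarrow> norm w < r \<Longrightarrow> P (z, w)" by blast
  have "P p" if "dist p 0 < r" for p
    using r(2)[of "fst p" "snd p"] that norm_fst_le[of "fst p" "snd p"] norm_snd_le[of "snd p" "fst p"]
    by (simp add: dist_norm)
  then show "\<forall>\<^sub>F p in nhds (0 :: complex \<times> complex). P p"
    unfolding eventually_nhds_metric using r(1) by blast
qed

lemma holo2_psum:
  assumes "geom_bounded c R" "R > 0"
  shows "holo2 (\<lambda>p. psum c (fst p) (snd p))"
  unfolding holo2_def eventually_nhds_polydisc using psum_has_derivative[OF assms(1)] assms(2) by blast

section \<open>Power series expansion of holomorphic germs in two variables\<close>

lemma has_derivative_slice1:
  assumes "(F has_derivative (\<lambda>h. a * fst h + b * snd h)) (at (z, w))"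
  shows "((\<lambda>z. F (z, w)) has_field_derivative a) (at z)"
proof -
  have "((\<lambda>z. (z, w)) has_derivative (\<lambda>h. (h, 0))) (at z)"
    by (auto intro!: derivative_eq_intros)
  from has_derivative_compose[OF this assms] show ?thesis
    by (simp add: has_field_derivative_def mult_commute_abs)
qed

lemma has_derivative_slice2:
  assumes "(F has_derivative (\<lambda>h. a * fst h + b * snd h)) (at (z, w))"
  shows "((\<lambda>w. F (z, w)) has_field_derivative b) (at w)"
proof -
  have "((\<lambda>w. (z, w)) has_derivative (\<lambda>h. (0, h))) (at w)"
    by (auto intro!: derivative_eq_intros)
  from has_derivative_compose[OF this assms] show ?thesis
    by (simp add: has_field_derivative_def mult_commute_abs)
qed

text \<open>For |z| \<le> r / 2 the remainder beyond the n-th coefficient is z times a series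
  dominated by a geometric one of ratio 1/2. The bound involves the coefficients only through M, so
  it is uniform in any further parameter.\<close>

lemma power_series_tail_bound:
  fixes a :: "nat \<Rightarrow> complex"
  assumes s: "(\<lambda>j. a j * z ^ j) sums S" and b: "\<And>j. norm (a j) \<le> M / r ^ j"
    and z: "z \<noteq> 0" "norm z \<le> r / 2" and r: "r > 0"
  shows "norm ((S - (\<Sum>j<n. a j * z ^ j)) / z ^ n - a n) \<le> norm z * (2 * M / r ^ Suc n)"
proof -
  have "(\<lambda>j. a (j + Suc n) * z ^ (j + Suc n)) sums (S - (\<Sum>j<Suc n. a j * z ^ j))"
    using sums_split_initial_segment[OF s] .
  then have "(\<lambda>j. a (j + Suc n) * z ^ (j + Suc n) / z ^ n) sums ((S - (\<Sum>j<Suc n. a j * z ^ j)) / z ^ n)"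
    by (rule sums_divide)
  moreover have "(S - (\<Sum>j<Suc n. a j * z ^ j)) / z ^ n = (S - (\<Sum>j<n. a j * z ^ j)) / z ^ n - a n"
    using z by (simp add: field_simps)
  moreover have "a (j + Suc n) * z ^ (j + Suc n) / z ^ n = z * (a (j + Suc n) * z ^ j)" for j
    using z by (simp add: power_add field_simps)
  ultimately have t: "(\<lambda>j. z * (a (j + Suc n) * z ^ j)) sums ((S - (\<Sum>j<n. a j * z ^ j)) / z ^ n - a n)"
    by simp
  have g: "(\<lambda>j. norm z * (M / r ^ Suc n) * (1/2) ^ j) sums (norm z * (M / r ^ Suc n) * 2)"
    using sums_mult[OF geometric_sums[of "1/2 :: real"], of "norm z * (M / r ^ Suc n)"] by simp
  have le: "norm (z * (a (j + Suc n) * z ^ j)) \<le> norm z * (M / r ^ Suc n) * (1/2) ^ j" for j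
  proof -
    have "norm (z * (a (j + Suc n) * z ^ j)) \<le> norm z * ((M / r ^ (j + Suc n)) * (r / 2) ^ j)"
      unfolding norm_mult norm_power
      using b[of "j + Suc n"] z r by (intro mult_left_mono mult_mono power_mono) (auto intro: order_trans[OF norm_ge_zero])
    also have "\<dots> = norm z * (M / r ^ Suc n) * (1/2) ^ j"
      using r by (simp add: power_add field_simps)
    finally show ?thesis .
  qed
  have "norm ((S - (\<Sum>j<n. a j * z ^ j)) / z ^ n - a n) \<le> norm z * (M / r ^ Suc n) * 2"
    by (rule norm_sums_le[OF t g le])
  then show ?thesis by (simp add: mult_ac)
qed

text \<open>Expansion in z gives coefficients \<open>a n w\<close>. Their holomorphy in w comes by
  induction on n: \<open>a n\<close> is the uniform limit, as z tends to 0, of the quotients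
  \<open>Q z\<close>, which involve only F and earlier coefficients. No integral has to be
  differentiated under the sign. Cauchy's inequality, used once in each variable, then bounds the
  double coefficients.\<close>

lemma holo2_expansion:
  assumes "holo2 F"
  shows "\<exists>c R. R > 0 \<and> geom_bounded c R \<and> (\<forall>z w. norm z < R \<longrightarrow> norm w < R \<longrightarrow> F (z, w) = psum c z w)"
proof -
  obtain r0 where r0: "r0 > 0"
    and D: "\<And>z w. norm z < r0 \<Longrightarrow> norm w < r0 \<Longrightarrow>
      \<exists>a b. (F has_derivative (\<lambda>h. a * fst h + b * snd h)) (at (z, w))"
    using assms unfolding holo2_def eventually_nhds_polydisc by blast
  define r where "r = r0 / 2"
  have r: "r > 0" "r < r0" using r0 by (auto simp: r_def)
  have "isCont F p" if "p \<in> cball 0 r \<times> cball 0 r" for p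
    using D[of "fst p" "snd p"] that r by (force dest: has_derivative_continuous)
  then have contF: "continuous_on (cball 0 r \<times> cball 0 r) F"
    by (simp add: continuous_at_imp_continuous_on)
  then have "compact (F ` (cball 0 r \<times> cball 0 r))"
    by (intro compact_continuous_image compact_Times) auto
  then obtain M where "\<And>x. x \<in> F ` (cball 0 r \<times> cball 0 r) \<Longrightarrow> norm x \<le> M"
    by (meson bounded_iff compact_imp_bounded)
  then have M: "norm (F (z, w)) \<le> M" if "norm z \<le> r" "norm w \<le> r" for z w
    using that by auto
  have hol1: "(\<lambda>z. F (z, w)) holomorphic_on ball 0 r0" if "norm w \<le> r" for w
    unfolding holomorphic_on_open[OF open_ball]
    using D[of _ w] that r by (force dest: has_derivative_slice1)
  have hol2: "(\<lambda>w. F (z, w)) holomorphic_on ball 0 r0" if "norm z \<le> r" for z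
    unfolding holomorphic_on_open[OF open_ball]
    using D[of z] that r by (force dest: has_derivative_slice2)
  have sub: "ball 0 r \<subseteq> ball (0::complex) r0" "cball 0 r \<subseteq> ball (0::complex) r0" using r by auto
  define a where "a = (\<lambda>n w. (deriv ^^ n) (\<lambda>z. F (z, w)) 0 / fact n)"
  have a_bound: "norm (a n w) \<le> M / r ^ n" if "norm w \<le> r" for n w
  proof -
    have "norm ((deriv ^^ n) (\<lambda>z. F (z, w)) 0) \<le> fact n * M / r ^ n"
    proof (rule Cauchy_inequality)
      show "continuous_on (cball 0 r) (\<lambda>z. F (z, w))"
        using holomorphic_on_imp_continuous_on[OF hol1[OF that]] sub continuous_on_subset by blast
    qed (use hol1[OF that] sub M that r in \<open>auto intro: holomorphic_on_subset\<close>)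
    then show ?thesis by (simp add: a_def norm_divide field_simps)
  qed
  have a_sums: "(\<lambda>n. a n w * z ^ n) sums F (z, w)" if "norm z < r" "norm w \<le> r" for z w
    using holomorphic_power_series[OF hol1[OF that(2)], of z] that r by (simp add: a_def)
  have a_hol: "continuous_on (cball 0 r) (a n) \<and> a n holomorphic_on ball 0 r" for n
  proof (induction n rule: less_induct)
    case (less n)
    define Q where "Q = (\<lambda>z w. (F (z, w) - (\<Sum>j<n. a j w * z ^ j)) / z ^ n)"
    have near: "\<forall>\<^sub>F z in at 0. z \<noteq> (0::complex) \<and> norm z < \<delta>" if "\<delta> > 0" for \<delta>
      using that unfolding eventually_at by (intro exI[of _ \<delta>]) (auto simp: dist_norm)
    have "\<forall>\<^sub>F z in at 0. continuous_on (cball 0 r) (Q z) \<and> Q z holomorphic_on ball 0 r"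
      using near[OF r(1)]
    proof eventually_elim
      case (elim z)
      have F: "(\<lambda>w. F (z, w)) holomorphic_on ball 0 r0" using hol2[of z] elim by simp
      have "continuous_on (cball 0 r) (\<lambda>w. F (z, w))"
        using holomorphic_on_imp_continuous_on[OF F] sub continuous_on_subset by blast
      moreover have "(\<lambda>w. F (z, w)) holomorphic_on ball 0 r"
        using F sub holomorphic_on_subset by blast
      ultimately show ?case unfolding Q_def
        using less elim by (auto intro!: continuous_intros holomorphic_intros)
    qed
    moreover have "uniform_limit (cball 0 r) Q (a n) (at 0)"
    proof (rule uniform_limitI)
      fix e :: real assume e: "e > 0"
      let ?C = "2 * M / r ^ Suc n"
      have M0: "0 \<le> M" using order_trans[OF norm_ge_zero M[of 0 0]] r by simp
      have C0: "?C \<ge> 0" using M0 r by simp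
      \<comment> \<open>The summand 1 keeps the denominator positive even if M = 0.\<close>
      define \<delta> where "\<delta> = min (r / 2) (e / (?C + 1))"
      have "\<delta> > 0" using r e C0 by (simp add: \<delta>_def)
      from near[OF this] show "\<forall>\<^sub>F z in at 0. \<forall>w\<in>cball 0 r. dist (Q z w) (a n w) < e"
      proof eventually_elim
        case (elim z)
        show ?case
        proof
          fix w :: complex assume "w \<in> cball 0 r"
          then have w: "norm w \<le> r" by simp
          have z: "norm z \<le> r / 2" "norm z < e / (?C + 1)" using elim by (auto simp: \<delta>_def)
          have "dist (Q z w) (a n w) \<le> norm z * ?C"
            unfolding dist_norm Q_def
            by (rule power_series_tail_bound[OF a_sums a_bound]) (use w z r elim in auto)
          also have "\<dots> \<le> norm z * (?C + 1)" by (intro mult_left_mono) auto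
          also have "\<dots> < e" using z(2) C0 by (simp add: pos_less_divide_eq)
          finally show "dist (Q z w) (a n w) < e" .
        qed
      qed
    qed
    ultimately show ?case
      using holomorphic_uniform_limit[of 0 r Q "at 0" "a n"] by (metis trivial_limit_at)
  qed
  define c where "c = (\<lambda>n k. (deriv ^^ k) (a n) 0 / fact k)"
  have c_bound: "norm (c n k) * r ^ (n + k) \<le> M" for n k
  proof -
    have "norm ((deriv ^^ k) (a n) 0) \<le> fact k * (M / r ^ n) / r ^ k"
      by (rule Cauchy_inequality) (use a_hol r a_bound in auto)
    then have "norm (c n k) \<le> M / r ^ n / r ^ k" by (simp add: c_def norm_divide field_simps)
    then show ?thesis using r by (simp add: field_simps power_add)
  qed
  then have gb: "geom_bounded c r" unfolding geom_bounded_def by blast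
  have "F (z, w) = psum c z w" if "norm z < r" "norm w < r" for z w
  proof -
    have "a n w = (\<Sum>k. c n k * w ^ k)" for n
      using holomorphic_power_series[of "a n" 0 r w] a_hol[of n] that by (simp add: c_def sums_iff)
    then show ?thesis
      using psum_sums[OF gb that] a_sums[of z w] that sums_unique2 by fastforce
  qed
  with gb r show ?thesis by blast
qed

text \<open>The coefficients of the derivative are sums of the differentiated series, hence germs of
  the same kind; this is where the expansion pays off.\<close>

lemma holo2_derivative:
  assumes "holo2 F"
  obtains A B where "holo2 A" "holo2 B"
    "\<forall>\<^sub>F p in nhds 0. (F has_derivative (\<lambda>h. A p * fst h + B p * snd h)) (at p)"
proof -
  obtain c R where R: "R > 0" "geom_bounded c R"
    and F: "\<And>z w. norm z < R \<Longrightarrow> norm w < R \<Longrightarrow> F (z, w) = psum c z w"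
    using holo2_expansion[OF assms] by blast
  let ?A = "\<lambda>p. psum (\<lambda>j k. of_nat (Suc j) * c (Suc j) k) (fst p) (snd p)"
  let ?B = "\<lambda>p. psum (\<lambda>j k. of_nat (Suc k) * c j (Suc k)) (fst p) (snd p)"
  have R2: "0 < R / 2" "R / 2 < R" using R by auto
  show ?thesis
  proof (rule that[of ?A ?B])
    show "holo2 ?A" "holo2 ?B"
      by (rule holo2_psum[OF geom_bounded_deriv1[OF R(2) R2] R2(1)]
          holo2_psum[OF geom_bounded_deriv2[OF R(2) R2] R2(1)])+
    have S: "open (ball (0::complex) R \<times> ball (0::complex) R)" by (intro open_Times) auto
    have eq: "psum c (fst p) (snd p) = F p" if "p \<in> ball 0 R \<times> ball 0 R" for p
      using F[of "fst p" "snd p"] that by (simp add: mem_Times_iff)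
    have "(F has_derivative (\<lambda>h. ?A (z, w) * fst h + ?B (z, w) * snd h)) (at (z, w))"
      if zw: "norm z < R" "norm w < R" for z w
    proof -
      have "(z, w) \<in> ball 0 R \<times> ball 0 R" using zw by simp
      from has_derivative_transform_within_open[OF psum_has_derivative[OF R(2) zw] S this eq]
      show ?thesis by (simp only: fst_conv snd_conv)
    qed
    then show "\<forall>\<^sub>F p in nhds 0. (F has_derivative (\<lambda>h. ?A p * fst h + ?B p * snd h)) (at p)"
      unfolding eventually_nhds_polydisc using R(1) by blast
  qed
qed

lemma holo2_hadamard1:
  assumes "holo2 F"
  obtains E where "holo2 E" "\<forall>\<^sub>F p in nhds 0. F p = F (0, snd p) + fst p * E p"
proof -
  obtain c R where R: "R > 0" "geom_bounded c R"
    and F: "\<And>z w. norm z < R \<Longrightarrow> norm w < R \<Longrightarrow> F (z, w) = psum c z w"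
    using holo2_expansion[OF assms] by blast
  let ?E = "\<lambda>p. psum (\<lambda>j k. c (Suc j) k) (fst p) (snd p)"
  show ?thesis
  proof (rule that[of ?E])
    show "holo2 ?E" by (rule holo2_psum[OF geom_bounded_shift1[OF R(2,1)] R(1)])
    have "F (z, w) = F (0, w) + z * ?E (z, w)" if "norm z < R" "norm w < R" for z w
      using psum_shift1[OF R(2) that] F[of z w] F[of 0 w] that R by simp
    then show "\<forall>\<^sub>F p in nhds 0. F p = F (0, snd p) + fst p * ?E p"
      unfolding eventually_nhds_polydisc using R(1) by auto
  qed
qed

section \<open>Closure of holomorphic germs under algebraic operations and composition\<close>

lemma holo2_const [simp]: "holo2 (\<lambda>_. c)"
  unfolding holo2_def by (rule always_eventually) (auto intro!: exI[of _ 0] derivative_eq_intros)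

lemma holo2_fst [simp]: "holo2 fst"
  unfolding holo2_def
  by (intro always_eventually allI exI[of _ 1] exI[of _ 0])
    (simp add: bounded_linear_imp_has_derivative bounded_linear_fst)

lemma holo2_snd [simp]: "holo2 snd"
  unfolding holo2_def
  by (intro always_eventually allI exI[of _ 0] exI[of _ 1])
    (simp add: bounded_linear_imp_has_derivative bounded_linear_snd)

lemma holo2_add:
  assumes "holo2 F" "holo2 G"
  shows "holo2 (\<lambda>p. F p + G p)"
  using assms unfolding holo2_def
proof eventually_elim
  case (elim p)
  then obtain a b c d where "(F has_derivative (\<lambda>h. a * fst h + b * snd h)) (at p)"
    "(G has_derivative (\<lambda>h. c * fst h + d * snd h)) (at p)" by blast
  from has_derivative_add[OF this] show ?case
    by (intro exI[of _ "a + c"] exI[of _ "b + d"]) (simp add: algebra_simps)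
qed

lemma holo2_mult:
  assumes "holo2 F" "holo2 G"
  shows "holo2 (\<lambda>p. F p * G p)"
  using assms unfolding holo2_def
proof eventually_elim
  case (elim p)
  then obtain a b c d where "(F has_derivative (\<lambda>h. a * fst h + b * snd h)) (at p)"
    "(G has_derivative (\<lambda>h. c * fst h + d * snd h)) (at p)" by blast
  from has_derivative_mult[OF this] show ?case
    by (intro exI[of _ "F p * c + a * G p"] exI[of _ "F p * d + b * G p"]) (simp add: algebra_simps)
qed

lemma holo2_imp_isCont: "holo2 F \<Longrightarrow> isCont F 0"
  unfolding holo2_def by (drule eventually_nhds_x_imp_x) (blast dest: has_derivative_continuous)

lemma isCont_imp_tendsto_nhds: "isCont f a \<Longrightarrow> filterlim f (nhds (f a)) (nhds a)"
  by (simp add: continuous_at tendsto_at_iff_tendsto_nhds)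

lemma holo2_compose1:
  assumes "holo2 F" "g analytic_on {F 0}"
  shows "holo2 (\<lambda>p. g (F p))"
proof -
  obtain e where e: "e > 0" "g holomorphic_on ball (F 0) e"
    using assms(2) by (auto simp: analytic_on_def)
  have "\<forall>\<^sub>F p in nhds 0. F p \<in> ball (F 0) e"
    by (rule topological_tendstoD[OF isCont_imp_tendsto_nhds[OF holo2_imp_isCont[OF assms(1)]] open_ball])
      (use e in simp)
  with assms(1) show ?thesis unfolding holo2_def
  proof eventually_elim
    case (elim p)
    then obtain a b where F: "(F has_derivative (\<lambda>h. a * fst h + b * snd h)) (at p)" by blast
    have "(g has_field_derivative deriv g (F p)) (at (F p))"
      using holomorphic_derivI[OF e(2) open_ball elim(2)] .
    then have "(g has_derivative (*) (deriv g (F p))) (at (F p))"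
      by (simp add: has_field_derivative_def)
    from has_derivative_compose[OF F this] show ?case
      by (intro exI[of _ "deriv g (F p) * a"] exI[of _ "deriv g (F p) * b"]) (simp add: algebra_simps)
  qed
qed

lemma holo2_compose2:
  assumes "holo2 F" "holo2 G" "holo2 H" "G 0 = 0" "H 0 = 0"
  shows "holo2 (\<lambda>p. F (G p, H p))"
proof -
  have "isCont (\<lambda>p. (G p, H p)) 0"
    using assms by (intro continuous_intros holo2_imp_isCont)
  then have "filterlim (\<lambda>p. (G p, H p)) (nhds 0) (nhds 0)"
    using isCont_imp_tendsto_nhds assms(4,5) by (fastforce simp: zero_prod_def)
  then have "\<forall>\<^sub>F p in nhds 0. \<exists>a b. (F has_derivative (\<lambda>h. a * fst h + b * snd h)) (at (G p, H p))"
    using assms(1) filterlim_iff[THEN iffD1, rule_format,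
        where P = "\<lambda>q. \<exists>a b. (F has_derivative (\<lambda>h. a * fst h + b * snd h)) (at q)"]
    unfolding holo2_def by blast
  with assms(2,3) show ?thesis unfolding holo2_def
  proof eventually_elim
    case (elim p)
    then obtain a b c d e f where F: "(F has_derivative (\<lambda>h. a * fst h + b * snd h)) (at (G p, H p))"
      and G: "(G has_derivative (\<lambda>h. c * fst h + d * snd h)) (at p)"
      and H: "(H has_derivative (\<lambda>h. e * fst h + f * snd h)) (at p)" by blast
    from has_derivative_compose[OF has_derivative_Pair[OF G H] F] show ?case
      by (intro exI[of _ "a * c + b * e"] exI[of _ "a * d + b * f"]) (simp add: algebra_simps)
  qed
qed

lemma holo2_swap:
  assumes "holo2 F"
  shows "holo2 (\<lambda>p. F (snd p, fst p))"
  by (rule holo2_compose2[OF assms]) auto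

lemma holo2_hadamard2:
  assumes "holo2 F"
  obtains E where "holo2 E" "\<forall>\<^sub>F p in nhds 0. F p = F (fst p, 0) + snd p * E p"
proof -
  obtain E where E: "holo2 E" "\<forall>\<^sub>F p in nhds 0. F (snd p, fst p) = F (snd p, 0) + fst p * E p"
    using holo2_hadamard1[OF holo2_swap[OF assms]] by auto
  show ?thesis
    by (rule that[OF holo2_swap[OF E(1)]]) (use E(2) in \<open>auto simp: eventually_nhds_polydisc\<close>)
qed

text \<open>The antidiagonal is totally real, so the one-variable identity theorem applies in each of
  the coordinates \<open>(z + w) / 2\<close> and \<open>(z - w) / (2 \<i>)\<close> in turn.\<close>

lemma holomorphic_zero_on_reals:
  assumes "f holomorphic_on ball 0 r" "r > 0" "\<And>x :: real. \<bar>x\<bar> < r \<Longrightarrow> f (of_real x) = 0" "norm z < r"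
  shows "f z = 0"
proof (rule analytic_continuation[OF assms(1) open_ball connected_ball])
  show "(0::complex) islimpt (of_real ` {-r<..<r})"
  proof (rule islimptI)
    fix T :: "complex set" assume "0 \<in> T" "open T"
    then obtain e where e: "e > 0" "ball 0 e \<subseteq> T" using open_contains_ball by blast
    have "of_real (min (e/2) (r/2)) \<in> of_real ` {-r<..<r}" "(of_real (min (e/2) (r/2)) :: complex) \<in> T"
      using e assms(2) by (auto intro!: imageI subsetD[OF e(2)])
    moreover have "(of_real (min (e/2) (r/2)) :: complex) \<noteq> 0" using e assms(2) by auto
    ultimately show "\<exists>y\<in>of_real ` {-r<..<r}. y \<in> T \<and> y \<noteq> 0" by blast
  qed
qed (use assms in \<open>auto simp: abs_less_iff\<close>)

lemma holo2_identity:
  assumes "holo2 F" "\<forall>\<^sub>F z in nhds 0. F (z, cnj z) = 0"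
  shows "\<forall>\<^sub>F p in nhds 0. F p = 0"
proof -
  \<comment> \<open>In the variables x and y with z = x + \<i> y and w = x - \<i> y, the plane w =
    cnj z consists of the pairs with x and y both real.\<close>
  define G where "G = (\<lambda>p. F (fst p + \<i> * snd p, fst p - \<i> * snd p))"
  have "holo2 (\<lambda>p. fst p + \<i> * snd p)" "holo2 (\<lambda>p. fst p + (- \<i>) * snd p)"
    by (intro holo2_add holo2_mult; simp)+
  then have G: "holo2 G"
    unfolding G_def by (intro holo2_compose2[OF assms(1)]) auto
  obtain r where r: "r > 0"
    "\<And>z w. norm z < r \<Longrightarrow> norm w < r \<Longrightarrow> \<exists>a b. (G has_derivative (\<lambda>h. a * fst h + b * snd h)) (at (z, w))"
    using G unfolding holo2_def eventually_nhds_polydisc by blast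
  obtain d where d: "d > 0" "\<And>z. norm z < d \<Longrightarrow> F (z, cnj z) = 0"
    using assms(2) unfolding eventually_nhds_metric by (auto simp: dist_norm)
  \<comment> \<open>Half of d suffices because |x + \<i> y| \<le> |x| + |y|.\<close>
  define s where "s = min r (d / 2)"
  have s: "s > 0" "s \<le> r" "s \<le> d / 2" using r d by (auto simp: s_def)
  have hol1: "(\<lambda>z. G (z, w)) holomorphic_on ball 0 s" if "norm w < s" for w
    unfolding holomorphic_on_open[OF open_ball]
    using r(2)[of _ w] that s by (force dest: has_derivative_slice1)
  have hol2: "(\<lambda>w. G (z, w)) holomorphic_on ball 0 s" if "norm z < s" for z
    unfolding holomorphic_on_open[OF open_ball]
    using r(2)[of z] that s by (force dest: has_derivative_slice2)
  have real: "G (of_real x, of_real y) = 0" if "\<bar>x\<bar> < s" "\<bar>y\<bar> < s" for x y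
  proof -
    have "norm (Complex x y) < d"
      using cmod_le[of "Complex x y"] that s by simp
    from d(2)[OF this] show ?thesis
      by (simp add: G_def complex_eq_iff Complex_eq)
  qed
  have real2: "G (z, of_real y) = 0" if "norm z < s" "\<bar>y\<bar> < s" for z y
    using holomorphic_zero_on_reals[OF hol1[of "of_real y"] s(1) real that(1)] that(2) by simp
  have G0: "G (z, w) = 0" if "norm z < s" "norm w < s" for z w
    using holomorphic_zero_on_reals[OF hol2[OF that(1)] s(1) real2[OF that(1)] that(2)] .
  have "F (z, w) = 0" if "norm z < s" "norm w < s" for z w
  proof -
    have "F (z, w) = G ((z + w) / 2, (z - w) / (2 * \<i>))"
      by (simp add: G_def field_simps)
    also have "\<dots> = 0"
    proof (rule G0)
      show "norm ((z + w) / 2) < s" "norm ((z - w) / (2 * \<i>)) < s"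
        using norm_triangle_ineq[of z w] norm_triangle_ineq4[of z w] that
        by (simp_all add: norm_divide norm_mult)
    qed
    finally show ?thesis .
  qed
  then show ?thesis unfolding eventually_nhds_polydisc using s(1) by blast
qed

section \<open>Real-analytic germs of the plane\<close>

text \<open>A real-analytic germ is the restriction of a holomorphic germ in two variables to the totally
  real plane \<open>{(z, cnj z)}\<close>; this characterisation makes closure under composition immediate.\<close>

definition ra_germ :: "(complex \<Rightarrow> complex) \<Rightarrow> bool" where
  "ra_germ f \<longleftrightarrow> (\<exists>F. holo2 F \<and> (\<forall>\<^sub>F z in nhds 0. f z = F (z, cnj z)))"

lemma eventually_norm_less: "R > 0 \<Longrightarrow> \<forall>\<^sub>F z in nhds (0::complex). norm z < R"
  unfolding eventually_nhds_metric by (auto simp: dist_norm)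

lemma eventually_slice:
  assumes "\<forall>\<^sub>F p in nhds 0. P p"
  shows "\<forall>\<^sub>F z in nhds 0. P (z, cnj z)"
proof -
  have "isCont (\<lambda>z. (z, cnj z)) 0" by (intro continuous_intros)
  from isCont_imp_tendsto_nhds[OF this] have "filterlim (\<lambda>z. (z, cnj z)) (nhds 0) (nhds 0)"
    by (simp add: zero_prod_def)
  then show ?thesis using assms by (simp add: filterlim_iff)
qed

lemma eventually_nhds_compose:
  assumes "isCont g a" "\<forall>\<^sub>F y in nhds (g a). P y"
  shows "\<forall>\<^sub>F z in nhds a. P (g z)"
  using isCont_imp_tendsto_nhds[OF assms(1)] assms(2) by (simp add: filterlim_iff)

lemma ra_germI:
  assumes "holo2 F" "\<forall>\<^sub>F z in nhds 0. f z = F (z, cnj z)"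
  shows "ra_germ f"
  using assms unfolding ra_germ_def by blast

lemma ra_germ_cong:
  assumes "ra_germ f" "\<forall>\<^sub>F z in nhds 0. f z = g z"
  shows "ra_germ g"
proof -
  obtain F where F: "holo2 F" "\<forall>\<^sub>F z in nhds 0. f z = F (z, cnj z)"
    using assms(1) unfolding ra_germ_def by blast
  have "\<forall>\<^sub>F z in nhds 0. g z = F (z, cnj z)"
    using F(2) assms(2) by eventually_elim simp
  then show ?thesis by (rule ra_germI[OF F(1)])
qed

lemma ra_germ_const [simp]: "ra_germ (\<lambda>_. c)"
  by (rule ra_germI[of "\<lambda>_. c"]) auto

lemma ra_germ_id [simp]: "ra_germ (\<lambda>z. z)"
  by (rule ra_germI[of fst]) auto

lemma ra_germ_cnj_id [simp]: "ra_germ cnj"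
  by (rule ra_germI[of snd]) auto

lemma ra_germ_add:
  assumes "ra_germ f" "ra_germ g"
  shows "ra_germ (\<lambda>z. f z + g z)"
proof -
  obtain F G where F: "holo2 F" "\<forall>\<^sub>F z in nhds 0. f z = F (z, cnj z)"
    and G: "holo2 G" "\<forall>\<^sub>F z in nhds 0. g z = G (z, cnj z)"
    using assms unfolding ra_germ_def by blast
  have "\<forall>\<^sub>F z in nhds 0. f z + g z = F (z, cnj z) + G (z, cnj z)"
    using F(2) G(2) by eventually_elim simp
  then show ?thesis by (rule ra_germI[OF holo2_add[OF F(1) G(1)]])
qed

lemma ra_germ_mult:
  assumes "ra_germ f" "ra_germ g"
  shows "ra_germ (\<lambda>z. f z * g z)"
proof -
  obtain F G where F: "holo2 F" "\<forall>\<^sub>F z in nhds 0. f z = F (z, cnj z)"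
    and G: "holo2 G" "\<forall>\<^sub>F z in nhds 0. g z = G (z, cnj z)"
    using assms unfolding ra_germ_def by blast
  have "\<forall>\<^sub>F z in nhds 0. f z * g z = F (z, cnj z) * G (z, cnj z)"
    using F(2) G(2) by eventually_elim simp
  then show ?thesis by (rule ra_germI[OF holo2_mult[OF F(1) G(1)]])
qed

lemma ra_germ_minus: "ra_germ f \<Longrightarrow> ra_germ (\<lambda>z. - f z)"
  using ra_germ_mult[of "\<lambda>_. -1" f] by simp

lemma ra_germ_diff: "ra_germ f \<Longrightarrow> ra_germ g \<Longrightarrow> ra_germ (\<lambda>z. f z - g z)"
  using ra_germ_add[of f "\<lambda>z. - g z"] ra_germ_minus by simp

text \<open>Schwarz reflection: conjugating both arguments and the value restores complex
  differentiability, and exchanging the arguments makes the restriction to w = cnj z equal to cnj (F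
  (z, cnj z)).\<close>

lemma holo2_cnj:
  assumes "holo2 F"
  shows "holo2 (\<lambda>p. cnj (F (cnj (snd p), cnj (fst p))))"
proof -
  have "isCont (\<lambda>p :: complex \<times> complex. (cnj (snd p), cnj (fst p))) 0"
    by (intro continuous_intros)
  from eventually_nhds_compose[OF this] assms
  have "\<forall>\<^sub>F p in nhds 0. \<exists>a b. (F has_derivative (\<lambda>h. a * fst h + b * snd h)) (at (cnj (snd p), cnj (fst p)))"
    unfolding holo2_def by (simp add: zero_prod_def)
  then show ?thesis unfolding holo2_def
  proof eventually_elim
    case (elim p)
    then obtain a b where F: "(F has_derivative (\<lambda>h. a * fst h + b * snd h)) (at (cnj (snd p), cnj (fst p)))"
      by blast
    have "((\<lambda>p. (cnj (snd p), cnj (fst p))) has_derivative (\<lambda>h. (cnj (snd h), cnj (fst h)))) (at p)"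
      by (auto intro!: derivative_eq_intros)
    from has_derivative_cnj[OF has_derivative_compose[OF this F]] show ?case
      by (intro exI[of _ "cnj b"] exI[of _ "cnj a"]) (simp add: algebra_simps)
  qed
qed

lemma ra_germ_cnj:
  assumes "ra_germ f"
  shows "ra_germ (\<lambda>z. cnj (f z))"
proof -
  obtain F where F: "holo2 F" "\<forall>\<^sub>F z in nhds 0. f z = F (z, cnj z)"
    using assms unfolding ra_germ_def by blast
  show ?thesis
    by (rule ra_germI[OF holo2_cnj[OF F(1)]], use F(2) in eventually_elim) simp
qed

lemma ra_germ_Re:
  assumes "ra_germ f"
  shows "ra_germ (\<lambda>z. of_real (Re (f z)))"
proof -
  have "ra_germ (\<lambda>z. 1 / 2 * (f z + cnj (f z)))"
    by (intro ra_germ_mult ra_germ_add ra_germ_cnj assms) simp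
  then show ?thesis by (simp add: complex_add_cnj)
qed

lemma ra_germ_compose1:
  assumes "ra_germ f" "g analytic_on {f 0}"
  shows "ra_germ (\<lambda>z. g (f z))"
proof -
  obtain F where F: "holo2 F" "\<forall>\<^sub>F z in nhds 0. f z = F (z, cnj z)"
    using assms unfolding ra_germ_def by blast
  have "f 0 = F 0" using eventually_nhds_x_imp_x[OF F(2)] by (simp add: zero_prod_def)
  then have "holo2 (\<lambda>p. g (F p))" using assms(2) by (intro holo2_compose1[OF F(1)]) simp
  then show ?thesis
    by (rule ra_germI, use F(2) in eventually_elim) simp
qed

lemma ra_germ_inverse:
  assumes "ra_germ f" "f 0 \<noteq> 0"
  shows "ra_germ (\<lambda>z. inverse (f z))"
  by (rule ra_germ_compose1[OF assms(1)]) (use assms(2) in \<open>auto intro!: analytic_intros\<close>)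

lemma ra_germ_divide:
  assumes "ra_germ f" "ra_germ g" "g 0 \<noteq> 0"
  shows "ra_germ (\<lambda>z. f z / g z)"
  using ra_germ_mult[OF assms(1) ra_germ_inverse[OF assms(2,3)]] by (simp add: divide_inverse)

lemma holo2_eventually_isCont:
  assumes "holo2 F"
  shows "\<forall>\<^sub>F p in nhds 0. isCont F p"
  using assms unfolding holo2_def by eventually_elim (blast dest: has_derivative_continuous)

lemma eventually_has_derivative_cong:
  assumes "\<forall>\<^sub>F z in nhds a. f z = g z" "\<forall>\<^sub>F z in nhds a. (f has_derivative D z) (at z)"
  shows "\<forall>\<^sub>F z in nhds a. (g has_derivative D z) (at z)"
proof -
  have "\<forall>\<^sub>F z in nhds a. \<forall>\<^sub>F q in nhds z. f q = g q"
    using assms(1) eventually_eventually by blast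
  with assms(2) show ?thesis
  proof eventually_elim
    case (elim z)
    have "\<forall>\<^sub>F q in at z. f q = g q"
      using elim(2) by (auto simp: eventually_at_filter elim: eventually_mono)
    moreover have "f z = g z" using elim(2) by (rule eventually_nhds_x_imp_x)
    ultimately show ?case
      by (rule has_derivative_transform_eventually[OF elim(1)]) simp
  qed
qed

text \<open>The two complex partial derivatives become the Wirtinger derivatives with respect to z
  and cnj z.\<close>

lemma slice_has_derivative:
  assumes "(F has_derivative (\<lambda>h. a * fst h + b * snd h)) (at (z, cnj z))"
  shows "((\<lambda>z. F (z, cnj z)) has_derivative (\<lambda>h. a * h + b * cnj h)) (at z)"
proof -
  have "((\<lambda>z. (z, cnj z)) has_derivative (\<lambda>h. (h, cnj h))) (at z)"
    by (auto intro!: derivative_eq_intros)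
  from has_derivative_compose[OF this assms] show ?thesis by simp
qed

lemma ra_germ_derivative:
  assumes "ra_germ f"
  obtains a b where "ra_germ a" "ra_germ b"
    "\<forall>\<^sub>F z in nhds 0. (f has_derivative (\<lambda>h. a z * h + b z * cnj h)) (at z)"
proof -
  obtain F where F: "holo2 F" "\<forall>\<^sub>F z in nhds 0. f z = F (z, cnj z)"
    using assms unfolding ra_germ_def by blast
  obtain A B where AB: "holo2 A" "holo2 B"
    "\<forall>\<^sub>F p in nhds 0. (F has_derivative (\<lambda>h. A p * fst h + B p * snd h)) (at p)"
    using holo2_derivative[OF F(1)] .
  show ?thesis
  proof (rule that[of "\<lambda>z. A (z, cnj z)" "\<lambda>z. B (z, cnj z)"])
    show "ra_germ (\<lambda>z. A (z, cnj z))" "ra_germ (\<lambda>z. B (z, cnj z))"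
      using AB by (auto intro: ra_germI)
    have e: "\<forall>\<^sub>F z in nhds 0. F (z, cnj z) = f z" using F(2) by eventually_elim simp
    have "\<forall>\<^sub>F z in nhds 0. ((\<lambda>z. F (z, cnj z)) has_derivative
        (\<lambda>h. A (z, cnj z) * h + B (z, cnj z) * cnj h)) (at z)"
      using eventually_slice[OF AB(3)] by eventually_elim (rule slice_has_derivative)
    from eventually_has_derivative_cong[OF e this]
    show "\<forall>\<^sub>F z in nhds 0. (f has_derivative (\<lambda>h. A (z, cnj z) * h + B (z, cnj z) * cnj h)) (at z)" .
  qed
qed

lemma ra_germ_eventually_isCont:
  assumes "ra_germ f"
  shows "\<forall>\<^sub>F z in nhds 0. isCont f z"
proof -
  obtain a b where "ra_germ a" "ra_germ b"
    "\<forall>\<^sub>F z in nhds 0. (f has_derivative (\<lambda>h. a z * h + b z * cnj h)) (at z)"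
    using ra_germ_derivative[OF assms] .
  from this(3) show ?thesis by eventually_elim (rule has_derivative_continuous)
qed

lemma ra_germ_isCont: "ra_germ f \<Longrightarrow> isCont f 0"
  using ra_germ_eventually_isCont eventually_nhds_x_imp_x by blast

lemma ra_germ_compose:
  assumes "ra_germ f" "ra_germ g" "g 0 = 0"
  shows "ra_germ (\<lambda>z. f (g z))"
proof -
  obtain F where F: "holo2 F" "\<forall>\<^sub>F z in nhds 0. f z = F (z, cnj z)"
    using assms unfolding ra_germ_def by blast
  obtain G where G: "holo2 G" "\<forall>\<^sub>F z in nhds 0. g z = G (z, cnj z)"
    using assms unfolding ra_germ_def by blast
  obtain H where H: "holo2 H" "\<forall>\<^sub>F z in nhds 0. cnj (g z) = H (z, cnj z)"
    using ra_germ_cnj[OF assms(2)] unfolding ra_germ_def by blast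
  have 0: "G 0 = 0" "H 0 = 0"
    using eventually_nhds_x_imp_x[OF G(2)] eventually_nhds_x_imp_x[OF H(2)] assms(3)
    by (simp_all add: zero_prod_def)
  have e: "\<forall>\<^sub>F z in nhds 0. f (g z) = F (g z, cnj (g z))"
    using eventually_nhds_compose[OF ra_germ_isCont[OF assms(2)], of "\<lambda>z. f z = F (z, cnj z)"] F(2) assms(3)
    by simp
  show ?thesis
    by (rule ra_germI[OF holo2_compose2[OF F(1) G(1) H(1) 0]], use e G(2) H(2) in eventually_elim) simp
qed

text \<open>Two Hadamard divisions, by z and then by w on z = 0. The coefficients are germs again,
  so the lemma can be iterated for a second-order expansion.\<close>

lemma ra_germ_linear_remainder:
  assumes "ra_germ f"
  obtains a b where "ra_germ a" "ra_germ b" "\<forall>\<^sub>F z in nhds 0. f z = f 0 + z * a z + cnj z * b z"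
proof -
  obtain F where F: "holo2 F" "\<forall>\<^sub>F z in nhds 0. f z = F (z, cnj z)"
    using assms unfolding ra_germ_def by blast
  obtain A where A: "holo2 A" "\<forall>\<^sub>F p in nhds 0. F p = F (0, snd p) + fst p * A p"
    using holo2_hadamard1[OF F(1)] .
  have "holo2 (\<lambda>p. F (0, snd p))" by (rule holo2_compose2[OF F(1)]) auto
  then obtain B where B: "holo2 B" "\<forall>\<^sub>F p in nhds 0. F (0, snd p) = F (0, 0) + snd p * B p"
    using holo2_hadamard2[of "\<lambda>p. F (0, snd p)"] by auto
  have f0: "f 0 = F (0, 0)" using eventually_nhds_x_imp_x[OF F(2)] by simp
  show ?thesis
  proof (rule that[of "\<lambda>z. A (z, cnj z)" "\<lambda>z. B (z, cnj z)"])
    show "ra_germ (\<lambda>z. A (z, cnj z))" "ra_germ (\<lambda>z. B (z, cnj z))"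
      using A B by (auto intro: ra_germI)
    show "\<forall>\<^sub>F z in nhds 0. f z = f 0 + z * A (z, cnj z) + cnj z * B (z, cnj z)"
      using F(2) eventually_slice[OF A(2)] eventually_slice[OF B(2)]
      by eventually_elim (simp add: f0)
  qed
qed

section \<open>Comparison with convergent series in the real coordinates\<close>

lemma real_analytic_germ_imp_ra_germ:
  assumes "real_analytic_germ f"
  shows "ra_germ f"
proof -
  obtain c where "\<forall>\<^sub>F z in nhds 0. ((\<lambda>(j, k). (Re z ^ j * Im z ^ k) *\<^sub>R c j k) has_sum f z) UNIV"
    using assms unfolding real_analytic_germ_def by blast
  then obtain d where d: "d > 0"
    "\<And>z. norm z < d \<Longrightarrow> ((\<lambda>(j, k). (Re z ^ j * Im z ^ k) *\<^sub>R c j k) has_sum f z) UNIV"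
    unfolding eventually_nhds_metric by (auto simp: dist_norm)
  \<comment> \<open>The point t + \<i> t has modulus at most 2 t < d, so the series converges at x =
    y = t.\<close>
  define t where "t = d / 3"
  have t: "t > 0" "t < d" using d by (auto simp: t_def)
  have "norm (Complex t t) < d" using cmod_le[of "Complex t t"] d(1) by (simp add: t_def)
  from d(2)[OF this] have "(\<lambda>(j, k). (t ^ j * t ^ k) *\<^sub>R c j k) summable_on UNIV"
    by (auto simp: summable_on_def)
  \<comment> \<open>Unordered summability of complex numbers is absolute, so every single term is at
    most the total M; this is the coefficient bound.\<close>
  then have s: "(\<lambda>x. norm (case x of (j, k) \<Rightarrow> (t ^ j * t ^ k) *\<^sub>R c j k)) summable_on UNIV"
    by (simp add: summable_on_iff_abs_summable_on_complex)
  define M where "M = (\<Sum>\<^sub>\<infinity>x. norm (case x of (j, k) \<Rightarrow> (t ^ j * t ^ k) *\<^sub>R c j k))"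
  have "norm (c j k) * t ^ (j + k) \<le> M" for j k
    using finite_sum_le_infsum[OF s, of "{(j, k)}"] t by (simp add: M_def power_add mult_ac)
  then have g: "geom_bounded c t" unfolding geom_bounded_def by blast
  \<comment> \<open>These are x and y written as (z + w) / 2 and (z - w) / (2 \<i>).\<close>
  have "holo2 (\<lambda>p. 1 / 2 * (fst p + snd p))" "holo2 (\<lambda>p. (- \<i> / 2) * (fst p + (-1) * snd p))"
    by (intro holo2_mult holo2_add; simp)+
  from holo2_compose2[OF holo2_psum[OF g t(1)] this]
  have h: "holo2 (\<lambda>p. psum c (1 / 2 * (fst p + snd p)) ((- \<i> / 2) * (fst p + (-1) * snd p)))"
    by simp
  show ?thesis
  proof (rule ra_germI[OF h])
    have "f z = psum c (1 / 2 * (z + cnj z)) ((- \<i> / 2) * (z + (-1) * cnj z))" if "norm z < t" for z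
    proof -
      have z: "norm (of_real (Re z) :: complex) < t" "norm (of_real (Im z) :: complex) < t"
        using that abs_Re_le_cmod[of z] abs_Im_le_cmod[of z] by auto
      have "((\<lambda>(j, k). (Re z ^ j * Im z ^ k) *\<^sub>R c j k) has_sum f z) UNIV"
        using d(2) that t by simp
      moreover have "((\<lambda>(j, k). (Re z ^ j * Im z ^ k) *\<^sub>R c j k) has_sum psum c (Re z) (Im z)) UNIV"
        using psum_has_sum[OF g z] by (simp add: scaleR_conv_of_real mult_ac)
      ultimately have "f z = psum c (Re z) (Im z)" using has_sum_unique by blast
      moreover have "1 / 2 * (z + cnj z) = Re z" "(- \<i> / 2) * (z + (-1) * cnj z) = Im z"
        by (simp_all add: complex_eq_iff)
      ultimately show ?thesis by simp
    qed
    then show "\<forall>\<^sub>F z in nhds 0. f z = psum c (1 / 2 * (fst (z, cnj z) + snd (z, cnj z)))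
        ((- \<i> / 2) * (fst (z, cnj z) + (-1) * snd (z, cnj z)))"
      unfolding eventually_nhds_metric fst_conv snd_conv using t(1) by (auto simp: dist_norm)
  qed
qed

lemma ra_germ_imp_real_analytic_germ:
  assumes "ra_germ f"
  shows "real_analytic_germ f"
proof -
  obtain F where F: "holo2 F" "\<forall>\<^sub>F z in nhds 0. f z = F (z, cnj z)"
    using assms unfolding ra_germ_def by blast
  define G where "G = (\<lambda>p. F (fst p + \<i> * snd p, fst p + (- \<i>) * snd p))"
  have "holo2 (\<lambda>p. fst p + \<i> * snd p)" "holo2 (\<lambda>p. fst p + (- \<i>) * snd p)"
    by (intro holo2_add holo2_mult; simp)+
  then have G: "holo2 G"
    unfolding G_def by (intro holo2_compose2[OF F(1)]) auto
  obtain c R where R: "R > 0" "geom_bounded c R"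
    and c: "\<And>z w. norm z < R \<Longrightarrow> norm w < R \<Longrightarrow> G (z, w) = psum c z w"
    using holo2_expansion[OF G] by blast
  have "\<forall>\<^sub>F z in nhds 0. norm (z :: complex) < R"
    using R(1) unfolding eventually_nhds_metric by (auto simp: dist_norm)
  then have "\<forall>\<^sub>F z in nhds 0. ((\<lambda>(j, k). (Re z ^ j * Im z ^ k) *\<^sub>R c j k) has_sum f z) UNIV"
    using F(2)
  proof eventually_elim
    case (elim z)
    have z: "norm (of_real (Re z) :: complex) < R" "norm (of_real (Im z) :: complex) < R"
      using elim abs_Re_le_cmod[of z] abs_Im_le_cmod[of z] by auto
    have "F (z, cnj z) = G (of_real (Re z), of_real (Im z))"
    proof -
      have "of_real (Re z) + \<i> * of_real (Im z) = z" "of_real (Re z) + (- \<i>) * of_real (Im z) = cnj z"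
        by (simp_all add: complex_eq_iff)
      then show ?thesis unfolding G_def fst_conv snd_conv by (simp only:)
    qed
    then have "f z = psum c (Re z) (Im z)" using elim c[OF z] by simp
    then show ?case
      using psum_has_sum[OF R(2) z] by (simp add: scaleR_conv_of_real mult_ac)
  qed
  then show ?thesis unfolding real_analytic_germ_def by blast
qed

lemma real_analytic_germ_of_real:
  assumes "real_analytic_germ I"
  shows "real_analytic_germ (\<lambda>z. complex_of_real (I z))"
proof -
  obtain c where "\<forall>\<^sub>F z in nhds 0. ((\<lambda>(j, k). (Re z ^ j * Im z ^ k) *\<^sub>R c j k) has_sum I z) UNIV"
    using assms unfolding real_analytic_germ_def by blast
  then have "\<forall>\<^sub>F z in nhds 0. ((\<lambda>(j, k). (Re z ^ j * Im z ^ k) *\<^sub>R complex_of_real (c j k)) has_sum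
      complex_of_real (I z)) UNIV"
  proof eventually_elim
    case (elim z)
    from has_sum_bounded_linear[OF bounded_linear_of_real elim] show ?case
      by (simp add: case_prod_unfold scaleR_conv_of_real)
  qed
  then show ?thesis unfolding real_analytic_germ_def by (intro exI[of _ "\<lambda>j k. complex_of_real (c j k)"])
qed

section \<open>Analytic inverse functions\<close>

lemma local_inverse_near_identity:
  fixes f :: "'a::euclidean_space \<Rightarrow> 'a"
  assumes D: "\<forall>\<^sub>F x in nhds 0. (f has_derivative f' x) (at x)"
    and cont: "\<And>h. \<forall>\<^sub>F x in nhds 0. isCont (\<lambda>x. f' x h) x"
    and f0: "f 0 = 0" and id: "f' 0 = (\<lambda>h. h)"
  obtains g where "g 0 = 0" "\<forall>\<^sub>F y in nhds 0. f (g y) = y" "\<forall>\<^sub>F x in nhds 0. g (f x) = x"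
    "isCont g 0" "\<forall>\<^sub>F y in nhds 0. (g has_derivative inv (f' (g y))) (at y)"
proof -
  have "\<forall>\<^sub>F x in nhds 0. (f has_derivative f' x) (at x) \<and> (\<forall>h\<in>Basis. isCont (\<lambda>x. f' x h) x)"
    using D cont by (simp add: eventually_conj_iff eventually_ball_finite_distrib)
  then obtain U where U: "open U" "0 \<in> U"
    "\<And>x. x \<in> U \<Longrightarrow> (f has_derivative f' x) (at x)"
    "\<And>x h. x \<in> U \<Longrightarrow> h \<in> Basis \<Longrightarrow> isCont (\<lambda>x. f' x h) x"
    unfolding eventually_nhds by blast
  define B where "B = (\<lambda>x. Blinfun (f' x))"
  have B: "blinfun_apply (B x) = f' x" if "x \<in> U" for x
    using U(3)[OF that] by (simp add: B_def bounded_linear_Blinfun_apply has_derivative_bounded_linear)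
  \<comment> \<open>In finite dimension, continuity of the derivative on each basis vector yields
    continuity in operator norm, as the inverse function theorem asks.\<close>
  have "continuous_on U (\<lambda>x. blinfun_apply (B x) h)" if "h \<in> Basis" for h
  proof -
    have "continuous_on U (\<lambda>x. f' x h)"
      using U(4)[OF _ that] by (simp add: continuous_at_imp_continuous_on)
    then show ?thesis using B by (simp cong: continuous_on_cong)
  qed
  then have contB: "continuous_on U B" by (rule continuous_on_blinfun_componentwise)
  have derB: "(f has_derivative blinfun_apply (B x)) (at x)" if "x \<in> U" for x
    using U(3)[OF that] B[OF that] by simp
  have idB: "id_blinfun o\<^sub>L B 0 = id_blinfun"
    by (rule blinfun_eqI) (simp add: B[OF U(2)] id)
  show thesis
  proof (rule inverse_function_theorem[OF U(1) derB contB U(2) idB])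
    fix U' V g g' assume V: "open U'" "U' \<subseteq> U" "0 \<in> U'" "open V" "f 0 \<in> V"
      "homeomorphism U' V f g"
      "\<And>y. y \<in> V \<Longrightarrow> (g has_derivative (g' y)) (at y)"
      "\<And>y. y \<in> V \<Longrightarrow> g' y = inv (blinfun_apply (B (g y)))"
    have evV: "\<forall>\<^sub>F y in nhds 0. y \<in> V" and evU: "\<forall>\<^sub>F x in nhds 0. x \<in> U'"
      using V f0 by (auto intro: eventually_nhds_in_open)
    have gf: "g (f x) = x" if "x \<in> U'" for x using V(6) that by (auto simp: homeomorphism_def)
    have fg: "f (g y) = y" "g y \<in> U'" if "y \<in> V" for y using V(6) that by (auto simp: homeomorphism_def)
    show thesis
    proof (rule that[of g])
      show "g 0 = 0" using gf[OF V(3)] f0 by simp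
      show "\<forall>\<^sub>F y in nhds 0. f (g y) = y" using evV by eventually_elim (rule fg)
      show "\<forall>\<^sub>F x in nhds 0. g (f x) = x" using evU by eventually_elim (rule gf)
      show "isCont g 0" using V(7)[of 0] V(5) f0 by (auto dest: has_derivative_continuous)
      show "\<forall>\<^sub>F y in nhds 0. (g has_derivative inv (f' (g y))) (at y)"
        using evV
      proof eventually_elim
        case (elim y)
        then show ?case using V(7)[OF elim] V(8)[OF elim] B fg(2)[OF elim] V(2) by auto
      qed
    qed
  qed
qed

text \<open>Cramer's rule. The explicit inverse shows that the derivative of the inverse map is
  again complex linear.\<close>

lemma inv_linear_map_2x2:
  fixes a b c d :: complex
  assumes "a * d - b * c \<noteq> 0"
  shows "inv (\<lambda>h. (a * fst h + b * snd h, c * fst h + d * snd h))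
    = (\<lambda>h. ((d * fst h - b * snd h) / (a * d - b * c), (a * snd h - c * fst h) / (a * d - b * c)))"
proof (rule inv_equality)
  let ?\<Delta> = "a * d - b * c"
  fix h :: "complex \<times> complex"
  have "(d * (a * fst h + b * snd h) - b * (c * fst h + d * snd h)) = ?\<Delta> * fst h"
    "(a * (c * fst h + d * snd h) - c * (a * fst h + b * snd h)) = ?\<Delta> * snd h"
    by (simp_all add: algebra_simps)
  then show "((d * fst (a * fst h + b * snd h, c * fst h + d * snd h) - b * snd (a * fst h + b * snd h, c * fst h + d * snd h)) / ?\<Delta>,
       (a * snd (a * fst h + b * snd h, c * fst h + d * snd h) - c * fst (a * fst h + b * snd h, c * fst h + d * snd h)) / ?\<Delta>) = h"
    using assms by simp
  have "(a * (d * fst h - b * snd h) + b * (a * snd h - c * fst h)) = ?\<Delta> * fst h"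
    "(c * (d * fst h - b * snd h) + d * (a * snd h - c * fst h)) = ?\<Delta> * snd h"
    by (simp_all add: algebra_simps)
  then show "(a * fst ((d * fst h - b * snd h) / ?\<Delta>, (a * snd h - c * fst h) / ?\<Delta>)
        + b * snd ((d * fst h - b * snd h) / ?\<Delta>, (a * snd h - c * fst h) / ?\<Delta>),
       c * fst ((d * fst h - b * snd h) / ?\<Delta>, (a * snd h - c * fst h) / ?\<Delta>)
        + d * snd ((d * fst h - b * snd h) / ?\<Delta>, (a * snd h - c * fst h) / ?\<Delta>)) = h"
    using assms by (simp add: add_divide_distrib[symmetric])
qed

text \<open>Evaluation at 1 and \<i> determines a + b and a - b. This lets the Wirtinger
  coefficients be read off from a known derivative.\<close>

lemma real_linear_form_unique:
  fixes a b c d :: complex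
  assumes "(\<lambda>h. a * h + b * cnj h) = (\<lambda>h. c * h + d * cnj h)"
  shows "a = c" "b = d"
proof -
  have "a * 1 + b * cnj 1 = c * 1 + d * cnj 1" "a * \<i> + b * cnj \<i> = c * \<i> + d * cnj \<i>"
    using fun_cong[OF assms] by blast+
  then have sum: "a + b = c + d" and "\<i> * (a - b) = \<i> * (c - d)" by (simp_all add: algebra_simps)
  then have diff: "a - b = c - d" by simp
  have "2 * a = (a + b) + (a - b)" "2 * b = (a + b) - (a - b)" by simp_all
  then have "2 * a = 2 * c" "2 * b = 2 * d" unfolding sum diff by simp_all
  then show "a = c" "b = d" by simp_all
qed

text \<open>The real inverse k exists by the inverse function theorem; its analyticity comes from a
  second inverse. Extending h and cnj h to F and G gives a map H of two complex variables tangent to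
  the identity, and its inverse K is complex differentiable by Cramer's rule.\<close>

lemma ra_germ_local_inverse:
  assumes h: "ra_germ h" and h0: "h 0 = 0" and hD: "(h has_derivative (\<lambda>u. u)) (at 0)"
  obtains k where "ra_germ k" "k 0 = 0" "(k has_derivative (\<lambda>u. u)) (at 0)"
    "\<forall>\<^sub>F z in nhds 0. h (k z) = z" "\<forall>\<^sub>F z in nhds 0. k (h z) = z"
proof -
  obtain F where F: "holo2 F" "\<forall>\<^sub>F z in nhds 0. h z = F (z, cnj z)"
    using h unfolding ra_germ_def by blast
  obtain G where G: "holo2 G" "\<forall>\<^sub>F z in nhds 0. cnj (h z) = G (z, cnj z)"
    using ra_germ_cnj[OF h] unfolding ra_germ_def by blast
  obtain A B where AB: "holo2 A" "holo2 B"
    "\<forall>\<^sub>F p in nhds 0. (F has_derivative (\<lambda>h. A p * fst h + B p * snd h)) (at p)"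
    using holo2_derivative[OF F(1)] .
  obtain C E where CE: "holo2 C" "holo2 E"
    "\<forall>\<^sub>F p in nhds 0. (G has_derivative (\<lambda>h. C p * fst h + E p * snd h)) (at p)"
    using holo2_derivative[OF G(1)] .
  have FG0: "F 0 = 0" "G 0 = 0"
    using eventually_nhds_x_imp_x[OF F(2)] eventually_nhds_x_imp_x[OF G(2)] h0
    by (simp_all add: zero_prod_def)
  have F2: "\<forall>\<^sub>F z in nhds 0. F (z, cnj z) = h z" using F(2) by eventually_elim simp
  have G2: "\<forall>\<^sub>F z in nhds 0. G (z, cnj z) = cnj (h z)" using G(2) by eventually_elim simp
  have "\<forall>\<^sub>F z in nhds 0. ((\<lambda>z. F (z, cnj z)) has_derivative
      (\<lambda>u. A (z, cnj z) * u + B (z, cnj z) * cnj u)) (at z)"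
    using eventually_slice[OF AB(3)] by eventually_elim (rule slice_has_derivative)
  note hder = eventually_has_derivative_cong[OF F2 this]
  have "\<forall>\<^sub>F z in nhds 0. ((\<lambda>z. G (z, cnj z)) has_derivative
      (\<lambda>u. C (z, cnj z) * u + E (z, cnj z) * cnj u)) (at z)"
    using eventually_slice[OF CE(3)] by eventually_elim (rule slice_has_derivative)
  note chder = eventually_has_derivative_cong[OF G2 this]
  have "(\<lambda>u. A (0, cnj 0) * u + B (0, cnj 0) * cnj u) = (\<lambda>u. 1 * u + 0 * cnj u)"
    using has_derivative_unique[OF eventually_nhds_x_imp_x[OF hder] hD] by simp
  from real_linear_form_unique[OF this] have AB0: "A 0 = 1" "B 0 = 0" by (simp_all add: zero_prod_def)
  have "(\<lambda>u. C (0, cnj 0) * u + E (0, cnj 0) * cnj u) = (\<lambda>u. 0 * u + 1 * cnj u)"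
    using has_derivative_unique[OF eventually_nhds_x_imp_x[OF chder] has_derivative_cnj[OF hD]] by simp
  from real_linear_form_unique[OF this] have CE0: "C 0 = 0" "E 0 = 1" by (simp_all add: zero_prod_def)

  have raA: "ra_germ (\<lambda>z. A (z, cnj z))" and raB: "ra_germ (\<lambda>z. B (z, cnj z))"
    using AB by (auto intro: ra_germI)
  have contk: "\<forall>\<^sub>F z in nhds 0. isCont (\<lambda>z. A (z, cnj z) * u + B (z, cnj z) * cnj u) z" for u
    using ra_germ_eventually_isCont[OF raA] ra_germ_eventually_isCont[OF raB]
    by eventually_elim (intro continuous_intros)
  have idk: "(\<lambda>u. A (0, cnj 0) * u + B (0, cnj 0) * cnj u) = (\<lambda>u. u)"
    using AB0 by (simp add: zero_prod_def)
  obtain k where k: "k 0 = 0" "\<forall>\<^sub>F z in nhds 0. h (k z) = z" "\<forall>\<^sub>F z in nhds 0. k (h z) = z" "isCont k 0"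
    "\<forall>\<^sub>F z in nhds 0. (k has_derivative inv (\<lambda>u. A (k z, cnj (k z)) * u + B (k z, cnj (k z)) * cnj u)) (at z)"
    by (rule local_inverse_near_identity[OF hder contk h0 idk]) blast

  define H where "H = (\<lambda>p. (F p, G p))"
  define H' where "H' = (\<lambda>p u. (A p * fst u + B p * snd u, C p * fst u + E p * snd u))"
  have HD: "\<forall>\<^sub>F p in nhds 0. (H has_derivative H' p) (at p)"
    using AB(3) CE(3) unfolding H_def H'_def by eventually_elim (rule has_derivative_Pair)
  have contH: "\<forall>\<^sub>F p in nhds 0. isCont (\<lambda>p. H' p u) p" for u
    using holo2_eventually_isCont[OF AB(1)] holo2_eventually_isCont[OF AB(2)]
      holo2_eventually_isCont[OF CE(1)] holo2_eventually_isCont[OF CE(2)]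
    unfolding H'_def by eventually_elim (intro continuous_intros)
  have H0: "H 0 = 0" using FG0 by (simp add: H_def zero_prod_def)
  have H'0: "H' 0 = (\<lambda>u. u)" by (simp add: H'_def AB0 CE0)
  obtain K where K: "K 0 = 0" "\<forall>\<^sub>F p in nhds 0. H (K p) = p" "\<forall>\<^sub>F p in nhds 0. K (H p) = p" "isCont K 0"
    "\<forall>\<^sub>F p in nhds 0. (K has_derivative inv (H' (K p))) (at p)"
    by (rule local_inverse_near_identity[OF HD contH H0 H'0]) blast
  define \<Delta> where "\<Delta> = (\<lambda>p. A p * E p - B p * C p)"
  have "isCont \<Delta> 0"
    unfolding \<Delta>_def using AB CE by (intro continuous_intros holo2_imp_isCont)
  moreover have "\<Delta> 0 \<noteq> 0" by (simp add: \<Delta>_def AB0 CE0)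
  ultimately have "\<forall>\<^sub>F p in nhds 0. \<Delta> p \<noteq> 0"
    using topological_tendstoD[OF isCont_imp_tendsto_nhds, where S = "- {0}"] by fastforce
  then have "\<forall>\<^sub>F p in nhds 0. \<Delta> (K p) \<noteq> 0"
    using eventually_nhds_compose[OF K(4), of "\<lambda>p. \<Delta> p \<noteq> 0"] K(1) by simp
  then have holoK: "holo2 (\<lambda>p. fst (K p))"
    using K(5) unfolding holo2_def
  proof eventually_elim
    case (elim p)
    then have "(K has_derivative (\<lambda>u. ((E (K p) * fst u - B (K p) * snd u) / \<Delta> (K p),
        (A (K p) * snd u - C (K p) * fst u) / \<Delta> (K p)))) (at p)"
      unfolding H'_def \<Delta>_def by (simp add: inv_linear_map_2x2)
    from has_derivative_fst[OF this] show ?case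
      by (intro exI[of _ "E (K p) / \<Delta> (K p)"] exI[of _ "- B (K p) / \<Delta> (K p)"])
        (simp add: diff_divide_distrib)
  qed
  \<comment> \<open>H sends (k z, cnj (k z)) to (z, cnj z), so applying K identifies k z with the
    first component of K (z, cnj z).\<close>
  have "isCont (\<lambda>z. (k z, cnj (k z))) 0" using k(4) by (intro continuous_intros)
  from eventually_nhds_compose[OF this, of "\<lambda>p. K (H p) = p"]
  have "\<forall>\<^sub>F z in nhds 0. K (H (k z, cnj (k z))) = (k z, cnj (k z))"
    using K(3) k(1) by (simp add: zero_prod_def)
  moreover have "\<forall>\<^sub>F z in nhds 0. F (k z, cnj (k z)) = h (k z)"
    "\<forall>\<^sub>F z in nhds 0. G (k z, cnj (k z)) = cnj (h (k z))"
    using eventually_nhds_compose[OF k(4), of "\<lambda>z. F (z, cnj z) = h z"] F2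
      eventually_nhds_compose[OF k(4), of "\<lambda>z. G (z, cnj z) = cnj (h z)"] G2 k(1) by simp_all
  ultimately have "\<forall>\<^sub>F z in nhds 0. k z = fst (K (z, cnj z))"
    using k(2) by eventually_elim (simp add: H_def)
  from ra_germI[OF holoK this] have rak: "ra_germ k" .
  have "(k has_derivative inv (\<lambda>u::complex. u)) (at 0)"
    using eventually_nhds_x_imp_x[OF k(5)] AB0 k(1) by (simp add: zero_prod_def)
  moreover have "inv (\<lambda>u::complex. u) = (\<lambda>u. u)" by (rule inv_equality) auto
  ultimately have "(k has_derivative (\<lambda>u. u)) (at 0)" by simp
  from that[OF rak k(1) this k(2,3)] show ?thesis .
qed

section \<open>The Hessian of an invariant function and the Morse lemma\<close>

lemma ra_germ_differentiable:
  assumes "ra_germ f"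
  obtains D where "(f has_derivative D) (at 0)"
proof -
  obtain a b where "ra_germ a" "ra_germ b"
    and D: "\<forall>\<^sub>F z in nhds 0. (f has_derivative (\<lambda>h. a z * h + b z * cnj h)) (at z)"
    using ra_germ_derivative[OF assms] .
  show thesis using that[OF eventually_nhds_x_imp_x[OF D]] .
qed

lemma linear_remainder_has_derivative:
  assumes "ra_germ a" "ra_germ b"
  shows "((\<lambda>z. z * a z + cnj z * b z) has_derivative (\<lambda>h. a 0 * h + b 0 * cnj h)) (at 0)"
proof -
  obtain D where D: "(a has_derivative D) (at 0)" using ra_germ_differentiable[OF assms(1)] .
  obtain E where E: "(b has_derivative E) (at 0)" using ra_germ_differentiable[OF assms(2)] .
  show ?thesis
    using has_derivative_add[OF has_derivative_mult[OF has_derivative_ident D]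
        has_derivative_mult[OF has_derivative_cnj[OF has_derivative_ident] E]]
    by (simp add: mult.commute)
qed

text \<open>Iterating \<open>ra_germ_linear_remainder\<close> gives second-order terms in z^2, z cnj
  z and (cnj z)^2. On taking real parts, the last is conjugated and merged with the first. The
  identity is exact because the coefficients remain functions of z.\<close>

lemma of_real_taylor2:
  fixes I :: "complex \<Rightarrow> real"
  assumes "ra_germ (\<lambda>z. of_real (I z))"
  obtains m \<gamma> B where "ra_germ \<gamma>" "ra_germ (\<lambda>z. of_real (B z))"
    "\<forall>\<^sub>F z in nhds 0. I z = I 0 + Re (m * z) + Re (z\<^sup>2 * \<gamma> z) + (cmod z)\<^sup>2 * B z"
proof -
  let ?f = "\<lambda>z. complex_of_real (I z)"
  obtain a b where ab: "ra_germ a" "ra_germ b" "\<forall>\<^sub>F z in nhds 0. ?f z = ?f 0 + z * a z + cnj z * b z"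
    using ra_germ_linear_remainder[OF assms] .
  obtain a1 a2 where a: "ra_germ a1" "ra_germ a2" "\<forall>\<^sub>F z in nhds 0. a z = a 0 + z * a1 z + cnj z * a2 z"
    using ra_germ_linear_remainder[OF ab(1)] .
  obtain b1 b2 where b: "ra_germ b1" "ra_germ b2" "\<forall>\<^sub>F z in nhds 0. b z = b 0 + z * b1 z + cnj z * b2 z"
    using ra_germ_linear_remainder[OF ab(2)] .
  show thesis
  proof (rule that)
    show "ra_germ (\<lambda>z. a1 z + cnj (b2 z))" by (intro ra_germ_add ra_germ_cnj a b)
    show "ra_germ (\<lambda>z. of_real (Re (a2 z + b1 z)))" by (intro ra_germ_add ra_germ_Re a b)
    show "\<forall>\<^sub>F z in nhds 0. I z = I 0 + Re ((a 0 + cnj (b 0)) * z) + Re (z\<^sup>2 * (a1 z + cnj (b2 z)))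
      + (cmod z)\<^sup>2 * Re (a2 z + b1 z)"
      using ab(3) a(3) b(3)
    proof eventually_elim
      case (elim z)
      have "I z = Re (?f z)" by simp
      also have "?f z = ?f 0 + (a 0 * z + cnj z * b 0) + (z\<^sup>2 * a1 z + (cnj z)\<^sup>2 * b2 z) + (z * cnj z) * (a2 z + b1 z)"
        unfolding elim(1) elim(2) elim(3) by (simp add: algebra_simps power2_eq_square)
      also have "z * cnj z = of_real ((cmod z)\<^sup>2)" by (rule complex_norm_square[symmetric])
      finally show ?case
        by (simp add: algebra_simps power2_eq_square)
    qed
  qed
qed

lemma linear_of_real_mult: "linear L \<Longrightarrow> L (complex_of_real t * v) = t *\<^sub>R L v"
  by (simp add: scaleR_conv_of_real[symmetric] linear_scale)

text \<open>On the ray through v the function is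
  \<open>\<phi> 0 + t * (Re (m * v) + t * q t)\<close>. The Hessian controls its derivative near t =
  0, and a comparison with a parabola transfers positivity to q 0. A positive lower bound is all
  that is extracted.\<close>

lemma nondegenerate_local_min_quadratic:
  assumes min: "nondegenerate_local_min I"
    and \<gamma>: "isCont \<gamma> 0" and B: "isCont B 0"
    and I: "\<forall>\<^sub>F z in nhds 0. I z = I 0 + Re (m * z) + Re (z\<^sup>2 * \<gamma> z) + (cmod z)\<^sup>2 * B z"
    and v: "v \<noteq> 0"
  shows "Re (m * v) = 0" "Re (v\<^sup>2 * \<gamma> 0) + (cmod v)\<^sup>2 * B 0 > 0"
proof -
  obtain D H where D: "\<forall>\<^sub>F z in nhds 0. (I has_derivative blinfun_apply (D z)) (at z)"
    and D0: "D 0 = 0" and H: "(D has_derivative H) (at 0)"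
    and posH: "\<forall>v. v \<noteq> 0 \<longrightarrow> blinfun_apply (H v) v > 0"
    using min unfolding nondegenerate_local_min_def by (elim exE conjE)
  have pos: "blinfun_apply (H v) v > 0" using posH v by simp
  define c where "c = blinfun_apply (H v) v"
  define \<phi> where "\<phi> = (\<lambda>t::real. I (of_real t * v))"
  define \<phi>' where "\<phi>' = (\<lambda>t::real. blinfun_apply (D (of_real t * v)) v)"
  define q where "q = (\<lambda>t::real. Re (v\<^sup>2 * \<gamma> (of_real t * v)) + (cmod v)\<^sup>2 * B (of_real t * v))"
  have cs: "isCont (\<lambda>t::real. of_real t * v) 0" by (intro continuous_intros)
  have ray: "\<forall>\<^sub>F t in nhds (0::real). P (of_real t * v)" if "\<forall>\<^sub>F z in nhds 0. P z" for P
    using eventually_nhds_compose[OF cs, of P] that by simp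
  have \<phi>D: "\<forall>\<^sub>F t in nhds 0. (\<phi> has_real_derivative \<phi>' t) (at t)"
    using ray[OF D]
  proof eventually_elim
    case (elim t)
    have "((\<lambda>t::real. of_real t * v) has_derivative (\<lambda>h. of_real h * v)) (at t)"
      by (auto intro!: derivative_eq_intros)
    from has_derivative_compose[OF this elim] show ?case
      unfolding \<phi>_def \<phi>'_def has_field_derivative_def
      by (simp add: linear_of_real_mult[OF has_derivative_linear[OF elim]] mult_commute_abs)
  qed
  have Dv: "((\<lambda>z. blinfun_apply (D z) v) has_derivative (\<lambda>h. blinfun_apply (H h) v)) (at 0)"
    by (rule bounded_linear.has_derivative[OF blinfun.bounded_linear_left H])
  have "((\<lambda>t::real. of_real t * v) has_derivative (\<lambda>h. of_real h * v)) (at 0)"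
    by (auto intro!: derivative_eq_intros)
  moreover have "((\<lambda>z. blinfun_apply (D z) v) has_derivative (\<lambda>h. blinfun_apply (H h) v))
      (at (of_real 0 * v))"
    using Dv by simp
  ultimately have "((\<lambda>t. blinfun_apply (D (of_real t * v)) v) has_derivative
      (\<lambda>h. blinfun_apply (H (of_real h * v)) v)) (at 0)"
    by (rule has_derivative_compose)
  then
  have \<phi>'D: "(\<phi>' has_real_derivative c) (at 0)"
    unfolding \<phi>'_def has_field_derivative_def c_def
    by (simp add: linear_of_real_mult[OF has_derivative_linear[OF H]] blinfun.scaleR_left
        mult_commute_abs)
  have \<phi>q: "\<forall>\<^sub>F t in nhds 0. \<phi> t = \<phi> 0 + t * (Re (m * v) + t * q t)"
    using ray[OF I]
  proof eventually_elim
    case (elim t)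
    have "Re (m * (of_real t * v)) = t * Re (m * v)" by (simp add: algebra_simps)
    moreover have "Re ((of_real t * v)\<^sup>2 * w) = t * (t * Re (v\<^sup>2 * w))" for w
      by (simp add: power_mult_distrib power2_eq_square algebra_simps)
    ultimately show ?case using elim
      by (simp add: \<phi>_def q_def norm_mult power_mult_distrib power2_eq_square algebra_simps)
  qed
  have qc: "isCont q 0"
    unfolding q_def using isCont_o2[OF cs, of \<gamma>] isCont_o2[OF cs, of B] \<gamma> B
    by (intro continuous_intros continuous_Re) simp_all
  have \<phi>0: "(\<phi> has_real_derivative 0) (at 0)"
    using eventually_nhds_x_imp_x[OF \<phi>D] by (simp add: \<phi>'_def D0)
  then have "((\<lambda>t. (\<phi> t - \<phi> 0) / t) \<longlongrightarrow> 0) (at 0)"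
    by (simp add: DERIV_def)
  moreover have "((\<lambda>t. (\<phi> t - \<phi> 0) / t) \<longlongrightarrow> Re (m * v)) (at 0)"
  proof (rule Lim_transform_eventually)
    have "isCont (\<lambda>t. Re (m * v) + t * q t) 0" using qc by (intro continuous_intros)
    then show "((\<lambda>t. Re (m * v) + t * q t) \<longlongrightarrow> Re (m * v)) (at 0)" by (simp add: isCont_def)
    show "\<forall>\<^sub>F t in at 0. Re (m * v) + t * q t = (\<phi> t - \<phi> 0) / t"
      using \<phi>q by (auto simp: eventually_at_filter elim!: eventually_mono)
  qed
  ultimately show mv: "Re (m * v) = 0" using LIM_unique by fastforce
  have "((\<lambda>t. \<phi>' t / t) \<longlongrightarrow> c) (at 0)"
    using \<phi>'D by (simp add: DERIV_def \<phi>'_def D0)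
  then have "((\<lambda>t. \<phi>' t / t) \<longlongrightarrow> c) (at_right 0)" by (rule tendsto_within_subset) simp
  moreover have c: "c > 0" using pos by (simp add: c_def)
  \<comment> \<open>Half of the limit c leaves room for a strict inequality; its integral t^2 c / 4
    is the comparison parabola.\<close>
  ultimately have "\<forall>\<^sub>F t in at_right 0. \<phi>' t / t > c / 2"
    by (intro order_tendstoD(1)) auto
  then have "\<forall>\<^sub>F t in at_right 0. \<phi>' t > t * c / 2 \<and> (\<phi> has_real_derivative \<phi>' t) (at t)
      \<and> \<phi> t = \<phi> 0 + t * (Re (m * v) + t * q t)"
    using eventually_at_right_less[of 0] filter_leD[OF at_within_le_nhds \<phi>D]
      filter_leD[OF at_within_le_nhds \<phi>q]
    by eventually_elim (simp add: field_simps)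
  then obtain d where d: "d > 0"
    "\<And>t. 0 < t \<Longrightarrow> t < d \<Longrightarrow> \<phi>' t > t * c / 2 \<and> (\<phi> has_real_derivative \<phi>' t) (at t)
      \<and> \<phi> t = \<phi> 0 + t * (Re (m * v) + t * q t)"
    unfolding eventually_at_right_field by auto
  have qge: "q t \<ge> c / 4" if t: "0 < t" "t < d" for t
  proof -
    have "\<exists>z>0. z < t \<and> (\<phi> t - t\<^sup>2 * c / 4) - (\<phi> 0 - 0\<^sup>2 * c / 4) = (t - 0) * (\<phi>' z - z * c / 2)"
    proof (rule MVT2[OF t(1)])
      fix x assume x: "0 \<le> x" "x \<le> t"
      have "(\<phi> has_real_derivative \<phi>' x) (at x)"
        using \<phi>0 d(2)[of x] x t by (cases "x = 0") (auto simp: \<phi>'_def D0)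
      then show "((\<lambda>t. \<phi> t - t\<^sup>2 * c / 4) has_real_derivative \<phi>' x - x * c / 2) (at x)"
        by (auto intro!: derivative_eq_intros)
    qed
    then obtain z where z: "0 < z" "z < t" "\<phi> t - t\<^sup>2 * c / 4 - \<phi> 0 = t * (\<phi>' z - z * c / 2)" by auto
    have "t * (\<phi>' z - z * c / 2) \<ge> 0" using d(2)[of z] z t by (intro mult_nonneg_nonneg) auto
    then have "\<phi> t - \<phi> 0 \<ge> t\<^sup>2 * c / 4" using z by linarith
    moreover have "\<phi> t - \<phi> 0 = t\<^sup>2 * q t" using d(2)[OF t] mv by (simp add: power2_eq_square)
    ultimately have "t\<^sup>2 * (c / 4) \<le> t\<^sup>2 * q t" by simp
    then show ?thesis using t by simp
  qed
  have "(q \<longlongrightarrow> q 0) (at_right 0)" using qc by (simp add: continuous_at filterlim_at_split)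
  moreover have "\<forall>\<^sub>F t in at_right 0. c / 4 \<le> q t"
    unfolding eventually_at_right_field using d(1) qge by auto
  ultimately have "c / 4 \<le> q 0" by (rule tendsto_lowerbound) simp
  then show "Re (v\<^sup>2 * \<gamma> 0) + (cmod v)\<^sup>2 * B 0 > 0" using c by (simp add: q_def)
qed

text \<open>The linear part keeps |z|^2 and multiplies z^2 by \<mu>^2. Comparing the t^2 terms of I
  and of I after f along a ray t v therefore gives Re ((\<mu>^2 - 1) (\<gamma> 0) v^2) = 0.\<close>

lemma invariant_quadratic_part:
  assumes f: "ra_germ f" "f 0 = 0" "(f has_derivative (\<lambda>z. \<mu> * z)) (at 0)" "norm \<mu> = 1"
    and \<gamma>: "isCont \<gamma> 0" and B: "isCont B 0"
    and I: "\<forall>\<^sub>F z in nhds 0. I z = I 0 + Re (z\<^sup>2 * \<gamma> z) + (cmod z)\<^sup>2 * (B z :: real)"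
    and inv: "\<forall>\<^sub>F z in nhds 0. I (f z) = I z"
  shows "(\<mu>\<^sup>2 - 1) * \<gamma> 0 = 0"
proof -
  obtain a b where ab: "ra_germ a" "ra_germ b" "\<forall>\<^sub>F z in nhds 0. f z = f 0 + z * a z + cnj z * b z"
    using ra_germ_linear_remainder[OF f(1)] .
  have fe: "\<forall>\<^sub>F z in nhds 0. z * a z + cnj z * b z = f z"
    using ab(3) by eventually_elim (simp add: f(2))
  have "(f has_derivative (\<lambda>h. a 0 * h + b 0 * cnj h)) (at 0)"
  proof (rule has_derivative_transform_eventually[OF linear_remainder_has_derivative[OF ab(1,2)]])
    show "\<forall>\<^sub>F z in at 0. z * a z + cnj z * b z = f z"
      using fe by (auto simp: eventually_at_filter elim!: eventually_mono)
  qed (use f in auto)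
  then have "(\<lambda>h. a 0 * h + b 0 * cnj h) = (\<lambda>h. \<mu> * h + 0 * cnj h)"
    using has_derivative_unique[OF _ f(3)] by simp
  from real_linear_form_unique[OF this] have ab0: "a 0 = \<mu>" "b 0 = 0" by auto
  \<comment> \<open>For this direction the number whose real part vanishes is the squared modulus of
    (\<mu>^2 - 1) (\<gamma> 0).\<close>
  define v where "v = csqrt (cnj ((\<mu>\<^sup>2 - 1) * \<gamma> 0))"
  have v2: "v\<^sup>2 = cnj ((\<mu>\<^sup>2 - 1) * \<gamma> 0)" by (simp add: v_def)
  have cs: "isCont (\<lambda>t::real. of_real t * v) 0" by (intro continuous_intros)
  have ray: "\<forall>\<^sub>F t in nhds (0::real). P (of_real t * v)" if "\<forall>\<^sub>F z in nhds 0. P z" for P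
    using eventually_nhds_compose[OF cs, of P] that by simp
  \<comment> \<open>This is f (t v) / t extended continuously to t = 0, so that t^2 can be cancelled
    before passing to the limit.\<close>
  define e where "e = (\<lambda>t::real. v * a (of_real t * v) + cnj v * b (of_real t * v))"
  have comp: "isCont (\<lambda>t::real. g (of_real t * v)) 0" if "isCont g 0" for g :: "complex \<Rightarrow> 'b::topological_space"
    using isCont_o2[OF cs, of g] that by simp
  have ec: "isCont e 0" unfolding e_def
    by (intro continuous_intros comp ra_germ_isCont ab)
  have e0: "e 0 = \<mu> * v" by (simp add: e_def ab0)
  have fc: "isCont f 0" by (rule ra_germ_isCont[OF f(1)])
  have compf: "isCont (\<lambda>t::real. g (f (of_real t * v))) 0" if "isCont g 0" for g :: "complex \<Rightarrow> 'b::topological_space"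
    using isCont_o2[OF comp[OF fc], of g] that f(2) by simp
  let ?L = "\<lambda>t. Re ((e t)\<^sup>2 * \<gamma> (f (of_real t * v))) + (cmod (e t))\<^sup>2 * B (f (of_real t * v))"
  let ?R = "\<lambda>t. Re (v\<^sup>2 * \<gamma> (of_real t * v)) + (cmod v)\<^sup>2 * B (of_real t * v)"
  have "isCont ?L 0" by (intro continuous_intros continuous_Re ec compf \<gamma> B)
  then have L: "(?L \<longlongrightarrow> ?L 0) (at 0)" by (simp add: isCont_def)
  have "isCont ?R 0" by (intro continuous_intros continuous_Re comp \<gamma> B)
  then have R: "(?R \<longlongrightarrow> ?R 0) (at 0)" by (simp add: isCont_def)
  have If: "\<forall>\<^sub>F z in nhds 0. I (f z) = I 0 + Re ((f z)\<^sup>2 * \<gamma> (f z)) + (cmod (f z))\<^sup>2 * B (f z)"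
    using eventually_nhds_compose[OF fc, of "\<lambda>z. I z = I 0 + Re (z\<^sup>2 * \<gamma> z) + (cmod z)\<^sup>2 * B z"] I f(2) by simp
  have "\<forall>\<^sub>F t in nhds 0. t \<noteq> 0 \<longrightarrow> ?L t = ?R t"
    using ray[OF If] ray[OF I] ray[OF inv] ray[OF fe]
  proof eventually_elim
    case (elim t)
    have ft: "f (of_real t * v) = of_real t * e t"
      using elim(4) by (simp add: e_def algebra_simps)
    have sq: "Re ((of_real t * u)\<^sup>2 * w) + (cmod (of_real t * u))\<^sup>2 * y = t\<^sup>2 * (Re (u\<^sup>2 * w) + (cmod u)\<^sup>2 * y)" for u w y
      by (simp add: norm_mult power_mult_distrib power2_eq_square algebra_simps)
    have "t\<^sup>2 * ?L t = I (f (of_real t * v)) - I 0"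
      unfolding sq[symmetric] ft[symmetric] using elim(1) by simp
    also have "\<dots> = t\<^sup>2 * ?R t" unfolding sq[symmetric] using elim by simp
    finally show ?case by (simp only: mult_cancel_left zero_eq_power2) blast
  qed
  then have "\<forall>\<^sub>F t in at 0. ?L t = ?R t" by (simp add: eventually_at_filter)
  then have "(?R \<longlongrightarrow> ?L 0) (at 0)" by (rule Lim_transform_eventually[OF L])
  from LIM_unique[OF this R] have "?L 0 = ?R 0" .
  then have "Re (\<mu>\<^sup>2 * v\<^sup>2 * \<gamma> 0) = Re (v\<^sup>2 * \<gamma> 0)"
    using f(2,4) by (simp add: e0 norm_mult power_mult_distrib)
  then have "Re (((\<mu>\<^sup>2 - 1) * \<gamma> 0) * v\<^sup>2) = 0" by (simp add: algebra_simps)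
  then have "Re (((\<mu>\<^sup>2 - 1) * \<gamma> 0) * cnj ((\<mu>\<^sup>2 - 1) * \<gamma> 0)) = 0" by (simp only: v2)
  then have "(cmod ((\<mu>\<^sup>2 - 1) * \<gamma> 0))\<^sup>2 = 0"
    by (simp only: complex_norm_square[symmetric] Re_complex_of_real)
  then show ?thesis by (simp only: zero_eq_power2 norm_eq_zero)
qed

section \<open>The Morse lemma\<close>

lemma real_quadratic_root:
  fixes \<beta> s :: real
  assumes "p = (\<beta> + sqrt (\<beta>\<^sup>2 - 4 * s)) / 2" "\<beta>\<^sup>2 - 4 * s \<ge> 0"
  shows "p\<^sup>2 + s = \<beta> * p"
proof -
  define r where "r = sqrt (\<beta>\<^sup>2 - 4 * s)"
  have "r\<^sup>2 = \<beta>\<^sup>2 - 4 * s" using assms(2) by (simp add: r_def)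
  then have s: "s = (\<beta>\<^sup>2 - r\<^sup>2) / 4" by simp
  have p: "p = (\<beta> + r) / 2" by (simp add: assms(1) r_def)
  show ?thesis unfolding s p by (simp add: field_simps power2_eq_square)
qed

text \<open>The quadratic form \<open>2 Re (\<alpha> z\<^sup>2) + B \<bar>z\<bar>\<^sup>2\<close> with variable coefficients is factored as
  \<open>P \<bar>z + s cnj z\<bar>\<^sup>2\<close>, where \<open>P\<close> is the root near \<open>1\<close> of \<open>P\<^sup>2 - B P + \<bar>\<alpha>\<bar>\<^sup>2 = 0\<close> and \<open>s = cnj \<alpha> / P\<close>.\<close>

lemma morse_lemma:
  assumes \<alpha>: "ra_germ \<alpha>" "\<alpha> 0 = 0" and B: "ra_germ (\<lambda>z. of_real (B z))" "B 0 = (1::real)"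
  obtains Z where "ra_germ Z" "Z 0 = 0" "(Z has_derivative (\<lambda>h. h)) (at 0)"
    "\<forall>\<^sub>F z in nhds 0. (cmod (Z z))\<^sup>2 = 2 * Re (z\<^sup>2 * \<alpha> z) + (cmod z)\<^sup>2 * B z"
proof -
  \<comment> \<open>The discriminant of the equation for P. Both d and P equal 1 at the origin, away
    from the branch cut of \<open>csqrt\<close>.\<close>
  define d where "d = (\<lambda>z. complex_of_real (B z) * of_real (B z) + (-4) * (\<alpha> z * cnj (\<alpha> z)))"
  define P where "P = (\<lambda>z. 1/2 * (complex_of_real (B z) + csqrt (d z)))"
  define lam where "lam = (\<lambda>z. csqrt (P z))"
  \<comment> \<open>The square root of P is distributed over both summands of z + s cnj z, so that
    the squared modulus of Z absorbs the factor P.\<close>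
  define \<sigma> where "\<sigma> = (\<lambda>z. lam z * (cnj (\<alpha> z) / P z))"
  define Z where "Z = (\<lambda>z. z * lam z + cnj z * \<sigma> z)"
  have 0: "d 0 = 1" "P 0 = 1" "lam 0 = 1" "\<sigma> 0 = 0"
    by (simp_all add: d_def P_def lam_def \<sigma>_def \<alpha> B)
  have csq: "csqrt analytic_on {1}" by (intro analytic_intros) auto
  have "ra_germ d" unfolding d_def by (intro ra_germ_add ra_germ_mult ra_germ_cnj \<alpha> B ra_germ_const)
  then have "ra_germ (\<lambda>z. csqrt (d z))" by (rule ra_germ_compose1) (simp add: 0 csq)
  then have P: "ra_germ P" unfolding P_def by (intro ra_germ_add ra_germ_mult B ra_germ_const)
  then have lam: "ra_germ lam" unfolding lam_def by (rule ra_germ_compose1) (simp add: 0 csq)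
  then have \<sigma>: "ra_germ \<sigma>"
    unfolding \<sigma>_def by (intro ra_germ_mult ra_germ_divide ra_germ_cnj \<alpha> P) (simp_all add: 0)
  have Z: "ra_germ Z" unfolding Z_def by (intro ra_germ_add ra_germ_mult lam \<sigma> ra_germ_id ra_germ_cnj_id)
  have ZD: "(Z has_derivative (\<lambda>h. h)) (at 0)"
    using linear_remainder_has_derivative[OF lam \<sigma>] by (simp add: Z_def 0)
  have Bc: "isCont B 0"
    using ra_germ_isCont[OF ra_germ_Re[OF B(1)]] continuous_Re[of _ "\<lambda>z. complex_of_real (B z)"] by simp
  have dc: "isCont (\<lambda>z. (B z)\<^sup>2 - 4 * (cmod (\<alpha> z))\<^sup>2) 0"
    by (intro continuous_intros Bc ra_germ_isCont \<alpha>)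
  have "\<forall>\<^sub>F z in nhds 0. B z > 0"
    using topological_tendstoD[OF isCont_imp_tendsto_nhds[OF Bc], of "{0<..}"] B(2) by simp
  moreover have "\<forall>\<^sub>F z in nhds 0. (B z)\<^sup>2 - 4 * (cmod (\<alpha> z))\<^sup>2 > 0"
    using topological_tendstoD[OF isCont_imp_tendsto_nhds[OF dc], of "{0<..}"] B(2) \<alpha>(2) by simp
  ultimately have "\<forall>\<^sub>F z in nhds 0. (cmod (Z z))\<^sup>2 = 2 * Re (z\<^sup>2 * \<alpha> z) + (cmod z)\<^sup>2 * B z"
  proof eventually_elim
    case (elim z)
    define s where "s = (cmod (\<alpha> z))\<^sup>2"
    have norm_add_sq: "(cmod (x + y))\<^sup>2 = (cmod x)\<^sup>2 + (cmod y)\<^sup>2 + 2 * Re (x * cnj y)" for x y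
      unfolding cmod_power2 by (simp add: power2_eq_square algebra_simps)
    have divide_arith: "p * (n + n * s / p\<^sup>2 + 2 * (R / p)) = 2 * R + n * ((p\<^sup>2 + s) / p)"
      if "p > 0" for n R p :: real
      using that by (simp add: field_simps power2_eq_square)
    define p where "p = (B z + sqrt ((B z)\<^sup>2 - 4 * s)) / 2"
    have p: "p > 0" using elim by (simp add: p_def s_def add_pos_nonneg)
    have root: "p\<^sup>2 + s = B z * p" by (rule real_quadratic_root[OF p_def]) (use elim in \<open>simp add: s_def\<close>)
    have "d z = of_real ((B z)\<^sup>2 - 4 * s)"
      by (simp add: d_def s_def complex_norm_square[symmetric] power2_eq_square del: of_real_power)
    then have "P z = of_real p" using elim by (simp add: P_def p_def s_def csqrt_of_real_nonneg)
    then have l: "lam z = of_real (sqrt p)" "\<sigma> z = of_real (sqrt p) * (cnj (\<alpha> z) / of_real p)"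
      using p by (simp_all add: lam_def \<sigma>_def csqrt_of_real_nonneg)
    have "Z z = of_real (sqrt p) * (z + cnj z * cnj (\<alpha> z) / of_real p)"
      by (simp add: Z_def l algebra_simps)
    then have "(cmod (Z z))\<^sup>2 = p * (cmod (z + cnj z * cnj (\<alpha> z) / of_real p))\<^sup>2"
      using p by (simp add: norm_mult power_mult_distrib)
    also have "(cmod (z + cnj z * cnj (\<alpha> z) / of_real p))\<^sup>2
      = (cmod z)\<^sup>2 + (cmod (cnj z * cnj (\<alpha> z) / of_real p))\<^sup>2 + 2 * Re (z * cnj (cnj z * cnj (\<alpha> z) / of_real p))"
      by (rule norm_add_sq)
    also have "z * cnj (cnj z * cnj (\<alpha> z) / of_real p) = (z\<^sup>2 * \<alpha> z) / of_real p"
      by (simp add: power2_eq_square)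
    also have "(cmod (cnj z * cnj (\<alpha> z) / of_real p))\<^sup>2 = (cmod z)\<^sup>2 * s / p\<^sup>2"
      by (simp add: norm_mult norm_divide power_mult_distrib power_divide s_def)
    also have "p * ((cmod z)\<^sup>2 + (cmod z)\<^sup>2 * s / p\<^sup>2 + 2 * Re ((z\<^sup>2 * \<alpha> z) / of_real p))
      = 2 * Re (z\<^sup>2 * \<alpha> z) + (cmod z)\<^sup>2 * ((p\<^sup>2 + s) / p)"
      unfolding Re_divide_of_real using p by (intro divide_arith)
    also have "(p\<^sup>2 + s) / p = B z" using p by (simp add: root)
    finally show ?case .
  qed
  from that[OF Z _ ZD this] show thesis by (simp add: Z_def)
qed

section \<open>Angular derivatives\<close>

lemma bounded_coeffs_conv_radius_pos:
  fixes a :: "nat \<Rightarrow> 'a::{banach,real_normed_div_algebra}"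
  assumes "s > 0" "\<And>k. norm (a k) * s ^ k \<le> M"
  shows "fps_conv_radius (Abs_fps a) > 0"
proof -
  have "summable (\<lambda>k. a k * of_real (s / 2) ^ k)"
  proof (rule summable_comparison_test)
    show "summable (\<lambda>k. M * (1/2) ^ k)" by (intro summable_mult summable_geometric) simp
    have "norm (a k * of_real (s / 2) ^ k) = norm (a k) * s ^ k * (1/2) ^ k" for k
      using assms(1) by (simp only: norm_mult norm_power norm_of_real) (simp add: power_divide)
    also have "norm (a k) * s ^ k * (1/2) ^ k \<le> M * (1/2) ^ k" for k
      by (intro mult_right_mono assms(2)) simp
    finally show "\<exists>N. \<forall>n\<ge>N. norm (a n * of_real (s / 2) ^ n) \<le> M * (1/2) ^ n" by blast
  qed
  then have "conv_radius a \<ge> norm (of_real (s / 2) :: 'a)" by (rule conv_radius_geI)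
  from less_le_trans[OF _ this, of 0] show ?thesis
    unfolding fps_conv_radius_def using assms(1) by simp
qed

lemma has_sum_diff:
  fixes f g :: "'i \<Rightarrow> complex"
  assumes "(f has_sum a) A" "(g has_sum b) A"
  shows "((\<lambda>x. f x - g x) has_sum (a - b)) A"
  using has_sum_add[OF assms(1) has_sum_cmult_right[OF assms(2), of "-1"]] by simp

text \<open>The coefficients of z d/dz - w d/dw applied to the series; on w = cnj z this operator is
  -\<i> times the derivative along rotations.\<close>

definition euler_coeffs :: "(nat \<Rightarrow> nat \<Rightarrow> complex) \<Rightarrow> nat \<Rightarrow> nat \<Rightarrow> complex" where
  "euler_coeffs c j k = (of_nat j - of_nat k) * c j k"

lemma geom_bounded_euler:
  assumes "geom_bounded c R" "0 < r" "r < R"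
  shows "geom_bounded (euler_coeffs c) r"
proof -
  obtain M where M: "\<And>j k. norm (c j k) * R ^ (j + k) \<le> M"
    using assms(1) unfolding geom_bounded_def by blast
  have M0: "M \<ge> 0" using order_trans[OF norm_ge_zero M[of 0 0, simplified]] .
  obtain C where C: "\<And>n. real n * (r / R) ^ n \<le> C"
    using nat_mult_power_bounded[of "r / R"] assms by auto
  have "norm (euler_coeffs c j k) * r ^ (j + k) \<le> C * M" for j k
  proof -
    have "norm (of_nat j - of_nat k :: complex) \<le> real (j + k)"
      using norm_triangle_ineq4[of "of_nat j :: complex" "of_nat k"] by simp
    then have "norm (euler_coeffs c j k) * r ^ (j + k) \<le> (real (j + k) * norm (c j k)) * r ^ (j + k)"
      unfolding euler_coeffs_def norm_mult using assms by (intro mult_right_mono) auto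
    also have "\<dots> = (real (j + k) * (r / R) ^ (j + k)) * (norm (c j k) * R ^ (j + k))"
      using assms by (simp add: power_divide)
    also have "\<dots> \<le> C * M"
      using assms M0 by (intro mult_mono C M order_trans[OF _ C[of 0]]) auto
    finally show ?thesis .
  qed
  then show ?thesis unfolding geom_bounded_def by blast
qed

lemma psum_euler:
  assumes "geom_bounded c R" "norm z < R" "norm w < R"
  shows "z * psum (\<lambda>j k. of_nat (Suc j) * c (Suc j) k) z w
       - w * psum (\<lambda>j k. of_nat (Suc k) * c j (Suc k)) z w = psum (euler_coeffs c) z w"
proof -
  have p: "of_nat n * (x * x ^ (n - 1)) = of_nat n * x ^ n" for x :: complex and n
    by (cases n) auto
  have "((\<lambda>x. z * (case x of (j, k) \<Rightarrow> of_nat j * c j k * z ^ (j - 1) * w ^ k)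
       - w * (case x of (j, k) \<Rightarrow> of_nat k * c j k * z ^ j * w ^ (k - 1))) has_sum
      (z * psum (\<lambda>j k. of_nat (Suc j) * c (Suc j) k) z w
       - w * psum (\<lambda>j k. of_nat (Suc k) * c j (Suc k)) z w)) UNIV"
    by (intro has_sum_diff has_sum_cmult_right psum_deriv1_has_sum(1)[OF assms]
        psum_deriv2_has_sum(1)[OF assms])
  also have "(\<lambda>x. z * (case x of (j, k) \<Rightarrow> of_nat j * c j k * z ^ (j - 1) * w ^ k)
       - w * (case x of (j, k) \<Rightarrow> of_nat k * c j k * z ^ j * w ^ (k - 1)))
    = (\<lambda>(j, k). euler_coeffs c j k * z ^ j * w ^ k)"
  proof (rule ext, clarify)
    fix j k
    have "z * (of_nat j * c j k * z ^ (j - 1) * w ^ k) - w * (of_nat k * c j k * z ^ j * w ^ (k - 1))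
       = (of_nat j * (z * z ^ (j - 1))) * (c j k * w ^ k) - (of_nat k * (w * w ^ (k - 1))) * (c j k * z ^ j)"
      by (simp add: mult_ac)
    also have "\<dots> = euler_coeffs c j k * z ^ j * w ^ k"
      unfolding p by (simp add: euler_coeffs_def algebra_simps)
    finally show "z * (of_nat j * c j k * z ^ (j - 1) * w ^ k) - w * (of_nat k * c j k * z ^ j * w ^ (k - 1))
      = euler_coeffs c j k * z ^ j * w ^ k" .
  qed
  finally show ?thesis unfolding psum_def by (simp add: infsumI)
qed

lemma psum_angular_derivative:
  assumes "geom_bounded c R" "norm z < R"
  shows "\<exists>D. ((\<lambda>z. psum c z (cnj z)) has_derivative D) (at z) \<and>
    D (\<i> * z) = \<i> * psum (euler_coeffs c) z (cnj z)"
proof -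
  have w: "norm (cnj z) < R" using assms by simp
  from slice_has_derivative[OF psum_has_derivative[OF assms(1,2) w]]
  show ?thesis
    using psum_euler[OF assms(1,2) w] by (fastforce simp: algebra_simps)
qed

text \<open>The angular mean: averaging over rotations keeps exactly the monomials with j =
  k.\<close>

definition diag_coeffs :: "(nat \<Rightarrow> nat \<Rightarrow> complex) \<Rightarrow> nat \<Rightarrow> nat \<Rightarrow> complex" where
  "diag_coeffs c j k = (if j = k then c j k else 0)"

lemma geom_bounded_diag:
  assumes "geom_bounded c R" "R > 0"
  shows "geom_bounded (diag_coeffs c) R"
proof -
  obtain M where M: "\<And>j k. norm (c j k) * R ^ (j + k) \<le> M"
    using assms(1) unfolding geom_bounded_def by blast
  have "0 \<le> M" using order_trans[OF _ M[of 0 0], of 0] by simp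
  then have "norm (diag_coeffs c j k) * R ^ (j + k) \<le> M" for j k
    using M[of j k] by (auto simp: diag_coeffs_def)
  then show ?thesis unfolding geom_bounded_def by blast
qed

lemma psum_diag_sums:
  assumes "geom_bounded c R" "norm z < R" "norm w < R"
  shows "(\<lambda>k. c k k * (z * w) ^ k) sums psum (diag_coeffs c) z w"
proof -
  have R: "R > 0" using assms(2) norm_ge_zero[of z] by linarith
  have "((\<lambda>(j, k). diag_coeffs c j k * z ^ j * w ^ k) has_sum psum (diag_coeffs c) z w) UNIV"
    by (rule psum_has_sum[OF geom_bounded_diag[OF assms(1) R] assms(2,3)])
  also have "?this \<longleftrightarrow> ((\<lambda>(j, k). c j k * z ^ j * w ^ k) has_sum psum (diag_coeffs c) z w) (range (\<lambda>k. (k, k)))"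
    by (intro has_sum_cong_neutral) (auto simp: diag_coeffs_def)
  also have "\<dots> \<longleftrightarrow> ((\<lambda>k. c k k * (z * w) ^ k) has_sum psum (diag_coeffs c) z w) UNIV"
    by (subst has_sum_reindex) (auto simp: inj_on_def o_def power_mult_distrib mult_ac)
  finally show ?thesis by (rule has_sum_imp_sums)
qed

text \<open>The angular mean as a real power series in the squared modulus of z.\<close>

definition radial_fps :: "(nat \<Rightarrow> nat \<Rightarrow> complex) \<Rightarrow> real fps" where
  "radial_fps c = Abs_fps (\<lambda>k. Re (c k k))"

lemma radial_fps_conv_radius:
  assumes "geom_bounded c R" "R > 0"
  shows "fps_conv_radius (radial_fps c) > 0"
proof -
  obtain M where M: "\<And>j k. norm (c j k) * R ^ (j + k) \<le> M"
    using assms(1) unfolding geom_bounded_def by blast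
  have "norm (Re (c k k)) * (R\<^sup>2) ^ k \<le> M" for k
  proof -
    have "norm (Re (c k k)) * (R\<^sup>2) ^ k \<le> norm (c k k) * (R\<^sup>2) ^ k"
      using abs_Re_le_cmod by (intro mult_right_mono) auto
    also have "\<dots> = norm (c k k) * R ^ (k + k)"
      by (simp add: power_mult[symmetric] mult_2)
    finally show ?thesis using M[of k k] by linarith
  qed
  then show ?thesis
    unfolding radial_fps_def using assms(2) by (intro bounded_coeffs_conv_radius_pos[of "R\<^sup>2"]) auto
qed

lemma Re_psum_diag:
  assumes "geom_bounded c R" "norm z < R"
  shows "Re (psum (diag_coeffs c) z (cnj z)) = eval_fps (radial_fps c) ((cmod z)\<^sup>2)"
proof -
  have "(\<lambda>k. c k k * (z * cnj z) ^ k) sums psum (diag_coeffs c) z (cnj z)"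
    by (rule psum_diag_sums[OF assms]) (use assms in simp)
  from sums_Re[OF this] have "(\<lambda>k. Re (c k k * (of_real ((cmod z)\<^sup>2)) ^ k)) sums Re (psum (diag_coeffs c) z (cnj z))"
    by (simp only: complex_norm_square)
  then have "(\<lambda>k. Re (c k k) * ((cmod z)\<^sup>2) ^ k) sums Re (psum (diag_coeffs c) z (cnj z))"
    by (simp flip: of_real_power)
  then show ?thesis by (simp add: eval_fps_def radial_fps_def sums_iff)
qed

text \<open>Uniqueness of one-variable coefficients is used twice: in z for fixed w, then in w for
  each row.\<close>

lemma psum_eq_0_imp_coeffs_eq_0:
  assumes "geom_bounded c R" "R > 0" "\<forall>\<^sub>F p in nhds 0. psum c (fst p) (snd p) = 0"
  shows "c j k = 0"
proof -
  obtain r0 where r0: "r0 > 0" "\<And>z w. norm z < r0 \<Longrightarrow> norm w < r0 \<Longrightarrow> psum c z w = 0"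
    using assms(3) unfolding eventually_nhds_polydisc by auto
  define r where "r = min r0 R"
  have r: "r > 0" "r \<le> r0" "r \<le> R" using r0 assms(2) by (auto simp: r_def)
  have uniq: "a n = 0" if a: "\<And>z. norm z < r \<Longrightarrow> (\<lambda>n. a n * z ^ n) sums 0" for a :: "nat \<Rightarrow> complex" and n
  proof -
    have "norm (of_real (r / 2) :: complex) < r" using r by simp
    from sums_summable[OF a[OF this]] have "conv_radius a \<ge> norm (of_real (r / 2) :: complex)"
      by (rule conv_radius_geI)
    from less_le_trans[OF _ this, of 0] have c: "fps_conv_radius (Abs_fps a) > 0"
      unfolding fps_conv_radius_def using r by simp
    have "Abs_fps a = 0"
    proof (rule eval_fps_eqD[OF c])
      show "\<forall>\<^sub>F z in nhds 0. eval_fps (Abs_fps a) z = eval_fps 0 z"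
        using eventually_norm_less[OF r(1)] by eventually_elim (use a in \<open>auto simp: eval_fps_def sums_iff\<close>)
    qed simp
    then show ?thesis by (metis fps_nth_Abs_fps fps_zero_nth)
  qed
  have "(\<Sum>k. c j k * w ^ k) = 0" if w: "norm w < r" for w
  proof (rule uniq)
    fix z :: complex assume z: "norm z < r"
    have "psum c z w = 0" using r0(2)[of z w] z w r by simp
    then show "(\<lambda>j. (\<Sum>k. c j k * w ^ k) * z ^ j) sums 0"
      using psum_sums[OF assms(1), of z w] z w r by simp
  qed
  then have "(\<lambda>k. c j k * w ^ k) sums 0" if "norm w < r" for w
    using has_sum_imp_sums[OF psum_row_has_sum[OF assms(1), of w j]] that r by simp
  then show ?thesis by (rule uniq)
qed

lemma ra_germ_psum:
  assumes "geom_bounded c R" "R > 0"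
  shows "ra_germ (\<lambda>z. psum c z (cnj z))"
  by (rule ra_germI[OF holo2_psum[OF assms]]) simp

lemma ra_germ_expansion:
  assumes "ra_germ f"
  obtains c R where "R > 0" "geom_bounded c R" "\<forall>\<^sub>F z in nhds 0. f z = psum c z (cnj z)"
proof -
  obtain F where F: "holo2 F" "\<forall>\<^sub>F z in nhds 0. f z = F (z, cnj z)"
    using assms unfolding ra_germ_def by blast
  obtain c R where R: "R > 0" "geom_bounded c R"
    and c: "\<And>z w. norm z < R \<Longrightarrow> norm w < R \<Longrightarrow> F (z, w) = psum c z w"
    using holo2_expansion[OF F(1)] by blast
  have "\<forall>\<^sub>F z in nhds 0. norm (z :: complex) < R"
    using R(1) unfolding eventually_nhds_metric by (auto simp: dist_norm)
  then have "\<forall>\<^sub>F z in nhds 0. f z = psum c z (cnj z)"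
    using F(2) by eventually_elim (simp add: c)
  from that[OF R this] show thesis .
qed

text \<open>On the monomial with exponents j and k the angular derivative is multiplication by \<i>
  (j - k). Off the diagonal it can be inverted without loss of radius, and the diagonal is the
  angular mean, which has to be subtracted.\<close>

lemma angular_primitive:
  fixes g :: "complex \<Rightarrow> real"
  assumes "ra_germ (\<lambda>z. of_real (g z))"
  obtains F :: "real fps" and v :: "complex \<Rightarrow> real"
  where "fps_conv_radius F > 0" "ra_germ (\<lambda>z. of_real (v z))" "v 0 = 0"
    "\<forall>\<^sub>F z in nhds 0. \<exists>D. (v has_derivative D) (at z) \<and> D (\<i> * z) = g z - eval_fps F ((cmod z)\<^sup>2)"
proof -
  obtain c R where R: "R > 0" and c: "geom_bounded c R"
    and g: "\<forall>\<^sub>F z in nhds 0. complex_of_real (g z) = psum c z (cnj z)"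
    using ra_germ_expansion[OF assms] .
  define b where "b = (\<lambda>j k. if j = k then 0 else c j k / (\<i> * (of_nat j - of_nat k)))"
  have b: "geom_bounded b R"
  proof -
    obtain M where M: "\<And>j k. norm (c j k) * R ^ (j + k) \<le> M"
      using c unfolding geom_bounded_def by blast
    have nb: "norm (b j k) \<le> norm (c j k)" for j k
    proof (cases "j = k")
      case False
      have "norm (of_nat j - of_nat k :: complex) = \<bar>real_of_int (int j - int k)\<bar>"
        by (metis norm_of_int of_int_diff of_int_of_nat_eq of_int_abs)
      also have "\<dots> \<ge> 1" using False by linarith
      finally have "norm (\<i> * (of_nat j - of_nat k :: complex)) \<ge> 1" by (simp add: norm_mult)
      then show ?thesis using False
        by (simp add: b_def norm_divide divide_le_eq mult_le_cancel_left1 del: norm_mult)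
    qed (simp add: b_def)
    have "norm (b j k) * R ^ (j + k) \<le> M" for j k
      using R by (intro order_trans[OF mult_right_mono[OF nb] M]) simp
    then show ?thesis unfolding geom_bounded_def by blast
  qed
  have Rh: "R / 2 > 0" "R / 2 < R" using R by auto
  have eb: "\<i> * psum (euler_coeffs b) z w = psum c z w - psum (diag_coeffs c) z w"
    if "norm z < R / 2" "norm w < R / 2" for z w
  proof -
    have zw: "norm z < R" "norm w < R" using that R by auto
    have s1: "((\<lambda>x. \<i> * (case x of (j, k) \<Rightarrow> euler_coeffs b j k * z ^ j * w ^ k)) has_sum
        \<i> * psum (euler_coeffs b) z w) UNIV"
      by (intro has_sum_cmult_right psum_has_sum[OF geom_bounded_euler[OF b Rh]] that)
    have s2: "((\<lambda>x. (case x of (j, k) \<Rightarrow> c j k * z ^ j * w ^ k)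
        - (case x of (j, k) \<Rightarrow> diag_coeffs c j k * z ^ j * w ^ k)) has_sum
        (psum c z w - psum (diag_coeffs c) z w)) UNIV"
      by (intro has_sum_diff psum_has_sum[OF c] psum_has_sum[OF geom_bounded_diag[OF c R]] zw)
    have eq: "(\<lambda>x. \<i> * (case x of (j, k) \<Rightarrow> euler_coeffs b j k * z ^ j * w ^ k))
      = (\<lambda>x. (case x of (j, k) \<Rightarrow> c j k * z ^ j * w ^ k)
        - (case x of (j, k) \<Rightarrow> diag_coeffs c j k * z ^ j * w ^ k))"
    proof (rule ext, clarify)
      fix j k
      have "\<i> * euler_coeffs b j k = c j k - diag_coeffs c j k"
        by (simp add: euler_coeffs_def diag_coeffs_def b_def)
      then have "\<i> * euler_coeffs b j k * (z ^ j * w ^ k) = (c j k - diag_coeffs c j k) * (z ^ j * w ^ k)"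
        by (rule arg_cong)
      then show "\<i> * (euler_coeffs b j k * z ^ j * w ^ k)
          = c j k * z ^ j * w ^ k - diag_coeffs c j k * z ^ j * w ^ k"
        by (simp only: mult.assoc left_diff_distrib)
    qed
    show ?thesis by (rule has_sum_unique[OF s1 s2[folded eq]])
  qed
  \<comment> \<open>Taking the real part spares a check of the symmetry of b; it preserves the
    equation for the angular derivative because g is real. The constant only normalises v 0.\<close>
  define v where "v = (\<lambda>z. Re (psum b z (cnj z)) - Re (psum b 0 0))"
  show thesis
  proof (rule that[of "radial_fps c" v])
    show "fps_conv_radius (radial_fps c) > 0" by (rule radial_fps_conv_radius[OF c R])
    show "ra_germ (\<lambda>z. of_real (v z))"
      unfolding v_def of_real_diff by (intro ra_germ_diff ra_germ_Re ra_germ_psum[OF b R] ra_germ_const)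
    show "v 0 = 0" by (simp add: v_def)
    show "\<forall>\<^sub>F z in nhds 0. \<exists>D. (v has_derivative D) (at z) \<and> D (\<i> * z) = g z - eval_fps (radial_fps c) ((cmod z)\<^sup>2)"
      using g eventually_norm_less[OF Rh(1)]
    proof eventually_elim
      case (elim z)
      have z: "norm z < R" using elim Rh by simp
      obtain D where D: "((\<lambda>z. psum b z (cnj z)) has_derivative D) (at z)"
        "D (\<i> * z) = \<i> * psum (euler_coeffs b) z (cnj z)"
        using psum_angular_derivative[OF b z] by blast
      have "(v has_derivative (\<lambda>h. Re (D h))) (at z)"
        unfolding v_def using has_derivative_diff[OF has_derivative_Re[OF D(1)] has_derivative_const] by simp
      moreover have "Re (D (\<i> * z)) = g z - eval_fps (radial_fps c) ((cmod z)\<^sup>2)"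
      proof -
        have "Re (psum c z (cnj z)) = g z" by (metis elim(1) Re_complex_of_real)
        then show ?thesis
          using Re_psum_diag[OF c z] eb[of z "cnj z"] elim(2) D(2) by simp
      qed
      ultimately show ?case by blast
    qed
  qed
qed

text \<open>The angular derivative vanishes on w = cnj z, hence its extension vanishes on a bidisc
  by \<open>holo2_identity\<close>. Every (j - k) c j k is then 0, so only diagonal coefficients
  survive.\<close>

lemma angular_invariant_imp_radial:
  fixes h :: "complex \<Rightarrow> real"
  assumes "ra_germ (\<lambda>z. of_real (h z))"
    and h: "\<forall>\<^sub>F z in nhds 0. \<exists>D. (h has_derivative D) (at z) \<and> D (\<i> * z) = 0"
  obtains F :: "real fps"
  where "fps_conv_radius F > 0" "\<forall>\<^sub>F z in nhds 0. h z = eval_fps F ((cmod z)\<^sup>2)"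
proof -
  obtain c R where R: "R > 0" and c: "geom_bounded c R"
    and hc: "\<forall>\<^sub>F z in nhds 0. complex_of_real (h z) = psum c z (cnj z)"
    using ra_germ_expansion[OF assms(1)] .
  have Rh: "R / 2 > 0" "R / 2 < R" using R by auto
  note be = geom_bounded_euler[OF c Rh]
  have "\<forall>\<^sub>F z in nhds 0. \<forall>\<^sub>F y in nhds z. complex_of_real (h y) = psum c y (cnj y)"
    using hc eventually_eventually by blast
  then have "\<forall>\<^sub>F z in nhds 0. psum (euler_coeffs c) z (cnj z) = 0"
    using h eventually_norm_less[OF R]
  proof eventually_elim
    case (elim z)
    then obtain D where D: "(h has_derivative D) (at z)" "D (\<i> * z) = 0" by blast
    obtain E where E: "((\<lambda>z. psum c z (cnj z)) has_derivative E) (at z)"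
      "E (\<i> * z) = \<i> * psum (euler_coeffs c) z (cnj z)"
      using psum_angular_derivative[OF c elim(3)] by blast
    have "((\<lambda>z. complex_of_real (h z)) has_derivative (\<lambda>u. of_real (D u))) (at z)"
      by (rule has_derivative_of_real[OF D(1)])
    moreover have "\<forall>\<^sub>F y in at z. complex_of_real (h y) = psum c y (cnj y)"
      using elim(1) by (auto simp: eventually_at_filter elim!: eventually_mono)
    moreover have "complex_of_real (h z) = psum c z (cnj z)"
      using elim(1) by (rule eventually_nhds_x_imp_x)
    ultimately have "((\<lambda>z. psum c z (cnj z)) has_derivative (\<lambda>u. of_real (D u))) (at z)"
      by (rule has_derivative_transform_eventually) simp
    from has_derivative_unique[OF this E(1)] have "of_real (D (\<i> * z)) = E (\<i> * z)"
      by (rule fun_cong)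
    then show ?case using D(2) E(2) by simp
  qed
  then have "\<forall>\<^sub>F z in nhds 0. (\<lambda>p. psum (euler_coeffs c) (fst p) (snd p)) (z, cnj z) = 0"
    by simp
  from psum_eq_0_imp_coeffs_eq_0[OF be Rh(1) holo2_identity[OF holo2_psum[OF be Rh(1)] this]]
  have ec: "euler_coeffs c j k = 0" for j k .
  have "c j k = 0" if "j \<noteq> k" for j k
    using ec[of j k] that by (simp add: euler_coeffs_def)
  then have cd: "diag_coeffs c = c" by (intro ext) (simp add: diag_coeffs_def)
  have "\<forall>\<^sub>F z in nhds 0. h z = eval_fps (radial_fps c) ((cmod z)\<^sup>2)"
    using hc eventually_norm_less[OF R]
  proof eventually_elim
    case (elim z)
    have "h z = Re (psum c z (cnj z))" by (metis elim(1) Re_complex_of_real)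
    then show ?case using Re_psum_diag[OF c elim(2)] by (simp add: cd)
  qed
  from that[OF radial_fps_conv_radius[OF c R] this] show thesis .
qed

section \<open>Normalising an area density\<close>

text \<open>The factor is the determinant of D, so a single pair of independent vectors suffices to
  determine it.\<close>

lemma area_form_linear:
  assumes "linear D"
  shows "area_form (D u) (D v) = area_form (D 1) (D \<i>) * area_form u v"
proof -
  have d: "D w = Re w *\<^sub>R D 1 + Im w *\<^sub>R D \<i>" for w
  proof -
    have "w = Re w *\<^sub>R 1 + Im w *\<^sub>R \<i>" by (simp add: complex_eq_iff)
    then show ?thesis by (metis assms linear_add linear_scale)
  qed
  show ?thesis unfolding d[of u] d[of v] by (simp add: area_form_def algebra_simps)
qed

text \<open>Along the rotation orbit of z the value of \<eta> is A times the unit number of angle t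
  + w / c; the claim is its derivative at t = 0. The number c stands for the value of a radial
  function, which is constant on the orbit.\<close>

lemma angular_derivative_exp:
  fixes w :: "complex \<Rightarrow> real"
  assumes \<eta>: "(\<eta> has_derivative D) (at z)" and w: "(w has_derivative E) (at z)"
    and eq: "\<forall>\<^sub>F t in nhds (0::real). \<eta> (exp (\<i> * of_real t) * z)
      = exp (\<i> * of_real t) * A * exp (\<i> * of_real (w (exp (\<i> * of_real t) * z) / c))"
  shows "D (\<i> * z) = of_real (1 + E (\<i> * z) / c) * (\<i> * \<eta> z)"
proof -
  define \<gamma> where "\<gamma> = (\<lambda>t::real. exp (\<i> * of_real t) * z)"
  have \<gamma>0: "\<gamma> 0 = z" by (simp add: \<gamma>_def)
  have "((\<lambda>t. exp (\<i> * t) * z) has_field_derivative \<i> * z) (at (of_real 0))"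
    by (auto intro!: derivative_eq_intros)
  from has_vector_derivative_real_field[OF this] have \<gamma>: "(\<gamma> has_vector_derivative \<i> * z) (at 0)"
    by (simp add: \<gamma>_def)
  have comp: "((\<lambda>t. f (\<gamma> t)) has_vector_derivative L (\<i> * z)) (at 0)"
    if "(f has_derivative L) (at z)" for f :: "complex \<Rightarrow> 'b::real_normed_vector" and L
  proof -
    have "((\<lambda>t. f (\<gamma> t)) has_derivative (\<lambda>x. L (x *\<^sub>R (\<i> * z)))) (at 0)"
      using has_derivative_compose[of \<gamma> _ 0 UNIV f L] \<gamma> that \<gamma>0
      by (simp add: has_vector_derivative_def)
    then show ?thesis
      by (simp add: has_vector_derivative_def linear_scale[OF has_derivative_linear[OF that]])
  qed
  have lhs: "((\<lambda>t. \<eta> (\<gamma> t)) has_vector_derivative D (\<i> * z)) (at 0)" by (rule comp[OF \<eta>])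
  define \<theta> where "\<theta> = (\<lambda>t. t + w (\<gamma> t) / c)"
  have "((\<lambda>t. w (\<gamma> t)) has_real_derivative E (\<i> * z)) (at 0)"
    using comp[OF w] by (simp add: has_real_derivative_iff_has_vector_derivative)
  from DERIV_add[OF DERIV_ident DERIV_cdivide[OF this, of c]]
  have "(\<theta> has_real_derivative 1 + E (\<i> * z) / c) (at 0)"
    by (simp add: \<theta>_def)
  then have "((\<lambda>t. complex_of_real (\<theta> t)) has_vector_derivative of_real (1 + E (\<i> * z) / c)) (at 0)"
    by (intro has_vector_derivative_of_real) (simp add: has_real_derivative_iff_has_vector_derivative)
  moreover have "((\<lambda>s. A * exp (\<i> * s)) has_field_derivative A * (exp (\<i> * of_real (\<theta> 0)) * \<i>)) (at (of_real (\<theta> 0)))"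
    by (auto intro!: derivative_eq_intros)
  ultimately have rhs: "((\<lambda>t. A * exp (\<i> * of_real (\<theta> t))) has_vector_derivative
      of_real (1 + E (\<i> * z) / c) * (A * (exp (\<i> * of_real (\<theta> 0)) * \<i>))) (at 0)"
    using field_vector_diff_chain_at by (fastforce simp: o_def)
  have eq': "\<forall>\<^sub>F t in nhds 0. A * exp (\<i> * of_real (\<theta> t)) = \<eta> (\<gamma> t)"
    using eq by eventually_elim (simp add: \<gamma>_def \<theta>_def exp_add[symmetric] distrib_left mult_ac)
  have "((\<lambda>t. \<eta> (\<gamma> t)) has_vector_derivative
      of_real (1 + E (\<i> * z) / c) * (A * (exp (\<i> * of_real (\<theta> 0)) * \<i>))) (at 0)"
    unfolding has_vector_derivative_def
    by (rule has_derivative_transform_eventually[OF rhs[unfolded has_vector_derivative_def]])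
      (use eq' eventually_nhds_x_imp_x[OF eq'] in \<open>auto simp: eventually_at_filter elim!: eventually_mono\<close>)
  from vector_derivative_unique_at[OF lhs this]
  have "D (\<i> * z) = of_real (1 + E (\<i> * z) / c) * (\<i> * (A * exp (\<i> * of_real (\<theta> 0))))"
    by (simp add: mult_ac)
  also have "A * exp (\<i> * of_real (\<theta> 0)) = \<eta> z" using eventually_nhds_x_imp_x[OF eq'] \<gamma>0 by simp
  finally show ?thesis .
qed

text \<open>Evaluating the area form on the radial and the angular direction.\<close>

lemma jacobian_of_circle_preserving:
  assumes \<eta>: "(\<eta> has_derivative D) (at z)" and z: "z \<noteq> 0"
    and ang: "D (\<i> * z) = of_real k * (\<i> * \<eta> z)"
    and S: "\<forall>\<^sub>F y in nhds z. (cmod (\<eta> y))\<^sup>2 = S ((cmod y)\<^sup>2)"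
    and S': "(S has_real_derivative S') (at ((cmod z)\<^sup>2))"
  shows "area_form (D u) (D v) = k * S' * area_form u v"
proof -
  have sq: "((\<lambda>y. (cmod (f y))\<^sup>2) has_derivative (\<lambda>h. 2 * (Re (f z) * Re (L h) + Im (f z) * Im (L h)))) (at z)"
    if "(f has_derivative L) (at z)" for f :: "complex \<Rightarrow> complex" and L
    unfolding cmod_power2 unfolding power2_eq_square
    by (auto intro!: derivative_eq_intros that)
  have "((\<lambda>y. S ((cmod y)\<^sup>2)) has_derivative (\<lambda>h. S' * (2 * (Re z * Re h + Im z * Im h)))) (at z)"
    using has_derivative_compose[OF sq[OF has_derivative_ident] S'[unfolded has_field_derivative_def]] .
  moreover have "((\<lambda>y. S ((cmod y)\<^sup>2)) has_derivative (\<lambda>h. 2 * (Re (\<eta> z) * Re (D h) + Im (\<eta> z) * Im (D h)))) (at z)"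
    by (rule has_derivative_transform_eventually[OF sq[OF \<eta>]])
      (use S eventually_nhds_x_imp_x[OF S] in \<open>auto simp: eventually_at_filter elim!: eventually_mono\<close>)
  ultimately have "(\<lambda>h. S' * (2 * (Re z * Re h + Im z * Im h))) = (\<lambda>h. 2 * (Re (\<eta> z) * Re (D h) + Im (\<eta> z) * Im (D h)))"
    by (rule has_derivative_unique)
  from fun_cong[OF this, of z]
  have rad: "Re (\<eta> z) * Re (D z) + Im (\<eta> z) * Im (D z) = S' * (cmod z)\<^sup>2"
    unfolding cmod_power2 unfolding power2_eq_square by (simp add: algebra_simps)
  \<comment> \<open>As D (\<i> z) is a real multiple of \<i> \<eta> z, only the component of D z
    along \<eta> z contributes, and that one is known from differentiating the squared
    modulus.\<close>
  have "area_form (D z) (D (\<i> * z)) = k * (Re (\<eta> z) * Re (D z) + Im (\<eta> z) * Im (D z))"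
    unfolding ang by (simp add: area_form_def algebra_simps)
  also have "\<dots> = k * S' * (cmod z)\<^sup>2" by (simp add: rad)
  finally have "area_form (D 1) (D \<i>) * area_form z (\<i> * z) = k * S' * (cmod z)\<^sup>2"
    using area_form_linear[OF has_derivative_linear[OF \<eta>], of z "\<i> * z"] by simp
  moreover have "area_form z (\<i> * z) = (cmod z)\<^sup>2"
    unfolding cmod_power2 by (simp add: area_form_def power2_eq_square)
  ultimately have "area_form (D 1) (D \<i>) = k * S'" using z by simp
  then show ?thesis using area_form_linear[OF has_derivative_linear[OF \<eta>]] by metis
qed

section \<open>Analytic functions of the squared modulus\<close>

lemma fps_conv_radius_pos_ball:
  assumes "fps_conv_radius F > 0"
  obtains s where "s > 0" "\<And>x :: real. norm x < s \<Longrightarrow> ereal (norm x) < fps_conv_radius F"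
proof -
  obtain s where s: "0 < ereal s" "ereal s < fps_conv_radius F"
    using ereal_dense2[OF assms] by blast
  show thesis
  proof (rule that[of s])
    show "ereal (norm x) < fps_conv_radius F" if "norm x < s" for x :: real
      using that s(2) by (meson ereal_less(2) less_ereal.simps(1) less_trans)
  qed (use s in simp)
qed

lemma eventually_cmod_sq:
  assumes "\<forall>\<^sub>F x in nhds (0::real). P x"
  shows "\<forall>\<^sub>F z in nhds 0. P ((cmod z)\<^sup>2)"
proof -
  have "isCont (\<lambda>z::complex. (cmod z)\<^sup>2) 0" by (intro continuous_intros)
  from eventually_nhds_compose[OF this, of P] assms show ?thesis by simp
qed

lemma eventually_in_conv_radius:
  fixes F :: "real fps"
  assumes "fps_conv_radius F > 0"
  shows "\<forall>\<^sub>F x in nhds (0 :: real). ereal (norm x) < fps_conv_radius F"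
proof -
  obtain s where s: "s > 0" "\<And>x :: real. norm x < s \<Longrightarrow> ereal (norm x) < fps_conv_radius F"
    by (rule fps_conv_radius_pos_ball[OF assms]) blast
  then show ?thesis unfolding eventually_nhds_metric by (auto simp: dist_norm)
qed

text \<open>The squared modulus is the product z cnj z, so the same coefficients, read as complex
  numbers, define a germ analytic in z and cnj z.\<close>

lemma ra_germ_radial:
  fixes F :: "real fps"
  assumes "fps_conv_radius F > 0"
  shows "ra_germ (\<lambda>z. of_real (eval_fps F ((cmod z)\<^sup>2)))"
proof -
  define Fc where "Fc = Abs_fps (\<lambda>n. complex_of_real (fps_nth F n))"
  have "conv_radius (\<lambda>n. complex_of_real (fps_nth F n)) = conv_radius (\<lambda>n. norm (complex_of_real (fps_nth F n)))"
    by (rule conv_radius_norm[symmetric])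
  also have "\<dots> = conv_radius (fps_nth F)" using conv_radius_norm[of "fps_nth F"] by simp
  finally have r: "fps_conv_radius Fc = fps_conv_radius F"
    by (simp add: Fc_def fps_conv_radius_def)
  have "{0::complex} \<subseteq> eball 0 (fps_conv_radius Fc)" using assms by (simp add: r zero_ereal_def)
  then have "eval_fps Fc analytic_on {0}" by (rule FPS_Convergence.analytic_on_eval_fps)
  then have "ra_germ (\<lambda>z. eval_fps Fc (z * cnj z))"
    using ra_germ_compose1[OF ra_germ_mult[OF ra_germ_id ra_germ_cnj_id], of "eval_fps Fc"] by simp
  then show ?thesis
  proof (rule ra_germ_cong)
    show "\<forall>\<^sub>F z in nhds 0. eval_fps Fc (z * cnj z) = of_real (eval_fps F ((cmod z)\<^sup>2))"
      using eventually_cmod_sq[OF eventually_in_conv_radius[OF assms]]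
    proof eventually_elim
      case (elim z)
      let ?x = "(cmod z)\<^sup>2"
      have "(\<lambda>n. fps_nth F n * ?x ^ n) sums eval_fps F ?x" by (rule sums_eval_fps[OF elim])
      from sums_of_real[OF this, where 'a = complex]
      have "(\<lambda>n. fps_nth Fc n * (of_real ?x) ^ n) sums of_real (eval_fps F ?x)"
        by (simp add: Fc_def)
      then have "eval_fps Fc (of_real ?x) = of_real (eval_fps F ?x)"
        by (simp add: eval_fps_def sums_iff)
      then show ?case by (simp only: complex_norm_square)
    qed
  qed
qed

text \<open>The primitive vanishing at 0 is written with its factor x split off: the modulus of the
  later coordinate change is |z| times the square root of T, which is analytic when T is positive at
  0.\<close>

lemma radial_primitive:
  fixes F :: "real fps"
  assumes "fps_conv_radius F > 0"
  obtains T :: "real fps" where "fps_conv_radius T > 0" "fps_nth T 0 = fps_nth F 0"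
    "\<forall>\<^sub>F x in nhds 0. ((\<lambda>x. x * eval_fps T x) has_real_derivative eval_fps F x) (at x)"
proof -
  define T where "T = Abs_fps (\<lambda>k. fps_nth F k / real (Suc k))"
  obtain s where s: "s > 0" "\<And>x :: real. norm x < s \<Longrightarrow> ereal (norm x) < fps_conv_radius F"
    by (rule fps_conv_radius_pos_ball[OF assms]) blast
  have "summable (\<lambda>k. fps_nth F k * (s/2) ^ k)"
    by (rule summable_fps[OF s(2)]) (use s in simp)
  from summable_LIMSEQ_zero[OF this] have "Bseq (\<lambda>k. fps_nth F k * (s/2) ^ k)"
    by (rule convergent_imp_Bseq[OF convergentI])
  then obtain M where "\<And>k. norm (fps_nth F k * (s/2) ^ k) \<le> M" by (rule BseqE) blast
  then have M: "norm (fps_nth F k) * (s/2) ^ k \<le> M" for k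
    using s by (simp add: norm_mult norm_power abs_mult power_abs)
  have T: "fps_conv_radius T > 0" unfolding T_def
  proof (rule bounded_coeffs_conv_radius_pos)
    show "norm (fps_nth F k / real (Suc k)) * (s/2) ^ k \<le> M" for k
    proof -
      have "norm (fps_nth F k / real (Suc k)) \<le> norm (fps_nth F k)"
        by (simp add: norm_divide divide_le_eq mult_le_cancel_left1)
      then have "norm (fps_nth F k / real (Suc k)) * (s/2) ^ k \<le> norm (fps_nth F k) * (s/2) ^ k"
        using s by (intro mult_right_mono) auto
      then show ?thesis using M[of k] by linarith
    qed
  qed (use s in simp)
  have XT: "fps_conv_radius (fps_X * T) > 0"
    using less_le_trans[OF _ fps_conv_radius_mult[of fps_X T], of 0] T by simp
  have dXT: "fps_deriv (fps_X * T) = F"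
  proof (rule fps_ext)
    fix n
    have "fps_nth (fps_deriv (fps_X * T)) n = real (Suc n) * fps_nth T n" by (simp only: fps_deriv_nth) simp
    then show "fps_nth (fps_deriv (fps_X * T)) n = fps_nth F n" by (simp add: T_def del: of_nat_Suc)
  qed
  have S: "\<forall>\<^sub>F x in nhds 0. x * eval_fps T x = eval_fps (fps_X * T) x"
    using eventually_in_conv_radius[OF T] by eventually_elim (simp add: eval_fps_mult)
  have "\<forall>\<^sub>F x in nhds 0. ((\<lambda>x. x * eval_fps T x) has_real_derivative eval_fps F x) (at x)"
    using eventually_eventually[THEN iffD2, OF S] eventually_in_conv_radius[OF XT]
  proof eventually_elim
    case (elim x)
    have "(eval_fps (fps_X * T) has_real_derivative eval_fps F x) (at x)"
      by (rule has_field_derivative_eval_fps[OF elim(2), unfolded dXT])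
    then show ?case using DERIV_cong_ev[OF refl elim(1) refl] by blast
  qed
  from that[OF T _ this] show thesis by (simp add: T_def)
qed

lemma eventually_radial_pos:
  fixes F :: "real fps"
  assumes "fps_conv_radius F > 0" "fps_nth F 0 > 0"
  shows "\<forall>\<^sub>F z in nhds 0. eval_fps F ((cmod z)\<^sup>2) > 0"
proof -
  have "isCont (eval_fps F) 0" using assms(1) by (intro continuous_eval_fps) (simp add: zero_ereal_def)
  from topological_tendstoD[OF isCont_imp_tendsto_nhds[OF this], of "{0<..}"] assms(2)
  have "\<forall>\<^sub>F x in nhds 0. eval_fps F x > 0" by (simp add: eval_fps_at_0)
  then show ?thesis by (rule eventually_cmod_sq)
qed

text \<open>In polar coordinates the map is \<open>(r, \<theta>) \<mapsto> (r sqrt (T (r\<^sup>2)), \<theta> + v / F)\<close>, where \<open>F\<close> is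
  the angular mean of \<open>g\<close>, \<open>x T(x)\<close> is the primitive of \<open>F\<close> and \<open>\<partial>v/\<partial>\<theta> = g - F\<close>.\<close>

lemma area_normalization:
  fixes g :: "complex \<Rightarrow> real"
  assumes g: "ra_germ (\<lambda>z. of_real (g z))" and g0: "g 0 = 1"
  obtains \<eta> S where "ra_germ \<eta>" "\<eta> 0 = 0" "(\<eta> has_derivative (\<lambda>h. h)) (at 0)"
    "\<forall>\<^sub>F z in nhds 0. (cmod (\<eta> z))\<^sup>2 = S ((cmod z)\<^sup>2)"
    "\<forall>\<^sub>F z in nhds 0. \<exists>D. (\<eta> has_derivative D) (at z) \<and>
       (\<forall>u v. area_form (D u) (D v) = g z * area_form u v)"
proof -
  obtain F :: "real fps" and v :: "complex \<Rightarrow> real" where F: "fps_conv_radius F > 0"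
    and v: "ra_germ (\<lambda>z. of_real (v z))" "v 0 = 0"
    and vD: "\<forall>\<^sub>F z in nhds 0. \<exists>D. (v has_derivative D) (at z) \<and> D (\<i> * z) = g z - eval_fps F ((cmod z)\<^sup>2)"
    using angular_primitive[OF g] .
  \<comment> \<open>At the origin the rotation direction \<i> z is zero, so the equation for v
    reduces there to equality of g and its mean.\<close>
  obtain D where "(v has_derivative D) (at 0)" "D 0 = g 0 - eval_fps F 0"
    using eventually_nhds_x_imp_x[OF vD] by auto
  then have F0: "fps_nth F 0 = 1"
    using linear_0[OF has_derivative_linear] g0 by (force simp: eval_fps_at_0)
  obtain T :: "real fps" where T: "fps_conv_radius T > 0" "fps_nth T 0 = fps_nth F 0"
    and TD: "\<forall>\<^sub>F x in nhds 0. ((\<lambda>x. x * eval_fps T x) has_real_derivative eval_fps F x) (at x)"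
    using radial_primitive[OF F] .
  define S where "S = (\<lambda>x. x * eval_fps T x)"
  define R where "R = (\<lambda>z. csqrt (of_real (eval_fps T ((cmod z)\<^sup>2))))"
  define e where "e = (\<lambda>z. R z * exp (\<i> * of_real (v z / eval_fps F ((cmod z)\<^sup>2))))"
  define \<eta> where "\<eta> = (\<lambda>z. z * e z)"
  have csq: "csqrt analytic_on {1}" by (intro analytic_intros) auto
  have "ra_germ R" unfolding R_def
    by (rule ra_germ_compose1[OF ra_germ_radial[OF T(1)]]) (simp add: eval_fps_at_0 T F0 csq)
  moreover have "ra_germ (\<lambda>z. of_real (v z) / of_real (eval_fps F ((cmod z)\<^sup>2)))"
    by (rule ra_germ_divide[OF v(1) ra_germ_radial[OF F]]) (simp add: eval_fps_at_0 F0)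
  then have "ra_germ (\<lambda>z. \<i> * of_real (v z / eval_fps F ((cmod z)\<^sup>2)))"
    unfolding of_real_divide by (rule ra_germ_mult[OF ra_germ_const])
  then have "ra_germ (\<lambda>z. exp (\<i> * of_real (v z / eval_fps F ((cmod z)\<^sup>2))))"
    by (rule ra_germ_compose1) (intro analytic_intros)
  ultimately have e: "ra_germ e" unfolding e_def by (rule ra_germ_mult)
  have e0: "e 0 = 1" by (simp add: e_def R_def v eval_fps_at_0 T F0)
  have \<eta>: "ra_germ \<eta>" unfolding \<eta>_def by (intro ra_germ_mult ra_germ_id e)
  have \<eta>0: "(\<eta> has_derivative (\<lambda>h. h)) (at 0)"
    using linear_remainder_has_derivative[OF e ra_germ_const[of 0]] by (simp add: \<eta>_def e0)
  obtain a b where ab: "ra_germ a" "ra_germ b"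
    "\<forall>\<^sub>F z in nhds 0. (\<eta> has_derivative (\<lambda>h. a z * h + b z * cnj h)) (at z)"
    using ra_germ_derivative[OF \<eta>] .
  have Tpos: "\<forall>\<^sub>F z in nhds 0. eval_fps T ((cmod z)\<^sup>2) > 0"
    by (rule eventually_radial_pos[OF T(1)]) (simp add: T F0)
  have Fpos: "\<forall>\<^sub>F z in nhds 0. eval_fps F ((cmod z)\<^sup>2) > 0"
    by (rule eventually_radial_pos[OF F]) (simp add: F0)
  have S: "\<forall>\<^sub>F z in nhds 0. (cmod (\<eta> z))\<^sup>2 = S ((cmod z)\<^sup>2)"
    using Tpos
  proof eventually_elim
    case (elim z)
    then show ?case
      by (simp add: \<eta>_def e_def R_def S_def norm_mult power_mult_distrib csqrt_of_real_nonneg)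
  qed
  have "\<forall>\<^sub>F z in nhds 0. \<exists>D. (\<eta> has_derivative D) (at z) \<and>
       (\<forall>u v. area_form (D u) (D v) = g z * area_form u v)"
    using ab(3) vD Fpos eventually_eventually[THEN iffD2, OF S] eventually_cmod_sq[OF TD]
  proof eventually_elim
    case (elim z)
    show ?case
    proof (cases "z = 0")
      case True
      then show ?thesis using \<eta>0 g0 by auto
    next
      case False
      obtain E where E: "(v has_derivative E) (at z)" "E (\<i> * z) = g z - eval_fps F ((cmod z)\<^sup>2)"
        using elim(2) by blast
      let ?F = "eval_fps F ((cmod z)\<^sup>2)"
      let ?D = "\<lambda>h. a z * h + b z * cnj h"
      have "?D (\<i> * z) = of_real (1 + E (\<i> * z) / ?F) * (\<i> * \<eta> z)"
        by (rule angular_derivative_exp[OF elim(1) E(1), where A = "z * R z"])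
          (simp add: \<eta>_def e_def R_def norm_mult)
      also have "1 + E (\<i> * z) / ?F = g z / ?F" using elim(3) by (simp add: E(2) field_simps)
      finally have ang: "?D (\<i> * z) = of_real (g z / ?F) * (\<i> * \<eta> z)" .
      \<comment> \<open>The angular factor g / F meets the radial factor F, the derivative of x
        T(x). This is why the shift is v divided by F.\<close>
      have "area_form (?D u) (?D w) = g z / ?F * ?F * area_form u w" for u w
        by (rule jacobian_of_circle_preserving[OF elim(1) False ang elim(4)])
          (use elim(5) in \<open>simp add: S_def\<close>)
      then have "area_form (?D u) (?D w) = g z * area_form u w" for u w
        using elim(3) by simp
      then show ?thesis using elim(1) by blast
    qed
  qed
  from that[OF \<eta> _ \<eta>0 S this] show thesis by (simp add: \<eta>_def)
qed

section \<open>Symplectic germs preserving circles\<close>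

text \<open>Complexified, the circle condition reads F H = z w on a bidisc, so F (0, w) H (0, w) =
  0. The derivative of H (0, w) at w = 0 is cnj \<mu>, which is nonzero; hence H (0, w) \<noteq> 0
  for small w \<noteq> 0, F vanishes on z = 0, and z divides F.\<close>

lemma circle_preserving_divisible:
  assumes G: "ra_germ G" and D: "(G has_derivative (\<lambda>h. \<mu> * h)) (at 0)" and \<mu>: "\<mu> \<noteq> 0"
    and circ: "\<forall>\<^sub>F z in nhds 0. (cmod (G z))\<^sup>2 = (cmod z)\<^sup>2"
  obtains e where "ra_germ e" "e 0 = \<mu>" "\<forall>\<^sub>F z in nhds 0. G z = z * e z"
proof -
  obtain F where F: "holo2 F" "\<forall>\<^sub>F z in nhds 0. G z = F (z, cnj z)"
    using G unfolding ra_germ_def by blast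
  obtain H where H: "holo2 H" "\<forall>\<^sub>F z in nhds 0. cnj (G z) = H (z, cnj z)"
    using ra_germ_cnj[OF G] unfolding ra_germ_def by blast
  have G0: "G 0 = 0" using eventually_nhds_x_imp_x[OF circ] by simp
  have FH0: "F (0, 0) = 0" "H (0, 0) = 0"
    using eventually_nhds_x_imp_x[OF F(2)] eventually_nhds_x_imp_x[OF H(2)] G0 by simp_all
  obtain c d where cd: "(H has_derivative (\<lambda>h. c * fst h + d * snd h)) (at (0, 0))"
    using eventually_nhds_x_imp_x[OF H(1)[unfolded holo2_def]] by (auto simp: zero_prod_def)
  have "((\<lambda>z. H (z, cnj z)) has_derivative (\<lambda>h. c * h + d * cnj h)) (at 0)"
    by (rule slice_has_derivative) (use cd in simp)
  moreover have "((\<lambda>z. H (z, cnj z)) has_derivative (\<lambda>h. cnj (\<mu> * h))) (at 0)"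
    by (rule has_derivative_transform_eventually[OF has_derivative_cnj[OF D]])
      (use H(2) eventually_nhds_x_imp_x[OF H(2)] in \<open>auto simp: eventually_at_filter elim!: eventually_mono\<close>)
  ultimately have "(\<lambda>h. c * h + d * cnj h) = (\<lambda>h. cnj (\<mu> * h))"
    by (rule has_derivative_unique)
  then have "(\<lambda>h. c * h + d * cnj h) = (\<lambda>h. 0 * h + cnj \<mu> * cnj h)" by simp
  then have d: "d = cnj \<mu>" by (rule real_linear_form_unique)
  have "((\<lambda>w. H (0, w)) has_field_derivative d) (at 0)"
    by (rule has_derivative_slice2[OF cd])
  then have "((\<lambda>w. H (0, w) / w) \<longlongrightarrow> d) (at 0)" by (simp add: DERIV_def FH0)
  then have "\<forall>\<^sub>F w in at 0. H (0, w) / w \<noteq> 0"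
    by (rule tendsto_imp_eventually_ne) (simp add: d \<mu>)
  then obtain \<delta> where \<delta>: "\<delta> > 0" "\<And>w. w \<noteq> 0 \<Longrightarrow> norm w < \<delta> \<Longrightarrow> H (0, w) \<noteq> 0"
    unfolding eventually_at by (auto simp: dist_norm)
  have "\<forall>\<^sub>F z in nhds 0. (\<lambda>p. F p * H p + (-1) * (fst p * snd p)) (z, cnj z) = 0"
    using F(2) H(2) circ
  proof eventually_elim
    case (elim z)
    have "F (z, cnj z) * H (z, cnj z) = of_real ((cmod (G z))\<^sup>2)"
      unfolding complex_norm_square elim(1)[symmetric] elim(2)[symmetric] ..
    also have "\<dots> = z * cnj z" by (simp only: elim(3) complex_norm_square)
    finally show ?case by simp
  qed
  moreover have "holo2 (\<lambda>p. F p * H p + (-1) * (fst p * snd p))"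
    by (intro holo2_add holo2_mult F H holo2_fst holo2_snd holo2_const)
  ultimately have "\<forall>\<^sub>F p in nhds 0. F p * H p + (-1) * (fst p * snd p) = 0"
    by (intro holo2_identity)
  then obtain r where r: "r > 0" "\<And>z w. norm z < r \<Longrightarrow> norm w < r \<Longrightarrow> F (z, w) * H (z, w) = z * w"
    unfolding eventually_nhds_polydisc by auto
  have F0: "F (0, w) = 0" if "norm w < min r \<delta>" for w
    using r(2)[of 0 w] r(1) \<delta>(2)[of w] that FH0 by (cases "w = 0") auto
  obtain E where E: "holo2 E" "\<forall>\<^sub>F p in nhds 0. F p = F (0, snd p) + fst p * E p"
    using holo2_hadamard1[OF F(1)] .
  define e where "e = (\<lambda>z. E (z, cnj z))"
  have e: "ra_germ e" unfolding e_def by (rule ra_germI[OF E(1)]) simp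
  have "\<forall>\<^sub>F z in nhds 0. norm (z::complex) < min r \<delta>"
    by (rule eventually_norm_less) (use r \<delta> in simp)
  then have Ge: "\<forall>\<^sub>F z in nhds 0. G z = z * e z"
    using F(2) eventually_slice[OF E(2)] by eventually_elim (simp add: F0 e_def)
  have "(G has_derivative (\<lambda>h. e 0 * h + 0 * cnj h)) (at 0)"
    by (rule has_derivative_transform_eventually[OF linear_remainder_has_derivative[OF e ra_germ_const]])
      (use Ge eventually_nhds_x_imp_x[OF Ge] in \<open>auto simp: eventually_at_filter elim!: eventually_mono\<close>)
  from has_derivative_unique[OF this D] have "(\<lambda>h. e 0 * h + 0 * cnj h) = (\<lambda>h. \<mu> * h + 0 * cnj h)"
    by simp
  then have "e 0 = \<mu>" by (rule real_linear_form_unique)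
  from that[OF e this Ge] show thesis .
qed

text \<open>A map that rotates every circle by an angle depending on the point has Jacobian 1 plus
  the angular derivative of that angle. Preservation of area makes the angle radial.\<close>

lemma circle_preserving_symplectic:
  assumes G: "ra_germ G" and D: "(G has_derivative (\<lambda>h. \<mu> * h)) (at 0)" and \<mu>: "norm \<mu> = 1"
    and circ: "\<forall>\<^sub>F z in nhds 0. (cmod (G z))\<^sup>2 = (cmod z)\<^sup>2"
    and symp: "symplectic_germ G"
  obtains F :: "real fps" where "fps_conv_radius F > 0" "fps_nth F 0 = 0"
    "\<forall>\<^sub>F z in nhds 0. G z = z * (\<mu> * exp (\<i> * of_real (eval_fps F ((cmod z)\<^sup>2))))"
proof -
  have \<mu>0: "\<mu> \<noteq> 0" using \<mu> by auto
  obtain e where e: "ra_germ e" "e 0 = \<mu>" and Ge: "\<forall>\<^sub>F z in nhds 0. G z = z * e z"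
    by (rule circle_preserving_divisible[OF G D \<mu>0 circ]) blast
  \<comment> \<open>Dividing by \<mu> moves the value at 0 to 1, where \<open>Ln\<close> is
    analytic. The real part makes h real by construction and loses nothing off the origin, since e
    has modulus 1 there.\<close>
  define h where "h = (\<lambda>z. Re ((- \<i>) * Ln (e z * inverse \<mu>)))"
  have "ra_germ (\<lambda>z. Ln (e z * inverse \<mu>))"
    by (rule ra_germ_compose1[OF ra_germ_mult[OF e(1) ra_germ_const]])
      (use \<mu>0 e(2) in \<open>auto intro!: analytic_intros\<close>)
  then have h: "ra_germ (\<lambda>z. of_real (h z))"
    unfolding h_def by (intro ra_germ_Re ra_germ_mult ra_germ_const)
  have h0: "h 0 = 0" using \<mu>0 by (simp add: h_def e)
  have Gh: "\<forall>\<^sub>F z in nhds 0. G z = z * \<mu> * exp (\<i> * of_real (h z))"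
    using Ge circ
  proof eventually_elim
    case (elim z)
    show ?case
    proof (cases "z = 0")
      case False
      let ?x = "e z * inverse \<mu>"
      have "cmod (G z) = cmod z" using elim(2) by (simp add: power2_eq_iff_nonneg)
      then have "cmod z * cmod (e z) = cmod z" by (simp add: elim(1) norm_mult)
      then have "cmod (e z) = 1" using False by simp
      then have x1: "cmod ?x = 1" using \<mu> by (simp add: norm_mult norm_inverse)
      then have x0: "?x \<noteq> 0" by (metis norm_zero zero_neq_one)
      have "Re (Ln ?x) = 0" by (simp only: Re_Ln[OF x0] x1 ln_one)
      moreover have "h z = Im (Ln ?x)" by (simp add: h_def)
      ultimately have "\<i> * of_real (h z) = Ln ?x" by (simp only: complex_eq_iff) simp
      then have "exp (\<i> * of_real (h z)) = ?x" by (simp only: exp_Ln[OF x0])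
      then show ?thesis using elim(1) \<mu>0 by simp
    qed (use elim in simp)
  qed
  obtain a b where ab: "ra_germ a" "ra_germ b"
    and hD: "\<forall>\<^sub>F z in nhds 0. ((\<lambda>z. complex_of_real (h z)) has_derivative (\<lambda>u. a z * u + b z * cnj u)) (at z)"
    using ra_germ_derivative[OF h] .
  have "\<forall>\<^sub>F z in nhds 0. \<exists>E. (h has_derivative E) (at z) \<and> E (\<i> * z) = 0"
    using symp[unfolded symplectic_germ_def] hD eventually_eventually[THEN iffD2, OF Gh]
      eventually_eventually[THEN iffD2, OF circ]
  proof eventually_elim
    case (elim z)
    obtain L where L: "(G has_derivative L) (at z)" "\<And>u v. area_form (L u) (L v) = area_form u v"
      using elim(1) by blast
    define E where "E = (\<lambda>u. Re (a z * u + b z * cnj u))"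
    have E: "(h has_derivative E) (at z)"
      using has_derivative_Re[OF elim(2)] by (simp add: E_def)
    have "E (\<i> * z) = 0"
    proof (cases "z = 0")
      case True
      then show ?thesis by (simp add: E_def)
    next
      case False
      have "isCont (\<lambda>t::real. exp (\<i> * of_real t) * z) 0" by (intro continuous_intros)
      from eventually_nhds_compose[OF this, of "\<lambda>z. G z = z * \<mu> * exp (\<i> * of_real (h z))"] elim(3)
      have "\<forall>\<^sub>F t in nhds (0::real). G (exp (\<i> * of_real t) * z)
          = (exp (\<i> * of_real t) * z) * \<mu> * exp (\<i> * of_real (h (exp (\<i> * of_real t) * z)))"
        by simp
      then have "\<forall>\<^sub>F t in nhds (0::real). G (exp (\<i> * of_real t) * z)
          = exp (\<i> * of_real t) * (z * \<mu>) * exp (\<i> * of_real (h (exp (\<i> * of_real t) * z) / 1))"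
        by eventually_elim (simp add: mult.assoc)
      from angular_derivative_exp[OF L(1) E this]
      have ang: "L (\<i> * z) = of_real (1 + E (\<i> * z)) * (\<i> * G z)" by simp
      have "area_form (L 1) (L \<i>) = (1 + E (\<i> * z)) * 1 * area_form 1 \<i>"
        by (rule jacobian_of_circle_preserving[OF L(1) False ang, where S = "\<lambda>x. x"])
          (use elim(4) in auto)
      then show ?thesis unfolding L(2) by (simp add: area_form_def)
    qed
    then show ?case using E by blast
  qed
  then obtain F :: "real fps" where F: "fps_conv_radius F > 0" "\<forall>\<^sub>F z in nhds 0. h z = eval_fps F ((cmod z)\<^sup>2)"
    using angular_invariant_imp_radial[OF h] by metis
  have "fps_nth F 0 = 0"
    using eventually_nhds_x_imp_x[OF F(2)] h0 by (simp add: eval_fps_at_0)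
  moreover have "\<forall>\<^sub>F z in nhds 0. G z = z * (\<mu> * exp (\<i> * of_real (eval_fps F ((cmod z)\<^sup>2))))"
    using Gh F(2) by eventually_elim (simp add: mult.assoc)
  ultimately show thesis using that[OF F(1)] by blast
qed

section \<open>The normal form\<close>

lemma symplectic_germ_compose:
  assumes "symplectic_germ f" "symplectic_germ g" "g 0 = 0"
  shows "symplectic_germ (\<lambda>z. f (g z))"
proof -
  have "isCont g 0"
    using eventually_nhds_x_imp_x[OF assms(2)[unfolded symplectic_germ_def]]
    by (blast dest: has_derivative_continuous)
  from eventually_nhds_compose[OF this, of "\<lambda>z. \<exists>D. (f has_derivative D) (at z) \<and>
      (\<forall>u v. area_form (D u) (D v) = area_form u v)"] assms(1,3)
  have "\<forall>\<^sub>F z in nhds 0. \<exists>D. (f has_derivative D) (at (g z)) \<and>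
      (\<forall>u v. area_form (D u) (D v) = area_form u v)"
    by (simp add: symplectic_germ_def)
  then show ?thesis
    using assms(2) unfolding symplectic_germ_def
  proof eventually_elim
    case (elim z)
    then obtain D E where D: "(f has_derivative D) (at (g z))" "\<And>u v. area_form (D u) (D v) = area_form u v"
      and E: "(g has_derivative E) (at z)" "\<And>u v. area_form (E u) (E v) = area_form u v" by blast
    show ?case
      using has_derivative_compose[OF E(1) D(1)] D(2) E(2) by (intro exI[of _ "\<lambda>u. D (E u)"]) simp
  qed
qed

lemma local_inverse_derivative:
  fixes f g :: "'a::real_normed_vector \<Rightarrow> 'a"
  assumes "\<forall>\<^sub>F y in nhds z. f (g y) = y" "(g has_derivative E) (at z)" "(f has_derivative D) (at (g z))"
  shows "D (E u) = u"
proof -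
  have "((\<lambda>y. f (g y)) has_derivative (\<lambda>u. D (E u))) (at z)"
    by (rule has_derivative_compose[OF assms(2,3)])
  moreover have "((\<lambda>y. f (g y)) has_derivative (\<lambda>u. u)) (at z)"
    by (rule has_derivative_transform_eventually[OF has_derivative_ident])
      (use assms(1) eventually_nhds_x_imp_x[OF assms(1)] in \<open>auto simp: eventually_at_filter elim!: eventually_mono\<close>)
  ultimately have "(\<lambda>u. D (E u)) = (\<lambda>u. u)" by (rule has_derivative_unique)
  then show ?thesis by (rule fun_cong)
qed

lemma symplectic_germ_local_inverse:
  assumes "symplectic_germ f" "ra_germ g" "g 0 = 0" "\<forall>\<^sub>F z in nhds 0. f (g z) = z"
  shows "symplectic_germ g"
proof -
  obtain a b where ab: "ra_germ a" "ra_germ b"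
    and g: "\<forall>\<^sub>F z in nhds 0. (g has_derivative (\<lambda>u. a z * u + b z * cnj u)) (at z)"
    using ra_germ_derivative[OF assms(2)] .
  have "\<forall>\<^sub>F z in nhds 0. \<exists>D. (f has_derivative D) (at (g z)) \<and>
      (\<forall>u v. area_form (D u) (D v) = area_form u v)"
    using eventually_nhds_compose[OF ra_germ_isCont[OF assms(2)], of "\<lambda>z. \<exists>D. (f has_derivative D) (at z) \<and>
      (\<forall>u v. area_form (D u) (D v) = area_form u v)"] assms(1,3)
    by (simp add: symplectic_germ_def)
  then show ?thesis
    using g eventually_eventually[THEN iffD2, OF assms(4)] unfolding symplectic_germ_def
  proof eventually_elim
    case (elim z)
    obtain D where D: "(f has_derivative D) (at (g z))" "\<And>u v. area_form (D u) (D v) = area_form u v"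
      using elim(1) by blast
    let ?E = "\<lambda>u. a z * u + b z * cnj u"
    have "area_form (?E u) (?E v) = area_form u v" for u v
      using D(2)[of "?E u" "?E v"] local_inverse_derivative[OF elim(3,2) D(1)] by simp
    then show ?case using elim(2) by blast
  qed
qed

lemma ra_germ_of_real_isCont:
  assumes "ra_germ (\<lambda>z. of_real (B z))"
  shows "isCont B 0"
  using continuous_Re[OF ra_germ_isCont[OF assms]] by simp

text \<open>The Morse coordinate \<open>Z\<close> straightens \<open>I\<close>; its inverse distorts area by \<open>g\<close>, which is undone
  by a diffeomorphism permuting the circles.\<close>

lemma symplectic_straightening:
  fixes I :: "complex \<Rightarrow> real"
  assumes \<gamma>: "ra_germ \<gamma>" "\<gamma> 0 = 0" and B: "ra_germ (\<lambda>z. of_real (B z))" "B 0 > (0::real)"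
    and I: "\<forall>\<^sub>F z in nhds 0. I z = I 0 + Re (z\<^sup>2 * \<gamma> z) + (cmod z)\<^sup>2 * B z"
  obtains \<phi> \<psi> T where "ra_germ \<phi>" "ra_germ \<psi>" "\<phi> 0 = 0" "\<psi> 0 = 0"
    "(\<phi> has_derivative (\<lambda>h. h)) (at 0)" "(\<psi> has_derivative (\<lambda>h. h)) (at 0)"
    "\<forall>\<^sub>F z in nhds 0. \<psi> (\<phi> z) = z" "\<forall>\<^sub>F z in nhds 0. \<phi> (\<psi> z) = z"
    "symplectic_germ \<phi>" "\<forall>\<^sub>F z in nhds 0. (cmod (\<psi> z))\<^sup>2 = T (I z)"
proof -
  define b where "b = B 0"
  have b: "b > 0" using B by (simp add: b_def)
  \<comment> \<open>The Morse lemma expects 2 Re (\<alpha> z^2) and a coefficient of |z|^2 equal to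
    1 at the origin; dividing the quadratic part by b accounts for both constants.\<close>
  have "ra_germ (\<lambda>z. of_real (1 / (2 * b)) * \<gamma> z)" "of_real (1 / (2 * b)) * \<gamma> 0 = 0"
    by (rule ra_germ_mult[OF ra_germ_const \<gamma>(1)]) (simp add: \<gamma>)
  moreover have "ra_germ (\<lambda>z. of_real (B z / b))" "B 0 / b = 1"
    using ra_germ_mult[OF B(1) ra_germ_const[of "of_real (1 / b)"]] b by (simp_all add: b_def)
  ultimately obtain Z where Z: "ra_germ Z" "Z 0 = 0" "(Z has_derivative (\<lambda>h. h)) (at 0)"
    and ZI: "\<forall>\<^sub>F z in nhds 0. (cmod (Z z))\<^sup>2
      = 2 * Re (z\<^sup>2 * (of_real (1 / (2 * b)) * \<gamma> z)) + (cmod z)\<^sup>2 * (B z / b)"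
    by (rule morse_lemma) blast
  have ZI: "\<forall>\<^sub>F z in nhds 0. (cmod (Z z))\<^sup>2 = (I z - I 0) / b"
    using ZI I
  proof eventually_elim
    case (elim z)
    have "z\<^sup>2 * (of_real (1 / (2 * b)) * \<gamma> z) = of_real (1 / (2 * b)) * (z\<^sup>2 * \<gamma> z)" by simp
    moreover have "2 * Re (of_real (1 / (2 * b)) * w) = Re w / b" for w by simp
    ultimately have "2 * Re (z\<^sup>2 * (of_real (1 / (2 * b)) * \<gamma> z)) = Re (z\<^sup>2 * \<gamma> z) / b"
      by (simp only:)
    moreover have "(x + r + c - x) / b = r / b + c / b" for x r c by (simp add: add_divide_distrib)
    ultimately show ?case by (simp only: elim(1,2) times_divide_eq_right)
  qed
  obtain k where k: "ra_germ k" "k 0 = 0" "(k has_derivative (\<lambda>u. u)) (at 0)"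
    "\<forall>\<^sub>F z in nhds 0. Z (k z) = z" "\<forall>\<^sub>F z in nhds 0. k (Z z) = z"
    using ra_germ_local_inverse[OF Z] .
  obtain c d where cd: "ra_germ c" "ra_germ d"
    and kD: "\<forall>\<^sub>F z in nhds 0. (k has_derivative (\<lambda>u. c z * u + d z * cnj u)) (at z)"
    using ra_germ_derivative[OF k(1)] .
  \<comment> \<open>The Jacobian determinant of k in terms of its Wirtinger derivatives.\<close>
  define g where "g = (\<lambda>z. (cmod (c z))\<^sup>2 - (cmod (d z))\<^sup>2)"
  have karea: "area_form (c z * u + d z * cnj u) (c z * v + d z * cnj v) = g z * area_form u v" for z u v
    unfolding area_form_def g_def cmod_power2 by (simp add: algebra_simps power2_eq_square)
  have "ra_germ (\<lambda>z. c z * cnj (c z) - d z * cnj (d z))"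
    by (intro ra_germ_diff ra_germ_mult ra_germ_cnj cd)
  then have g: "ra_germ (\<lambda>z. of_real (g z))"
    by (simp only: g_def of_real_diff complex_norm_square)
  have "(\<lambda>u. c 0 * u + d 0 * cnj u) = (\<lambda>u. 1 * u + 0 * cnj u)"
    using has_derivative_unique[OF eventually_nhds_x_imp_x[OF kD] k(3)] by simp
  from real_linear_form_unique[OF this] have g0: "g 0 = 1" by (simp add: g_def)
  obtain \<eta> S where \<eta>: "ra_germ \<eta>" "\<eta> 0 = 0" "(\<eta> has_derivative (\<lambda>h. h)) (at 0)"
    and S: "\<forall>\<^sub>F z in nhds 0. (cmod (\<eta> z))\<^sup>2 = S ((cmod z)\<^sup>2)"
    and \<eta>D: "\<forall>\<^sub>F z in nhds 0. \<exists>D. (\<eta> has_derivative D) (at z) \<and>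
       (\<forall>u v. area_form (D u) (D v) = g z * area_form u v)"
    using area_normalization[OF g g0] .
  obtain l where l: "ra_germ l" "l 0 = 0" "(l has_derivative (\<lambda>u. u)) (at 0)"
    "\<forall>\<^sub>F z in nhds 0. \<eta> (l z) = z" "\<forall>\<^sub>F z in nhds 0. l (\<eta> z) = z"
    using ra_germ_local_inverse[OF \<eta>] .
  have via: "\<forall>\<^sub>F z in nhds 0. P (h z)" if "\<forall>\<^sub>F z in nhds 0. P z" "ra_germ h" "h 0 = 0" for P h
    using eventually_nhds_compose[OF ra_germ_isCont[OF that(2)], of P] that by simp
  obtain a e where ae: "ra_germ a" "ra_germ e"
    and lD: "\<forall>\<^sub>F z in nhds 0. (l has_derivative (\<lambda>u. a z * u + e z * cnj u)) (at z)"
    using ra_germ_derivative[OF l(1)] .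
  \<comment> \<open>At l z both k and \<eta> multiply area by g (l z); since \<eta> (l z) = z, the
    map l divides by that factor before k restores it.\<close>
  have symp: "symplectic_germ (\<lambda>z. k (l z))"
    unfolding symplectic_germ_def
    using via[OF kD l(1,2)] via[OF \<eta>D l(1,2)] lD eventually_eventually[THEN iffD2, OF l(4)]
  proof eventually_elim
    case (elim z)
    let ?L = "\<lambda>u. a z * u + e z * cnj u"
    let ?K = "\<lambda>u. c (l z) * u + d (l z) * cnj u"
    obtain D where D: "(\<eta> has_derivative D) (at (l z))"
      "\<And>u v. area_form (D u) (D v) = g (l z) * area_form u v" using elim(2) by blast
    have "area_form (?K (?L u)) (?K (?L v)) = area_form u v" for u v
      using D(2)[of "?L u" "?L v"] local_inverse_derivative[OF elim(4,3) D(1)]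
      by (simp only: karea)
    then show ?case using has_derivative_compose[OF elim(3,1)] by blast
  qed
  show thesis
  proof (rule that[of "\<lambda>z. k (l z)" "\<lambda>z. \<eta> (Z z)" "\<lambda>x. S ((x - I 0) / b)"])
    show "ra_germ (\<lambda>z. k (l z))" "ra_germ (\<lambda>z. \<eta> (Z z))"
      by (rule ra_germ_compose[OF k(1) l(1,2)] ra_germ_compose[OF \<eta>(1) Z(1,2)])+
    show "k (l 0) = 0" "\<eta> (Z 0) = 0" by (simp_all add: k l \<eta> Z)
    show "((\<lambda>z. k (l z)) has_derivative (\<lambda>h. h)) (at 0)"
      using has_derivative_compose[OF l(3), of k "\<lambda>h. h"] k(3) l(2) by simp
    show "((\<lambda>z. \<eta> (Z z)) has_derivative (\<lambda>h. h)) (at 0)"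
      using has_derivative_compose[OF Z(3), of \<eta> "\<lambda>h. h"] \<eta>(3) Z(2) by simp
    show "\<forall>\<^sub>F z in nhds 0. \<eta> (Z (k (l z))) = z"
      using via[OF k(4) l(1,2)] l(4) by eventually_elim simp
    show "\<forall>\<^sub>F z in nhds 0. k (l (\<eta> (Z z))) = z"
      using via[OF l(5) Z(1,2)] k(5) by eventually_elim simp
    show "symplectic_germ (\<lambda>z. k (l z))" by (rule symp)
    show "\<forall>\<^sub>F z in nhds 0. (cmod (\<eta> (Z z)))\<^sup>2 = S ((I z - I 0) / b)"
      using via[OF S Z(1,2)] ZI by eventually_elim simp
  qed
qed

theorem theorem4p5:
  fixes f :: "complex \<Rightarrow> complex" and p q :: nat and I\<^sub>1 :: "complex \<Rightarrow> real"
  assumes "real_analytic_germ f"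
    and "symplectic_germ f"
    and "coprime p q" and "q \<ge> 3"
    and "elliptic_fixed_point f (real p / real q)"
    and "(f has_derivative (\<lambda>z. cis (2 * pi * (real p / real q)) * z)) (at 0)"
    and "real_analytic_germ I\<^sub>1"
    and "first_integral f I\<^sub>1"
    and "nondegenerate_local_min I\<^sub>1"
  shows "\<exists>(\<Omega> :: real \<Rightarrow> real) (F :: real fps) (g :: complex \<Rightarrow> complex).
           \<Omega> has_fps_expansion F \<and> \<Omega> 0 = 2 * pi * real p / real q \<and>
           (\<forall>r\<ge>0. \<forall>\<theta>. g (rcis r \<theta>) = rcis r (\<theta> + \<Omega> (r\<^sup>2))) \<and>
           analytic_symplectic_conjugate f g"
proof -
  define \<omega> where "\<omega> = 2 * pi * (real p / real q)"
  define \<mu> where "\<mu> = cis \<omega>"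
  have f: "ra_germ f" by (rule real_analytic_germ_imp_ra_germ[OF assms(1)])
  have f0: "f 0 = 0" and pq: "0 < real p / real q" "real p / real q < 1 / 2"
    using assms(5) unfolding elliptic_fixed_point_def by blast+
  have \<omega>: "0 < \<omega>" "\<omega> < pi"
    unfolding \<omega>_def using mult_pos_pos[of "2 * pi", OF _ pq(1)] mult_strict_left_mono[OF pq(2), of "2 * pi"]
    by simp_all
  have fD: "(f has_derivative (\<lambda>z. \<mu> * z)) (at 0)" using assms(6) by (simp add: \<mu>_def \<omega>_def)
  have \<mu>1: "norm \<mu> = 1" by (simp add: \<mu>_def)
  \<comment> \<open>An angle strictly between 0 and pi makes \<mu> nonreal, so \<mu> is neither 1
    nor -1.\<close>
  have "sin \<omega> > 0" using \<omega> by (intro sin_gt_zero)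
  then have "Im \<mu> \<noteq> 0" by (simp add: \<mu>_def)
  then have "\<mu>\<^sup>2 \<noteq> 1" by (auto simp: power2_eq_1_iff)
  have "ra_germ (\<lambda>z. of_real (I\<^sub>1 z))"
    by (rule real_analytic_germ_imp_ra_germ[OF real_analytic_germ_of_real[OF assms(7)]])
  then obtain m \<gamma> B where \<gamma>: "ra_germ \<gamma>" and B: "ra_germ (\<lambda>z. of_real (B z))"
    and I: "\<forall>\<^sub>F z in nhds 0. I\<^sub>1 z = I\<^sub>1 0 + Re (m * z) + Re (z\<^sup>2 * \<gamma> z) + (cmod z)\<^sup>2 * B z"
    by (rule of_real_taylor2) blast
  note Q = nondegenerate_local_min_quadratic[OF assms(9) ra_germ_isCont[OF \<gamma>] ra_germ_of_real_isCont[OF B] I]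
  have "Re (m * z) = 0" for z using Q(1)[of z] by (cases "z = 0") auto
  then have I: "\<forall>\<^sub>F z in nhds 0. I\<^sub>1 z = I\<^sub>1 0 + Re (z\<^sup>2 * \<gamma> z) + (cmod z)\<^sup>2 * B z"
    using I by simp
  have "(\<mu>\<^sup>2 - 1) * \<gamma> 0 = 0"
    by (rule invariant_quadratic_part[OF f f0 fD \<mu>1 ra_germ_isCont[OF \<gamma>] ra_germ_of_real_isCont[OF B] I])
      (use assms(8) in \<open>simp add: first_integral_def\<close>)
  then have \<gamma>0: "\<gamma> 0 = 0" using \<open>\<mu>\<^sup>2 \<noteq> 1\<close> by simp
  have B0: "B 0 > 0" using Q(2)[of 1] \<gamma>0 by simp
  obtain \<phi> \<psi> T where \<phi>\<psi>: "ra_germ \<phi>" "ra_germ \<psi>" "\<phi> 0 = 0" "\<psi> 0 = 0"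
    and \<phi>D: "(\<phi> has_derivative (\<lambda>h. h)) (at 0)" and \<psi>D: "(\<psi> has_derivative (\<lambda>h. h)) (at 0)"
    and inv: "\<forall>\<^sub>F z in nhds 0. \<psi> (\<phi> z) = z" "\<forall>\<^sub>F z in nhds 0. \<phi> (\<psi> z) = z"
    and symp: "symplectic_germ \<phi>" and T: "\<forall>\<^sub>F z in nhds 0. (cmod (\<psi> z))\<^sup>2 = T (I\<^sub>1 z)"
    using symplectic_straightening[OF \<gamma> \<gamma>0 B B0 I] .
  define G where "G = (\<lambda>z. \<psi> (f (\<phi> z)))"
  have f\<phi>: "ra_germ (\<lambda>z. f (\<phi> z))" "f (\<phi> 0) = 0"
    using ra_germ_compose[OF f \<phi>\<psi>(1,3)] \<phi>\<psi> f0 by auto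
  have G: "ra_germ G" unfolding G_def by (rule ra_germ_compose[OF \<phi>\<psi>(2) f\<phi>])
  have "((\<lambda>z. f (\<phi> z)) has_derivative (\<lambda>h. \<mu> * h)) (at 0)"
    using has_derivative_compose[OF \<phi>D, of f "\<lambda>h. \<mu> * h"] fD \<phi>\<psi>(3) by simp
  from has_derivative_compose[OF this, of \<psi> "\<lambda>h. h"] \<psi>D f\<phi>(2)
  have GD: "(G has_derivative (\<lambda>h. \<mu> * h)) (at 0)" by (simp add: G_def)
  have "symplectic_germ \<psi>" by (rule symplectic_germ_local_inverse[OF symp \<phi>\<psi>(2,4) inv(2)])
  from symplectic_germ_compose[OF this symplectic_germ_compose[OF assms(2) symp \<phi>\<psi>(3)] f\<phi>(2)]
  have Gs: "symplectic_germ G" unfolding G_def .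
  \<comment> \<open>The squared modulus of \<psi> is a function of \<open>I\<^sub>1\<close> alone,
    and f preserves \<open>I\<^sub>1\<close>.\<close>
  have circ: "\<forall>\<^sub>F z in nhds 0. (cmod (G z))\<^sup>2 = (cmod z)\<^sup>2"
  proof -
    have "\<forall>\<^sub>F z in nhds 0. (cmod (\<psi> (f (\<phi> z))))\<^sup>2 = T (I\<^sub>1 (f (\<phi> z)))"
      using eventually_nhds_compose[OF ra_germ_isCont[OF f\<phi>(1)], of "\<lambda>z. (cmod (\<psi> z))\<^sup>2 = T (I\<^sub>1 z)"] T f\<phi>(2)
      by simp
    moreover have "\<forall>\<^sub>F z in nhds 0. (cmod (\<psi> (\<phi> z)))\<^sup>2 = T (I\<^sub>1 (\<phi> z))"
      "\<forall>\<^sub>F z in nhds 0. I\<^sub>1 (f (\<phi> z)) = I\<^sub>1 (\<phi> z)"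
      using eventually_nhds_compose[OF ra_germ_isCont[OF \<phi>\<psi>(1)], of "\<lambda>z. (cmod (\<psi> z))\<^sup>2 = T (I\<^sub>1 z)"] T
        eventually_nhds_compose[OF ra_germ_isCont[OF \<phi>\<psi>(1)], of "\<lambda>z. I\<^sub>1 (f z) = I\<^sub>1 z"]
        assms(8)[unfolded first_integral_def] \<phi>\<psi>(3) by simp_all
    ultimately show ?thesis using inv(1) unfolding G_def by eventually_elim simp
  qed
  obtain F :: "real fps" where F: "fps_conv_radius F > 0" "fps_nth F 0 = 0"
    and GF: "\<forall>\<^sub>F z in nhds 0. G z = z * (\<mu> * exp (\<i> * of_real (eval_fps F ((cmod z)\<^sup>2))))"
    using circle_preserving_symplectic[OF G GD \<mu>1 circ Gs] .
  define \<Omega> where "\<Omega> = (\<lambda>x. \<omega> + eval_fps F x)"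
  \<comment> \<open>This total function has the polar form everywhere; agreement with G is claimed
    only near the origin.\<close>
  define g where "g = (\<lambda>z. z * cis (\<Omega> ((cmod z)\<^sup>2)))"
  have "\<Omega> has_fps_expansion (fps_const \<omega> + F)"
    unfolding \<Omega>_def by (intro has_fps_expansion_add has_fps_expansion_const eval_fps_has_fps_expansion F)
  moreover have "\<Omega> 0 = 2 * pi * real p / real q"
    by (simp add: \<Omega>_def \<omega>_def eval_fps_at_0 F)
  moreover have "\<forall>r\<ge>0. \<forall>\<theta>. g (rcis r \<theta>) = rcis r (\<theta> + \<Omega> (r\<^sup>2))"
    by (simp add: g_def rcis_def norm_mult cis_mult mult.assoc)
  moreover have "analytic_symplectic_conjugate f g"
  proof -
    have "\<forall>\<^sub>F z in nhds 0. \<psi> (f (\<phi> z)) = g z"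
      using GF
    proof eventually_elim
      case (elim z)
      then show ?case
        by (simp add: G_def g_def \<Omega>_def \<mu>_def cis_conv_exp exp_add distrib_left)
    qed
    moreover have "\<forall>\<^sub>F z in nhds 0. \<psi> (\<phi> z) = z \<and> \<phi> (\<psi> z) = z"
      using inv by eventually_elim simp
    ultimately show ?thesis
      unfolding analytic_symplectic_conjugate_def
      using \<phi>\<psi> symp ra_germ_imp_real_analytic_germ by blast
  qed
  ultimately show ?thesis by blast
qed

end
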